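(* Let $A$ be a complex affine Poisson algebra. Then $A$ satisfies the Poisson Dixmier-Moeglin equivalence if and only if the following holds: for every Poisson prime ideal $P$ of $A$, if the set of Poisson prime ideals of $A$ that are minimal among the Poisson prime ideals properly containing $P$ has cardinality strictly less than $|\mathbb{C}|$, then this set is finite.
   Context: A complex affine Poisson algebra is a finitely generated commutative $\mathbb{C}$-algebra $A$ with a bilinear map $\{-,-\}:A\times A\to A$ that is both a Lie bracket and a biderivation. An ideal $I$ is a Poisson ideal if $\{I,A\}\subseteq I$. The Poisson core of an ideal $J$ is the largest Poisson ideal contained in $J$. A Poisson primitive ideal is the Poisson core of a maximal ideal of $A$. A Poisson prime ideal is a prime ideal that is also a Poisson ideal; ${\rm P.spec}\,A$ denotes the set of Poisson prime ideals with the subspace topology from ${\rm spec}\,A$ (Zariski topology). The Poisson center of a Poisson algebra $B$ is $Z_P(B)=\{a\in B : \{a,b\}=0\ \forall b\in B\}$. For a Poisson prime ideal $P$, the Poisson bracket of $A$ induces one on $A/P$ and extends uniquely to ${\rm Frac}(A/P)$; $P$ is Poisson rational if $Z_P({\rm Frac}(A/P))=\mathbb{C}$. A Poisson prime ideal $P$ is locally closed if $\{P\}$ is a locally closed subset of ${\rm P.spec}\,A$ (the intersection of an open and a closed subset). $A$ satisfies the Poisson Dixmier-Moeglin equivalence if the following three sets of Poisson prime ideals coincide: the locally closed Poisson prime ideals, the Poisson primitive ideals, and the Poisson rational ideals. *)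

theory Defs
  imports
    "HOL-Algebra.Algebraic_Closure_Type"
    "HOL-Algebra.QuotRing"
    "HOL-Algebra.Module"
    "HOL-Algebra.Generated_Rings"
    "HOL-Library.Equipollence"
    "HOL-Analysis.Abstract_Topology"
begin

section \<open>Complex affine Poisson algebras\<close>

record 'a poisson_algebra = "(complex, 'a) module" +
  bracket :: "'a \<Rightarrow> 'a \<Rightarrow> 'a" (\<open>\<lbrace>_,/ _\<rbrace>\<index>\<close>)

locale complex_poisson_algebra =
  Module.algebra "ring_of_type_algebra :: complex ring" A
  for A :: "('a, 'm) poisson_algebra_scheme" (structure) +
  assumes bracket_closed:
      "\<lbrakk>x \<in> carrier A; y \<in> carrier A\<rbrakk> \<Longrightarrow> \<lbrace>x, y\<rbrace> \<in> carrier A"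
    and bracket_add_left:
      "\<lbrakk>x \<in> carrier A; y \<in> carrier A; z \<in> carrier A\<rbrakk> \<Longrightarrow>
        \<lbrace>x \<oplus> y, z\<rbrace> = \<lbrace>x, z\<rbrace> \<oplus> \<lbrace>y, z\<rbrace>"
    and bracket_add_right:
      "\<lbrakk>x \<in> carrier A; y \<in> carrier A; z \<in> carrier A\<rbrakk> \<Longrightarrow>
        \<lbrace>x, y \<oplus> z\<rbrace> = \<lbrace>x, y\<rbrace> \<oplus> \<lbrace>x, z\<rbrace>"
    and bracket_smult_left:
      "\<lbrakk>x \<in> carrier A; y \<in> carrier A\<rbrakk> \<Longrightarrow> \<lbrace>c \<odot> x, y\<rbrace> = c \<odot> \<lbrace>x, y\<rbrace>"
    and bracket_smult_right:
      "\<lbrakk>x \<in> carrier A; y \<in> carrier A\<rbrakk> \<Longrightarrow> \<lbrace>x, c \<odot> y\<rbrace> = c \<odot> \<lbrace>x, y\<rbrace>"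
    and bracket_alternating:
      "x \<in> carrier A \<Longrightarrow> \<lbrace>x, x\<rbrace> = \<zero>"
    and bracket_jacobi:
      "\<lbrakk>x \<in> carrier A; y \<in> carrier A; z \<in> carrier A\<rbrakk> \<Longrightarrow>
        \<lbrace>x, \<lbrace>y, z\<rbrace>\<rbrace> \<oplus> \<lbrace>y, \<lbrace>z, x\<rbrace>\<rbrace> \<oplus> \<lbrace>z, \<lbrace>x, y\<rbrace>\<rbrace> = \<zero>"
    and bracket_leibniz_left:
      "\<lbrakk>x \<in> carrier A; y \<in> carrier A; z \<in> carrier A\<rbrakk> \<Longrightarrow>
        \<lbrace>x \<otimes> y, z\<rbrace> = (x \<otimes> \<lbrace>y, z\<rbrace>) \<oplus> (\<lbrace>x, z\<rbrace> \<otimes> y)"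
    and bracket_leibniz_right:
      "\<lbrakk>x \<in> carrier A; y \<in> carrier A; z \<in> carrier A\<rbrakk> \<Longrightarrow>
        \<lbrace>x, y \<otimes> z\<rbrace> = (\<lbrace>x, y\<rbrace> \<otimes> z) \<oplus> (y \<otimes> \<lbrace>x, z\<rbrace>)"

text \<open>The \<open>\<complex>\<close>-subalgebra generated by \<open>S\<close> is the subring generated by \<open>S\<close> and the scalars.\<close>

definition scalars :: "('a, 'm) poisson_algebra_scheme \<Rightarrow> 'a set" where
  "scalars A = {c \<odot>\<^bsub>A\<^esub> \<one>\<^bsub>A\<^esub> |c. True}"

locale complex_affine_poisson_algebra = complex_poisson_algebra +
  assumes finitely_generated:
    "\<exists>S. finite S \<and> S \<subseteq> carrier A \<and> generate_ring A (scalars A \<union> S) = carrier A"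

section \<open>Poisson ideals, Poisson cores, Poisson primitive ideals\<close>

definition poisson_ideal :: "('a, 'm) poisson_algebra_scheme \<Rightarrow> 'a set \<Rightarrow> bool" where
  "poisson_ideal A I \<longleftrightarrow> ideal I A \<and> (\<forall>x\<in>I. \<forall>y\<in>carrier A. \<lbrace>x, y\<rbrace>\<^bsub>A\<^esub> \<in> I)"

definition poisson_core :: "('a, 'm) poisson_algebra_scheme \<Rightarrow> 'a set \<Rightarrow> 'a set" where
  "poisson_core A J = (GREATEST I. poisson_ideal A I \<and> I \<subseteq> J)"

definition poisson_primitive :: "('a, 'm) poisson_algebra_scheme \<Rightarrow> 'a set \<Rightarrow> bool" where
  "poisson_primitive A P \<longleftrightarrow> (\<exists>M. maximalideal M A \<and> P = poisson_core A M)"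

section \<open>The Poisson prime spectrum\<close>

definition prime_spec :: "('a, 'm) ring_scheme \<Rightarrow> 'a set set" where
  "prime_spec R = {P. primeideal P R}"

definition zariski_topology :: "('a, 'm) ring_scheme \<Rightarrow> 'a set topology" where
  "zariski_topology R =
    topology (\<lambda>U. \<exists>S\<subseteq>carrier R. U = prime_spec R - {P \<in> prime_spec R. S \<subseteq> P})"

lemma istopology_zariski:
  "istopology (\<lambda>U. \<exists>S\<subseteq>carrier R. U = prime_spec R - {P \<in> prime_spec R. S \<subseteq> P})"
proof -
  let ?D = "\<lambda>S. prime_spec R - {P \<in> prime_spec R. S \<subseteq> P}"
  have inter: "?D S \<inter> ?D T = ?D {s \<otimes>\<^bsub>R\<^esub> t |s t. s \<in> S \<and> t \<in> T}"
    if S: "S \<subseteq> carrier R" and T: "T \<subseteq> carrier R" for S T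
  proof -
    let ?ST = "{s \<otimes>\<^bsub>R\<^esub> t |s t. s \<in> S \<and> t \<in> T}"
    have "?ST \<subseteq> P \<longleftrightarrow> S \<subseteq> P \<or> T \<subseteq> P" if "primeideal P R" for P
    proof -
      interpret primeideal P R by (rule that)
      show ?thesis
      proof
        assume ST: "?ST \<subseteq> P"
        show "S \<subseteq> P \<or> T \<subseteq> P"
        proof (rule ccontr)
          assume "\<not> ?thesis"
          then obtain s t where "s \<in> S" "t \<in> T" "s \<notin> P" "t \<notin> P" by blast
          with ST S T I_prime[of s t] show False by blast
        qed
      qed (use S T I_l_closed I_r_closed in blast)
    qed
    then show ?thesis unfolding prime_spec_def by blast
  qed
  have prod_closed: "{s \<otimes>\<^bsub>R\<^esub> t |s t. s \<in> S \<and> t \<in> T} \<subseteq> carrier R"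
    if "S \<subseteq> carrier R" "T \<subseteq> carrier R" "cring R" for S T
  proof -
    interpret cring R by fact
    show ?thesis using that by auto
  qed
  show ?thesis
    unfolding istopology_def
  proof (intro conjI allI impI)
    fix U V
    assume "\<exists>S\<subseteq>carrier R. U = ?D S" "\<exists>T\<subseteq>carrier R. V = ?D T"
    then obtain S T where ST: "S \<subseteq> carrier R" "U = ?D S" "T \<subseteq> carrier R" "V = ?D T"
      by blast
    show "\<exists>S\<subseteq>carrier R. U \<inter> V = ?D S"
    proof (cases "prime_spec R = {}")
      case True
      then show ?thesis using ST by auto
    next
      case False
      then have "cring R"
        by (auto simp: prime_spec_def primeideal_def)
      then show ?thesis
        using inter[of S T] prod_closed[of S T] ST
        by (intro exI[of _ "{s \<otimes>\<^bsub>R\<^esub> t |s t. s \<in> S \<and> t \<in> T}"]) simp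
    qed
  next
    fix \<U>
    assume "\<forall>U\<in>\<U>. \<exists>S\<subseteq>carrier R. U = ?D S"
    then obtain S where S: "\<And>U. U \<in> \<U> \<Longrightarrow> S U \<subseteq> carrier R \<and> U = ?D (S U)"
      by metis
    have "\<Union>\<U> = ?D (\<Union>U\<in>\<U>. S U)"
    proof
      show "\<Union>\<U> \<subseteq> ?D (\<Union>U\<in>\<U>. S U)" using S by blast
      show "?D (\<Union>U\<in>\<U>. S U) \<subseteq> \<Union>\<U>" using S by blast
    qed
    moreover have "(\<Union>U\<in>\<U>. S U) \<subseteq> carrier R" using S by blast
    ultimately show "\<exists>S\<subseteq>carrier R. \<Union>\<U> = ?D S" by blast
  qed
qed

definition Pspec :: "('a, 'm) poisson_algebra_scheme \<Rightarrow> 'a set set" where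
  "Pspec A = {P. primeideal P A \<and> poisson_ideal A P}"

definition Pspec_topology :: "('a, 'm) poisson_algebra_scheme \<Rightarrow> 'a set topology" where
  "Pspec_topology A = subtopology (zariski_topology A) (Pspec A)"

definition locally_closed_in :: "'x topology \<Rightarrow> 'x set \<Rightarrow> bool" where
  "locally_closed_in T S \<longleftrightarrow> (\<exists>U C. openin T U \<and> closedin T C \<and> S = U \<inter> C)"

definition poisson_locally_closed :: "('a, 'm) poisson_algebra_scheme \<Rightarrow> 'a set \<Rightarrow> bool" where
  "poisson_locally_closed A P \<longleftrightarrow> P \<in> Pspec A \<and> locally_closed_in (Pspec_topology A) {P}"

section \<open>Quotients, fraction fields and Poisson rationality\<close>

definition poisson_quot ::
  "('a, 'm) poisson_algebra_scheme \<Rightarrow> 'a set \<Rightarrow> 'a set poisson_algebra" where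
  "poisson_quot A P =
    \<lparr>carrier = carrier (A Quot P),
     monoid.mult = monoid.mult (A Quot P),
     monoid.one = \<one>\<^bsub>A Quot P\<^esub>,
     ring.zero = \<zero>\<^bsub>A Quot P\<^esub>,
     ring.add = ring.add (A Quot P),
     module.smult = (\<lambda>c U. \<Union>x\<in>U. P +>\<^bsub>A\<^esub> (c \<odot>\<^bsub>A\<^esub> x)),
     bracket = (\<lambda>U V. \<Union>x\<in>U. \<Union>y\<in>V. P +>\<^bsub>A\<^esub> \<lbrace>x, y\<rbrace>\<^bsub>A\<^esub>)\<rparr>"

text \<open>
  Fractions \<open>a/s\<close> over a domain \<open>D\<close> are classes of pairs \<open>(a, s)\<close> with \<open>s \<noteq> 0\<close>.
\<close>

definition frac_pairs :: "('a, 'm) ring_scheme \<Rightarrow> ('a \<times> 'a) set" where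
  "frac_pairs D = carrier D \<times> (carrier D - {\<zero>\<^bsub>D\<^esub>})"

definition frac_rel :: "('a, 'm) ring_scheme \<Rightarrow> (('a \<times> 'a) \<times> ('a \<times> 'a)) set" where
  "frac_rel D = {((a, s), (b, t)). (a, s) \<in> frac_pairs D \<and> (b, t) \<in> frac_pairs D \<and>
     a \<otimes>\<^bsub>D\<^esub> t = b \<otimes>\<^bsub>D\<^esub> s}"

definition fraction :: "('a, 'm) ring_scheme \<Rightarrow> 'a \<Rightarrow> 'a \<Rightarrow> ('a \<times> 'a) set" where
  "fraction D a s = frac_rel D `` {(a, s)}"

text \<open>
  The biderivation property forces the quotient rule
  \<open>{a/s, b} = (s{a, b} - a{s, b}) / s\<^sup>2\<close> in each argument; applying it in both arguments
  gives the formula for the bracket, the only one extending the bracket of \<open>D\<close>.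
\<close>

definition poisson_frac ::
  "('a, 'm) poisson_algebra_scheme \<Rightarrow> ('a \<times> 'a) set poisson_algebra" where
  "poisson_frac D =
    \<lparr>carrier = frac_pairs D // frac_rel D,
     monoid.mult = (\<lambda>U V. \<Union>(a, s)\<in>U. \<Union>(b, t)\<in>V.
       fraction D (a \<otimes>\<^bsub>D\<^esub> b) (s \<otimes>\<^bsub>D\<^esub> t)),
     monoid.one = fraction D \<one>\<^bsub>D\<^esub> \<one>\<^bsub>D\<^esub>,
     ring.zero = fraction D \<zero>\<^bsub>D\<^esub> \<one>\<^bsub>D\<^esub>,
     ring.add = (\<lambda>U V. \<Union>(a, s)\<in>U. \<Union>(b, t)\<in>V.
       fraction D ((a \<otimes>\<^bsub>D\<^esub> t) \<oplus>\<^bsub>D\<^esub> (b \<otimes>\<^bsub>D\<^esub> s)) (s \<otimes>\<^bsub>D\<^esub> t)),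
     module.smult = (\<lambda>c U. \<Union>(a, s)\<in>U. fraction D (c \<odot>\<^bsub>D\<^esub> a) s),
     bracket = (\<lambda>U V. \<Union>(a, s)\<in>U. \<Union>(b, t)\<in>V.
       fraction D
         ((((s \<otimes>\<^bsub>D\<^esub> t) \<otimes>\<^bsub>D\<^esub> \<lbrace>a, b\<rbrace>\<^bsub>D\<^esub>)
           \<ominus>\<^bsub>D\<^esub> ((s \<otimes>\<^bsub>D\<^esub> b) \<otimes>\<^bsub>D\<^esub> \<lbrace>a, t\<rbrace>\<^bsub>D\<^esub>)
           \<ominus>\<^bsub>D\<^esub> ((a \<otimes>\<^bsub>D\<^esub> t) \<otimes>\<^bsub>D\<^esub> \<lbrace>s, b\<rbrace>\<^bsub>D\<^esub>))
           \<oplus>\<^bsub>D\<^esub> ((a \<otimes>\<^bsub>D\<^esub> b) \<otimes>\<^bsub>D\<^esub> \<lbrace>s, t\<rbrace>\<^bsub>D\<^esub>))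
         ((s \<otimes>\<^bsub>D\<^esub> s) \<otimes>\<^bsub>D\<^esub> (t \<otimes>\<^bsub>D\<^esub> t)))\<rparr>"

definition poisson_center :: "('a, 'm) poisson_algebra_scheme \<Rightarrow> 'a set" where
  "poisson_center B = {x \<in> carrier B. \<forall>y\<in>carrier B. \<lbrace>x, y\<rbrace>\<^bsub>B\<^esub> = \<zero>\<^bsub>B\<^esub>}"

definition poisson_rational :: "('a, 'm) poisson_algebra_scheme \<Rightarrow> 'a set \<Rightarrow> bool" where
  "poisson_rational A P \<longleftrightarrow> P \<in> Pspec A \<and>
     poisson_center (poisson_frac (poisson_quot A P)) = scalars (poisson_frac (poisson_quot A P))"

section \<open>The Poisson Dixmier-Moeglin equivalence\<close>

definition poisson_dixmier_moeglin :: "('a, 'm) poisson_algebra_scheme \<Rightarrow> bool" where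
  "poisson_dixmier_moeglin A \<longleftrightarrow>
     {P. poisson_locally_closed A P} = {P. poisson_primitive A P} \<and>
     {P. poisson_primitive A P} = {P. poisson_rational A P}"

definition minimal_Pspec_over ::
  "('a, 'm) poisson_algebra_scheme \<Rightarrow> 'a set \<Rightarrow> 'a set set" where
  "minimal_Pspec_over A P =
     {Q \<in> Pspec A. P \<subset> Q \<and> \<not> (\<exists>Q'\<in>Pspec A. P \<subset> Q' \<and> Q' \<subset> Q)}"

end

theory Submission
  imports Defs
    "HOL-Computational_Algebra.Fundamental_Theorem_Algebra"
    "HOL-Library.Poly_Mapping"
    "HOL-Analysis.Continuum_Not_Denumerable"
begin

text \<open>
  Only the derivations \<open>{-, y}\<close> of \<open>A\<close> matter, so the argument is carried out for differential
  ideals. To compute in a type of class \<open>comm_ring_1\<close>, \<open>A\<close> is presented as a quotient of a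
  polynomial ring by an ideal \<open>K\<close>, the lifted operators being derivations modulo \<open>K\<close> only.

  Let \<open>P\<close> be a Poisson prime. If \<open>P\<close> is rational, then for every finite-dimensional \<open>V \<subseteq> A\<close> a
  Wronskian of a basis of \<open>V\<close> modulo \<open>P\<close> lies outside \<open>P\<close> but in every Poisson ideal \<open>Q \<supseteq> P\<close>
  with \<open>Q \<inter> V\<close> not contained in \<open>P\<close>. As \<open>A\<close> has countable dimension, countably many elements
  outside \<open>P\<close> meet every Poisson ideal properly containing \<open>P\<close>, and each of them lies in only
  finitely many of the Poisson primes minimal over \<open>P\<close>, by noetherianity. So there are countably
  many of these; if there are finitely many, then \<open>P\<close> is locally closed, because chains of primes
  are finite. Locally closed primes are primitive and primitive ones rational.

  Conversely, if fewer than \<open>|\<complex>|\<close> Poisson primes are minimal over \<open>P\<close>, pick an element outside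
  \<open>P\<close> in each. Since \<open>A\<close> has countable dimension, some maximal ideal containing \<open>P\<close> avoids all of
  them; its core is \<open>P\<close>, so \<open>P\<close> is primitive. If \<open>P\<close> is then locally closed, noetherianity
  yields finiteness.
\<close>

section \<open>Ideals of subrings and the Hilbert basis theorem\<close>

text \<open>A type cannot depend on the chosen generators, so the polynomial ring has a variable for
  every value of the element type of \<open>A\<close>. In general it is not noetherian, and
  generation by a finite set \<open>G\<close> holds only modulo \<open>K\<close>. Chain conditions
  and dimension counts are therefore made in the subalgebra generated by \<open>G\<close>, which
  maps onto the quotient by \<open>K\<close>. Lifts of brackets are chosen arbitrarily, not even
  additively; hence computations carry correction terms lying in \<open>K\<close>, and every ideal
  of interest contains \<open>K\<close>. Cardinality enters through one count. Modulo
  \<open>K\<close> the ring is the union of the spans of monomials with bounded exponents, one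
  finite-dimensional space for each natural number. When all complex scalars are distributed over
  fewer than continuum many denominators and countably many such spaces, infinitely many of them
  share both, and linear dependence there yields an algebraic equation.\<close>

definition is_subring :: "'r::comm_ring_1 set \<Rightarrow> bool" where
  "is_subring B \<longleftrightarrow> 0 \<in> B \<and> 1 \<in> B \<and> (\<forall>a\<in>B. - a \<in> B) \<and>
     (\<forall>a\<in>B. \<forall>b\<in>B. a + b \<in> B \<and> a * b \<in> B)"

definition ideal_in :: "'r::comm_ring_1 set \<Rightarrow> 'r set \<Rightarrow> bool" where
  "ideal_in B I \<longleftrightarrow> I \<subseteq> B \<and> 0 \<in> I \<and> (\<forall>a\<in>I. \<forall>b\<in>I. a + b \<in> I) \<and> (\<forall>r\<in>B. \<forall>a\<in>I. r * a \<in> I)"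

text \<open>Subrings are sets inside one ring type, so that generators can be adjoined one at a time
  by an induction that never changes the type.\<close>

definition noetherian_subring :: "'r::comm_ring_1 set \<Rightarrow> bool" where
  "noetherian_subring B \<longleftrightarrow>
     (\<forall>I. (\<forall>n::nat. ideal_in B (I n) \<and> I n \<subseteq> I (Suc n)) \<longrightarrow> (\<exists>n. \<forall>k\<ge>n. I k = I n))"

text \<open>Values in the ring take the place of formal polynomials. Since \<open>x\<close> may
  satisfy relations over \<open>B\<close>, an element can have many such expressions, and
  \<open>n\<close> is a bound on one of them rather than a degree.\<close>

fun polys_below :: "'r::comm_ring_1 set \<Rightarrow> 'r \<Rightarrow> nat \<Rightarrow> 'r set" where
  "polys_below B x 0 = {0}"
| "polys_below B x (Suc n) = {p + b * x ^ n |p b. p \<in> polys_below B x n \<and> b \<in> B}"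

text \<open>As expressions are not unique, an element has no leading coefficient of its own; the
  coefficients of \<open>x ^ n\<close> over all expressions of elements of \<open>I\<close> are
  collected instead.\<close>

definition lead_coeffs :: "'r::comm_ring_1 set \<Rightarrow> 'r \<Rightarrow> nat \<Rightarrow> 'r set \<Rightarrow> 'r set" where
  "lead_coeffs B x n I = {b \<in> B. \<exists>p\<in>polys_below B x n. p + b * x ^ n \<in> I}"

lemma ideal_in_uminus: "is_subring B \<Longrightarrow> ideal_in B I \<Longrightarrow> a \<in> I \<Longrightarrow> - a \<in> I"
  unfolding is_subring_def ideal_in_def by (metis mult_minus1)

lemma ideal_in_diff: "is_subring B \<Longrightarrow> ideal_in B I \<Longrightarrow> a \<in> I \<Longrightarrow> b \<in> I \<Longrightarrow> a - b \<in> I"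
  by (metis diff_conv_add_uminus ideal_in_def ideal_in_uminus)

lemma polys_below_SucI:
  "p \<in> polys_below B x n \<Longrightarrow> b \<in> B \<Longrightarrow> p + b * x ^ n \<in> polys_below B x (Suc n)"
  by auto

lemma polys_below_add:
  assumes B: "is_subring B"
  shows "p \<in> polys_below B x n \<Longrightarrow> q \<in> polys_below B x n \<Longrightarrow> p + q \<in> polys_below B x n"
proof (induction n arbitrary: p q)
  case (Suc n)
  then obtain p' b q' c where "p = p' + b * x ^ n" "q = q' + c * x ^ n"
    "p' \<in> polys_below B x n" "q' \<in> polys_below B x n" "b \<in> B" "c \<in> B" by auto
  moreover from this have "p + q = (p' + q') + (b + c) * x ^ n" by (simp add: algebra_simps)
  moreover have "b + c \<in> B" using B calculation(5,6) by (simp add: is_subring_def)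
  ultimately show ?case using Suc.IH[of p' q'] polys_below_SucI by metis
qed simp

lemma polys_below_mult:
  assumes B: "is_subring B" and c: "c \<in> B"
  shows "p \<in> polys_below B x n \<Longrightarrow> c * p \<in> polys_below B x n"
proof (induction n arbitrary: p)
  case (Suc n)
  then obtain p' b where "p = p' + b * x ^ n" "p' \<in> polys_below B x n" "b \<in> B" by auto
  moreover from this have "c * p = c * p' + (c * b) * x ^ n" by (simp add: algebra_simps)
  moreover have "c * b \<in> B" using B c calculation(3) by (simp add: is_subring_def)
  ultimately show ?case using Suc.IH[of p'] polys_below_SucI by metis
qed simp

lemma polys_below_diff:
  assumes "is_subring B" "p \<in> polys_below B x n" "q \<in> polys_below B x n"
  shows "p - q \<in> polys_below B x n"
proof -
  have "-1 \<in> B" using assms(1) by (auto simp: is_subring_def)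
  then have "- q \<in> polys_below B x n"
    using polys_below_mult[OF assms(1) _ assms(3), of "-1"] by simp
  then show ?thesis using polys_below_add[OF assms(1,2), of "- q"] by simp
qed

lemma polys_below_Suc: "is_subring B \<Longrightarrow> p \<in> polys_below B x n \<Longrightarrow> p \<in> polys_below B x (Suc n)"
  using polys_below_SucI[of p B x n 0] by (simp add: is_subring_def del: polys_below.simps)

lemma polys_below_mono:
  "is_subring B \<Longrightarrow> n \<le> m \<Longrightarrow> p \<in> polys_below B x n \<Longrightarrow> p \<in> polys_below B x m"
proof (induction m)
  case (Suc m)
  then show ?case using polys_below_Suc[of B p x m] by (cases "n = Suc m") auto
qed simp

lemma polys_below_shift:
  assumes B: "is_subring B"
  shows "p \<in> polys_below B x n \<Longrightarrow> x * p \<in> polys_below B x (Suc n)"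
proof (induction n arbitrary: p)
  case 0
  then show ?case using B by (auto simp: is_subring_def intro!: exI[of _ 0])
next
  case (Suc n)
  then obtain p' b where p: "p = p' + b * x ^ n" "p' \<in> polys_below B x n" "b \<in> B" by auto
  then have "x * p = x * p' + b * x ^ Suc n" by (simp add: algebra_simps)
  with Suc.IH[OF p(2)] p(3) show ?case by (auto simp del: power_Suc)
qed

lemma polys_below_shift_power:
  assumes "is_subring B" "p \<in> polys_below B x n"
  shows "x ^ k * p \<in> polys_below B x (n + k)"
  using polys_below_shift[OF assms(1)] assms(2)
  by (induction k) (auto simp: mult.assoc simp del: polys_below.simps)

lemma polys_below_times:
  assumes B: "is_subring B" and q: "q \<in> polys_below B x k"
  shows "p \<in> polys_below B x n \<Longrightarrow> p * q \<in> polys_below B x (n + k)"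
proof (induction n arbitrary: p)
  case 0
  then show ?case using polys_below_mult[OF B _ q, of 0] B by (auto simp: is_subring_def)
next
  case (Suc n)
  then obtain p' b where p: "p = p' + b * x ^ n" "p' \<in> polys_below B x n" "b \<in> B" by auto
  have "p' * q \<in> polys_below B x (n + k)" by (rule Suc.IH[OF p(2)])
  moreover have "b * (x ^ n * q) \<in> polys_below B x (n + k)"
    using polys_below_mult[OF B p(3) polys_below_shift_power[OF B q, of n]] by (simp add: add.commute)
  ultimately have "p' * q + b * (x ^ n * q) \<in> polys_below B x (n + k)"
    by (rule polys_below_add[OF B])
  moreover have "p * q = p' * q + b * (x ^ n * q)" by (simp add: p(1) algebra_simps)
  ultimately show ?case using polys_below_mono[OF B, of "n + k" "Suc n + k"] by simp
qed

lemma ideal_in_lead_coeffs: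
  assumes B: "is_subring B" "B \<subseteq> C" "ideal_in C I"
  shows "ideal_in B (lead_coeffs B x n I)"
  unfolding ideal_in_def
proof (intro conjI ballI)
  show "lead_coeffs B x n I \<subseteq> B" by (auto simp: lead_coeffs_def)
  have "0 \<in> polys_below B x n"
    using polys_below_mono[OF B(1), of 0 n 0] by simp
  then show "0 \<in> lead_coeffs B x n I"
    using B by (auto simp: lead_coeffs_def is_subring_def ideal_in_def intro!: bexI[of _ 0])
next
  fix a b assume "a \<in> lead_coeffs B x n I" "b \<in> lead_coeffs B x n I"
  then obtain p q where "p \<in> polys_below B x n" "q \<in> polys_below B x n" "a \<in> B" "b \<in> B"
    "p + a * x ^ n \<in> I" "q + b * x ^ n \<in> I" by (auto simp: lead_coeffs_def)
  moreover from this have "(p + a * x ^ n) + (q + b * x ^ n) \<in> I" using B by (auto simp: ideal_in_def)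
  moreover have "(p + a * x ^ n) + (q + b * x ^ n) = (p + q) + (a + b) * x ^ n"
    by (simp add: algebra_simps)
  ultimately show "a + b \<in> lead_coeffs B x n I"
    using polys_below_add[OF B(1)] B(1)
    by (auto simp: lead_coeffs_def is_subring_def intro!: bexI[of _ "p + q"])
next
  fix r a assume r: "r \<in> B" and "a \<in> lead_coeffs B x n I"
  then obtain p where p: "p \<in> polys_below B x n" "a \<in> B" "p + a * x ^ n \<in> I"
    by (auto simp: lead_coeffs_def)
  then have "r * (p + a * x ^ n) \<in> I" using B r by (auto simp: ideal_in_def)
  then have "r * p + (r * a) * x ^ n \<in> I" by (simp add: algebra_simps)
  then show "r * a \<in> lead_coeffs B x n I"
    using polys_below_mult[OF B(1) r p(1)] B(1) p(2) r
    by (auto simp: lead_coeffs_def is_subring_def)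
qed

lemma lead_coeffs_Suc:
  assumes "is_subring B" "x \<in> C" "ideal_in C I"
  shows "lead_coeffs B x n I \<subseteq> lead_coeffs B x (Suc n) I"
proof
  fix b assume "b \<in> lead_coeffs B x n I"
  then obtain p where p: "p \<in> polys_below B x n" "b \<in> B" "p + b * x ^ n \<in> I"
    by (auto simp: lead_coeffs_def)
  then have "x * (p + b * x ^ n) \<in> I" using assms by (auto simp: ideal_in_def)
  then have "x * p + b * x ^ Suc n \<in> I" by (simp add: algebra_simps)
  then show "b \<in> lead_coeffs B x (Suc n) I"
    using polys_below_shift[OF assms(1) p(1)] p(2) unfolding lead_coeffs_def by blast
qed

text \<open>Descent on the bound: an element of \<open>J\<close> shares its top coefficient with
  some element of \<open>I\<close>, and their difference is an element of \<open>J\<close> with a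
  smaller bound.\<close>

lemma polys_below_subset_of_lead_coeffs_eq:
  assumes B: "is_subring B" and C: "is_subring C" and IJ: "ideal_in C I" "ideal_in C J" "I \<subseteq> J"
    and lead: "\<And>n. lead_coeffs B x n I = lead_coeffs B x n J"
  shows "J \<inter> polys_below B x n \<subseteq> I"
proof (induction n)
  case 0
  then show ?case using IJ by (auto simp: ideal_in_def)
next
  case (Suc n)
  show ?case
  proof
    fix f assume f: "f \<in> J \<inter> polys_below B x (Suc n)"
    then obtain p b where p: "f = p + b * x ^ n" "p \<in> polys_below B x n" "b \<in> B" by auto
    then have "b \<in> lead_coeffs B x n I" unfolding lead using f by (auto simp: lead_coeffs_def)
    then obtain q where q: "q \<in> polys_below B x n" "q + b * x ^ n \<in> I" by (auto simp: lead_coeffs_def)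
    have "p - q \<in> polys_below B x n" by (rule polys_below_diff[OF B p(2) q(1)])
    moreover have "f - (q + b * x ^ n) \<in> J" using ideal_in_diff[OF C IJ(2)] f q IJ(3) by auto
    moreover have "f - (q + b * x ^ n) = p - q" by (simp add: p(1))
    ultimately have "p - q \<in> I" using Suc.IH by auto
    then have "(p - q) + (q + b * x ^ n) \<in> I" using q(2) IJ(1) unfolding ideal_in_def by blast
    then show "f \<in> I" by (simp add: p(1))
  qed
qed

text \<open>Hilbert's basis theorem. The ideals \<open>L n k\<close> of top coefficients grow in the
  exponent \<open>n\<close> and in the position \<open>k\<close> of the chain, and they determine
  the members of the chain; what is needed is one position from which all exponents are stationary
  at once.\<close>

theorem noetherian_subring_adjoin:
  assumes B: "is_subring B" and C: "is_subring C" and BC: "B \<subseteq> C" "x \<in> C"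
    and gen: "C \<subseteq> (\<Union>n. polys_below B x n)" and noeth: "noetherian_subring B"
  shows "noetherian_subring C"
  unfolding noetherian_subring_def
proof (intro allI impI)
  fix I :: "nat \<Rightarrow> 'a set"
  assume I: "\<forall>n. ideal_in C (I n) \<and> I n \<subseteq> I (Suc n)"
  define L where "L n k = lead_coeffs B x n (I k)" for n k
  have idL: "ideal_in B (L n k)" for n k
    unfolding L_def using ideal_in_lead_coeffs[OF B BC(1)] I by blast
  have I_mono: "I k \<subseteq> I l" if "k \<le> l" for k l
    using lift_Suc_mono_le[of I, OF _ that] I by blast
  have L_mono2: "L n k \<subseteq> L n l" if "k \<le> l" for n k l
    using I_mono[OF that] by (auto simp: L_def lead_coeffs_def)
  have L_mono1: "L n k \<subseteq> L m k" if "n \<le> m" for n m k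
    using lift_Suc_mono_le[of "\<lambda>n. L n k", OF _ that] lead_coeffs_Suc[OF B BC(2)] I
    by (auto simp: L_def)
  have stab: "\<exists>n. \<forall>k\<ge>n. J k = J n" if "\<And>n. ideal_in B (J n)" "\<And>n. J n \<subseteq> J (Suc n)" for J
    using noeth that unfolding noetherian_subring_def by blast
  \<comment> \<open>Stability of the diagonal settles all exponents from \<open>n0\<close> on and
    leaves finitely many rows to be treated one by one.\<close>
  have "\<exists>n. \<forall>k\<ge>n. L k k = L n n"
    by (rule stab) (use idL L_mono1 L_mono2 in \<open>blast intro: le_SucI\<close>)+
  then obtain n0 where n0: "\<And>k. k \<ge> n0 \<Longrightarrow> L k k = L n0 n0" by blast
  have diag: "L n k = L n0 n0" if "n \<ge> n0" "k \<ge> n0" for n k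
  proof
    have "L n k \<subseteq> L (max n k) (max n k)"
      using L_mono1[of n "max n k" k] L_mono2[of k "max n k" "max n k"] by auto
    also have "\<dots> = L n0 n0" using n0[of "max n k"] that by auto
    finally show "L n k \<subseteq> L n0 n0" .
    show "L n0 n0 \<subseteq> L n k"
      using L_mono1[OF that(1), of n0] L_mono2[OF that(2), of n] by auto
  qed
  have "\<forall>n. \<exists>m. \<forall>k\<ge>m. L n k = L n m"
    by (intro allI stab idL L_mono2) simp
  then obtain s where s: "\<And>n k. k \<ge> s n \<Longrightarrow> L n k = L n (s n)" by metis
  define M where "M = Max (insert n0 (s ` {..<n0}))"
  have M: "M \<ge> n0" "n < n0 \<Longrightarrow> M \<ge> s n" for n
    by (auto simp: M_def intro: Max_ge)
  have "L n M = L n k" if "k \<ge> M" for n k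
  proof (cases "n < n0")
    case True
    then show ?thesis using s[of n M] s[of n k] M(2)[of n] that by simp
  next
    case False
    then show ?thesis using diag[of n M] diag[of n k] M(1) that by simp
  qed
  then have lead: "lead_coeffs B x n (I M) = lead_coeffs B x n (I k)" if "k \<ge> M" for n k
    using that unfolding L_def by blast
  have "I k \<subseteq> I M" if k: "k \<ge> M" for k
  proof
    fix f assume f: "f \<in> I k"
    have "I k \<subseteq> C" using I by (simp add: ideal_in_def)
    then obtain n where "f \<in> polys_below B x n" using f gen by blast
    moreover have "I k \<inter> polys_below B x n \<subseteq> I M"
      by (rule polys_below_subset_of_lead_coeffs_eq[OF B C _ _ I_mono[OF k] lead[OF k]])
        (use I in auto)
    ultimately show "f \<in> I M" using f by blast
  qed
  then show "\<exists>n. \<forall>k\<ge>n. I k = I n" using I_mono by blast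
qed

section \<open>Finitely generated complex subalgebras are noetherian\<close>

inductive_set subalgebra_gen :: "(complex \<Rightarrow> 'r::comm_ring_1) \<Rightarrow> 'r set \<Rightarrow> 'r set" for \<iota> S where
  scalar: "\<iota> c \<in> subalgebra_gen \<iota> S"
| generator: "x \<in> S \<Longrightarrow> x \<in> subalgebra_gen \<iota> S"
| add: "a \<in> subalgebra_gen \<iota> S \<Longrightarrow> b \<in> subalgebra_gen \<iota> S \<Longrightarrow> a + b \<in> subalgebra_gen \<iota> S"
| mult: "a \<in> subalgebra_gen \<iota> S \<Longrightarrow> b \<in> subalgebra_gen \<iota> S \<Longrightarrow> a * b \<in> subalgebra_gen \<iota> S"

text \<open>Scalars act by multiplication with their images under \<open>\<iota>\<close>, so
  identities about scalars become ring identities.\<close>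

locale complex_structure_map =
  fixes \<iota> :: "complex \<Rightarrow> 'r::comm_ring_1"
  assumes iota_add: "\<iota> (a + b) = \<iota> a + \<iota> b"
    and iota_mult: "\<iota> (a * b) = \<iota> a * \<iota> b"
    and iota_one: "\<iota> 1 = 1"
begin

lemma iota_zero: "\<iota> 0 = 0"
  using iota_add[of 0 0] by simp

lemma iota_uminus: "\<iota> (- a) = - \<iota> a"
  using iota_add[of a "- a"] iota_zero by (simp add: eq_neg_iff_add_eq_0 add.commute)

lemma iota_diff: "\<iota> (a - b) = \<iota> a - \<iota> b"
  using iota_add[of a "- b"] by (simp add: iota_uminus)

lemma iota_of_nat: "\<iota> (of_nat n) = of_nat n"
  by (induction n) (simp_all add: iota_zero iota_one iota_add)

lemma is_subring_gen: "is_subring (subalgebra_gen \<iota> S)"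
proof -
  have "- a \<in> subalgebra_gen \<iota> S" if "a \<in> subalgebra_gen \<iota> S" for a
    using subalgebra_gen.mult[OF subalgebra_gen.scalar[of \<iota> "-1" S] that]
    by (simp add: iota_uminus iota_one)
  then show ?thesis
    using subalgebra_gen.scalar[of \<iota> 0 S] subalgebra_gen.scalar[of \<iota> 1 S]
    by (auto simp: is_subring_def iota_zero iota_one intro: subalgebra_gen.intros)
qed

lemma subalgebra_gen_mono: "S \<subseteq> Y \<Longrightarrow> subalgebra_gen \<iota> S \<subseteq> subalgebra_gen \<iota> Y"
proof
  fix a assume "S \<subseteq> Y" "a \<in> subalgebra_gen \<iota> S"
  from this(2,1) show "a \<in> subalgebra_gen \<iota> Y"
    by induction (auto intro: subalgebra_gen.intros)
qed

lemma subalgebra_gen_insert: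
  "subalgebra_gen \<iota> (insert x S) \<subseteq> (\<Union>n. polys_below (subalgebra_gen \<iota> S) x n)"
proof
  let ?B = "subalgebra_gen \<iota> S"
  note B = is_subring_gen[of S]
  have one: "b \<in> polys_below ?B x 1" if "b \<in> ?B" for b
    using that by (auto intro!: exI[of _ b])
  fix a assume "a \<in> subalgebra_gen \<iota> (insert x S)"
  then show "a \<in> (\<Union>n. polys_below ?B x n)"
  proof induction
    case (scalar c)
    then show ?case using one subalgebra_gen.scalar by blast
  next
    case (generator y)
    show ?case
    proof (cases "y = x")
      case True
      have "1 \<in> ?B" using B by (auto simp: is_subring_def)
      then have "x * 1 \<in> polys_below ?B x (Suc 1)" by (intro polys_below_shift[OF B] one)
      then show ?thesis using True by (auto simp del: polys_below.simps)
    next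
      case False
      then show ?thesis using generator one[OF subalgebra_gen.generator[of y S \<iota>]] by blast
    qed
  next
    case (add a b)
    then obtain n k where "a \<in> polys_below ?B x n" "b \<in> polys_below ?B x k" by blast
    then have "a + b \<in> polys_below ?B x (max n k)"
      using polys_below_mono[OF B, of n "max n k"] polys_below_mono[OF B, of k "max n k"]
      by (intro polys_below_add[OF B]) auto
    then show ?case by blast
  next
    case (mult a b)
    then show ?case using polys_below_times[OF B] by blast
  qed
qed

text \<open>The image of a field has no ideals besides zero and itself, so a chain can grow only
  once.\<close>

lemma noetherian_range_iota: "noetherian_subring (range \<iota>)"
  unfolding noetherian_subring_def
proof (intro allI impI)
  fix I :: "nat \<Rightarrow> 'r set"
  assume I: "\<forall>n. ideal_in (range \<iota>) (I n) \<and> I n \<subseteq> I (Suc n)"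
  have I_mono: "I k \<subseteq> I l" if "k \<le> l" for k l
    using lift_Suc_mono_le[of I, OF _ that] I by blast
  have sub: "I n \<subseteq> range \<iota>" and zero: "0 \<in> I n"
    and mul: "a \<in> I n \<Longrightarrow> \<iota> c * a \<in> I n" for n a c
    using I by (simp_all add: ideal_in_def)
  have full: "I n = range \<iota>" if a: "a \<in> I n" "a \<noteq> 0" for a n
  proof -
    obtain c where c: "a = \<iota> c" using sub[of n] a(1) by blast
    with a have "c \<noteq> 0" using iota_zero by auto
    have "\<iota> r \<in> I n" for r
    proof -
      have "\<iota> (r / c) * a \<in> I n" by (rule mul[OF a(1)])
      then show ?thesis using \<open>c \<noteq> 0\<close> by (simp add: c flip: iota_mult)
    qed
    then show ?thesis using sub by blast
  qed
  show "\<exists>n. \<forall>k\<ge>n. I k = I n"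
  proof (cases "\<forall>n. I n \<subseteq> {0}")
    case True
    then have "I n = {0}" for n using zero by blast
    then show ?thesis by simp
  next
    case False
    then obtain n a where "a \<in> I n" "a \<noteq> 0" by blast
    then have "I k = range \<iota>" if "k \<ge> n" for k using full[of a k] I_mono[OF that] by blast
    then show ?thesis by (metis order_refl)
  qed
qed

theorem noetherian_subalgebra_gen: "finite S \<Longrightarrow> noetherian_subring (subalgebra_gen \<iota> S)"
proof (induction rule: finite_induct)
  case empty
  have "subalgebra_gen \<iota> {} = range \<iota>"
  proof
    show "subalgebra_gen \<iota> {} \<subseteq> range \<iota>"
    proof
      fix a assume "a \<in> subalgebra_gen \<iota> {}"
      then show "a \<in> range \<iota>" by induction (auto simp flip: iota_add iota_mult)
    qed
  qed (auto intro: subalgebra_gen.scalar)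
  then show ?case using noetherian_range_iota by simp
next
  case (insert x S)
  show ?case
    by (rule noetherian_subring_adjoin[OF is_subring_gen is_subring_gen _ _
          subalgebra_gen_insert insert.IH])
      (auto intro: subalgebra_gen.generator subalgebra_gen_mono[THEN subsetD, rotated])
qed

end

section \<open>Differential ideals of affine algebras\<close>

abbreviation is_ideal :: "'r::comm_ring_1 set \<Rightarrow> bool" where
  "is_ideal \<equiv> ideal_in UNIV"

lemma is_ideal_iff:
  "is_ideal I \<longleftrightarrow> 0 \<in> I \<and> (\<forall>a\<in>I. \<forall>b\<in>I. a + b \<in> I) \<and> (\<forall>r. \<forall>a\<in>I. r * a \<in> I)"
  by (simp add: ideal_in_def)

lemma is_ideal_0: "is_ideal I \<Longrightarrow> 0 \<in> I"
  by (simp add: is_ideal_iff)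

lemma is_ideal_add: "is_ideal I \<Longrightarrow> a \<in> I \<Longrightarrow> b \<in> I \<Longrightarrow> a + b \<in> I"
  by (simp add: is_ideal_iff)

lemma is_ideal_lmult: "is_ideal I \<Longrightarrow> a \<in> I \<Longrightarrow> r * a \<in> I"
  by (simp add: is_ideal_iff)

lemma is_ideal_rmult: "is_ideal I \<Longrightarrow> a \<in> I \<Longrightarrow> a * r \<in> I"
  by (metis is_ideal_lmult mult.commute)

lemma is_ideal_diff: "is_ideal I \<Longrightarrow> a \<in> I \<Longrightarrow> b \<in> I \<Longrightarrow> a - b \<in> I"
  by (rule ideal_in_diff[of UNIV]) (simp_all add: is_subring_def)

lemma is_ideal_uminus: "is_ideal I \<Longrightarrow> a \<in> I \<Longrightarrow> - a \<in> I"
  using is_ideal_diff[of I 0 a] is_ideal_0[of I] by simp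

lemma is_ideal_sum: "is_ideal I \<Longrightarrow> (\<And>i. i \<in> A \<Longrightarrow> f i \<in> I) \<Longrightarrow> sum f A \<in> I"
  by (induction A rule: infinite_finite_induct) (auto intro: is_ideal_0 is_ideal_add)

lemma is_ideal_cong: "is_ideal I \<Longrightarrow> a - b \<in> I \<Longrightarrow> a \<in> I \<longleftrightarrow> b \<in> I"
  using is_ideal_add[of I "a - b" b] is_ideal_diff[of I a "a - b"] by auto

definition extend_ideal :: "'r::comm_ring_1 set \<Rightarrow> 'r \<Rightarrow> 'r set" where
  "extend_ideal I a = {i + r * a |i r. i \<in> I}"

lemma extend_ideal:
  assumes I: "is_ideal I"
  shows "is_ideal (extend_ideal I a)" "I \<subseteq> extend_ideal I a" "a \<in> extend_ideal I a"
    "\<And>J. is_ideal J \<Longrightarrow> I \<subseteq> J \<Longrightarrow> a \<in> J \<Longrightarrow> extend_ideal I a \<subseteq> J"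
proof -
  show "is_ideal (extend_ideal I a)"
    unfolding is_ideal_iff
  proof (intro conjI ballI allI)
    show "0 \<in> extend_ideal I a"
      using is_ideal_0[OF I] by (auto simp: extend_ideal_def intro!: exI[of _ 0])
  next
    fix x y assume "x \<in> extend_ideal I a" "y \<in> extend_ideal I a"
    then obtain i r j s where "x = i + r * a" "y = j + s * a" "i \<in> I" "j \<in> I"
      by (auto simp: extend_ideal_def)
    moreover from this have "x + y = (i + j) + (r + s) * a" by (simp add: algebra_simps)
    ultimately show "x + y \<in> extend_ideal I a"
      using is_ideal_add[OF I, of i j] unfolding extend_ideal_def by blast
  next
    fix t x assume "x \<in> extend_ideal I a"
    then obtain i r where "x = i + r * a" "i \<in> I" by (auto simp: extend_ideal_def)
    moreover from this have "t * x = t * i + (t * r) * a" by (simp add: algebra_simps)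
    ultimately show "t * x \<in> extend_ideal I a"
      using is_ideal_lmult[OF I, of i t] unfolding extend_ideal_def by blast
  qed
  have "x \<in> extend_ideal I a" if "x \<in> I" for x
  proof -
    have "x = x + 0 * a" by simp
    with that show ?thesis unfolding extend_ideal_def by blast
  qed
  then show "I \<subseteq> extend_ideal I a" by blast
  have "a = 0 + 1 * a" by simp
  then show "a \<in> extend_ideal I a"
    using is_ideal_0[OF I] unfolding extend_ideal_def by blast
  show "extend_ideal I a \<subseteq> J" if "is_ideal J" "I \<subseteq> J" "a \<in> J" for J
    using that by (auto simp: extend_ideal_def intro!: is_ideal_add is_ideal_lmult)
qed

section \<open>Linear algebra over the complex numbers and monomials of bounded exponents\<close>

sublocale complex_structure_map \<subseteq> vs: vector_space "\<lambda>c x. \<iota> c * x"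
  by unfold_locales (simp_all add: algebra_simps iota_add iota_mult iota_one)

context complex_structure_map
begin

text \<open>Indexed families are used because the vectors met later may coincide. A repeated vector
  is a dependence by itself; otherwise the image is too large to be independent in the span of
  \<open>T\<close>.\<close>

lemma linear_dependence:
  fixes u :: "nat \<Rightarrow> 'r"
  assumes T: "finite T" "card T < n" and u: "\<And>j. j < n \<Longrightarrow> u j \<in> vs.span T"
  shows "\<exists>c. (\<exists>j<n. c j \<noteq> 0) \<and> (\<Sum>j<n. \<iota> (c j) * u j) = 0"
proof (cases "inj_on u {..<n}")
  case True
  then have "card (u ` {..<n}) > card T" using T by (simp add: card_image)
  then have "vs.dependent (u ` {..<n})"
    using vs.independent_span_bound[OF T(1), of "u ` {..<n}"] u by force
  then obtain w where w: "\<exists>v\<in>u ` {..<n}. w v \<noteq> 0" "(\<Sum>v\<in>u ` {..<n}. \<iota> (w v) * v) = 0"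
    by (subst (asm) vs.dependent_finite) auto
  from w(2) have "(\<Sum>j<n. \<iota> (w (u j)) * u j) = 0"
    using True by (simp add: sum.reindex)
  then show ?thesis using w(1) by (intro exI[of _ "\<lambda>j. w (u j)"]) auto
next
  case False
  then obtain i j where ij: "i < n" "j < n" "i \<noteq> j" "u i = u j" by (auto simp: inj_on_def)
  define c :: "nat \<Rightarrow> complex" where "c k = (if k = i then 1 else 0) - (if k = j then 1 else 0)" for k
  have "\<iota> (c k) * u k = (if k = i then u i else 0) - (if k = j then u j else 0)" for k
    by (auto simp: c_def iota_diff iota_one iota_zero)
  then have "(\<Sum>k<n. \<iota> (c k) * u k) = 0" using ij by (simp add: sum_subtractf)
  moreover have "c i \<noteq> 0" using ij by (simp add: c_def)
  ultimately show ?thesis using ij by blast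
qed

text \<open>The bound is on each exponent and not on the total degree: counting is then immediate,
  and bounds still add under multiplication. Extensional exponent functions make the index set
  finite.\<close>

definition monomials :: "'r set \<Rightarrow> nat \<Rightarrow> 'r set" where
  "monomials G n = (\<lambda>e. \<Prod>g\<in>G. g ^ e g) ` (G \<rightarrow>\<^sub>E {..n})"

lemma finite_monomials: "finite G \<Longrightarrow> finite (monomials G n)"
  unfolding monomials_def by (intro finite_imageI finite_PiE) auto

lemma card_monomials: "finite G \<Longrightarrow> card (monomials G n) \<le> (n + 1) ^ card G"
proof -
  assume G: "finite G"
  have "card (monomials G n) \<le> card (G \<rightarrow>\<^sub>E {..n})"
    unfolding monomials_def by (intro card_image_le finite_PiE G) auto
  also have "\<dots> = (n + 1) ^ card G" by (subst card_PiE) (use G in auto)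
  finally show ?thesis .
qed

lemma monomialsI:
  assumes "\<And>g. g \<in> G \<Longrightarrow> e g \<le> n"
  shows "(\<Prod>g\<in>G. g ^ e g) \<in> monomials G n"
proof -
  have "(\<Prod>g\<in>G. g ^ e g) = (\<Prod>g\<in>G. g ^ restrict e G g)" by (intro prod.cong) auto
  moreover have "restrict e G \<in> G \<rightarrow>\<^sub>E {..n}" using assms by auto
  ultimately show ?thesis unfolding monomials_def by blast
qed

lemma monomials_mono: "n \<le> k \<Longrightarrow> monomials G n \<subseteq> monomials G k"
  unfolding monomials_def by (intro image_mono PiE_mono) auto

lemma span_monomials_mono: "n \<le> k \<Longrightarrow> vs.span (monomials G n) \<subseteq> vs.span (monomials G k)"
  by (intro vs.span_mono monomials_mono)

lemma monomials_times:
  assumes "a \<in> monomials G n" "b \<in> monomials G k"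
  shows "a * b \<in> monomials G (n + k)"
proof -
  obtain e f where e: "e \<in> G \<rightarrow>\<^sub>E {..n}" "a = (\<Prod>g\<in>G. g ^ e g)"
    and f: "f \<in> G \<rightarrow>\<^sub>E {..k}" "b = (\<Prod>g\<in>G. g ^ f g)"
    using assms unfolding monomials_def by blast
  have "a * b = (\<Prod>g\<in>G. g ^ (e g + f g))" by (simp add: e f power_add prod.distrib)
  moreover have "e g + f g \<le> n + k" if "g \<in> G" for g
    using PiE_mem[OF e(1) that] PiE_mem[OF f(1) that] by simp
  ultimately show ?thesis using monomialsI[of G "\<lambda>g. e g + f g"] by simp
qed

lemma span_monomials_times:
  assumes a: "a \<in> vs.span (monomials G n)" and b: "b \<in> vs.span (monomials G k)"
  shows "a * b \<in> vs.span (monomials G (n + k))"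
proof -
  have 1: "v * b \<in> vs.span (monomials G (n + k))" if v: "v \<in> monomials G n" for v
    using b
  proof (induction rule: vs.span_induct_alt)
    case base
    then show ?case by (simp add: vs.span_zero)
  next
    case (step c x y)
    have "v * (\<iota> c * x + y) = \<iota> c * (v * x) + v * y" by (simp add: algebra_simps)
    then show ?case
      using step monomials_times[OF v step(1)] by (simp add: vs.span_add vs.span_scale vs.span_base)
  qed
  show ?thesis using a
  proof (induction rule: vs.span_induct_alt)
    case base
    then show ?case by (simp add: vs.span_zero)
  next
    case (step c x y)
    have "(\<iota> c * x + y) * b = \<iota> c * (x * b) + y * b" by (simp add: algebra_simps)
    then show ?case using step 1[OF step(1)] by (simp add: vs.span_add vs.span_scale)
  qed
qed

lemma span_monomials_power:
  assumes "a \<in> vs.span (monomials G n)"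
  shows "a ^ k \<in> vs.span (monomials G (k * n))"
proof (induction k)
  case 0
  have "1 \<in> monomials G 0" using monomialsI[of G "\<lambda>_. 0" 0] by simp
  then show ?case by (simp add: vs.span_base)
next
  case (Suc k)
  then show ?case using span_monomials_times[OF assms Suc] by simp
qed

lemma subalgebra_gen_subset_span_monomials:
  assumes G: "finite G" and a: "a \<in> subalgebra_gen \<iota> G"
  shows "\<exists>n. a \<in> vs.span (monomials G n)"
  using a
proof induction
  case (scalar c)
  have "1 \<in> monomials G 0" using monomialsI[of G "\<lambda>_. 0" 0] by simp
  then have "\<iota> c * 1 \<in> vs.span (monomials G 0)" by (intro vs.span_scale vs.span_base)
  then show ?case by auto
next
  case (generator g)
  have "(\<Prod>h\<in>G. h ^ (if h = g then 1 else 0)) = (\<Prod>h\<in>G. if h = g then g else 1)"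
    by (intro prod.cong) auto
  also have "\<dots> = g" using generator G by simp
  finally have "g \<in> monomials G 1" using monomialsI[of G "\<lambda>h. if h = g then 1 else 0" 1] by simp
  then show ?case by (auto intro: vs.span_base)
next
  case (add a b)
  then obtain n k where "a \<in> vs.span (monomials G n)" "b \<in> vs.span (monomials G k)" by blast
  then have "a + b \<in> vs.span (monomials G (max n k))"
    using span_monomials_mono[of n "max n k" G] span_monomials_mono[of k "max n k" G]
    by (intro vs.span_add) auto
  then show ?case by blast
next
  case (mult a b)
  then show ?case using span_monomials_times by blast
qed

end

text \<open>An affine algebra with derivations, written upstairs: the algebra is the quotient by
  \<open>K\<close>, and \<open>deriv_K\<close> together with the three congruences lets each
  \<open>d\<close> act on it as a complex-linear derivation.\<close>

locale affine_differential_algebra = complex_structure_map \<iota>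
  for \<iota> :: "complex \<Rightarrow> 'r::comm_ring_1" +
  fixes K :: "'r set" and \<Delta> :: "('r \<Rightarrow> 'r) set" and G :: "'r set"
  assumes finite_gens: "finite G"
    and K_ideal: "is_ideal K"
    and generated: "\<exists>p\<in>subalgebra_gen \<iota> G. a - p \<in> K"
    and deriv_K: "d \<in> \<Delta> \<Longrightarrow> a \<in> K \<Longrightarrow> d a \<in> K"
    and deriv_iota: "d \<in> \<Delta> \<Longrightarrow> d (\<iota> c) \<in> K"
    and deriv_add: "d \<in> \<Delta> \<Longrightarrow> d (a + b) - (d a + d b) \<in> K"
    and deriv_mult: "d \<in> \<Delta> \<Longrightarrow> d (a * b) - (a * d b + d a * b) \<in> K"
begin

definition is_prime :: "'r set \<Rightarrow> bool" where
  "is_prime P \<longleftrightarrow> is_ideal P \<and> K \<subseteq> P \<and> 1 \<notin> P \<and> (\<forall>a b. a * b \<in> P \<longrightarrow> a \<in> P \<or> b \<in> P)"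

definition is_maximal :: "'r set \<Rightarrow> bool" where
  "is_maximal N \<longleftrightarrow> is_ideal N \<and> K \<subseteq> N \<and> 1 \<notin> N \<and> (\<forall>J. is_ideal J \<longrightarrow> N \<subseteq> J \<longrightarrow> J = N \<or> J = UNIV)"

definition diff_ideal :: "'r set \<Rightarrow> bool" where
  "diff_ideal I \<longleftrightarrow> is_ideal I \<and> K \<subseteq> I \<and> (\<forall>d\<in>\<Delta>. \<forall>a\<in>I. d a \<in> I)"

definition Dspec :: "'r set set" where
  "Dspec = {P. is_prime P \<and> diff_ideal P}"

definition minimal_over :: "'r set \<Rightarrow> 'r set set" where
  "minimal_over P = {Q \<in> Dspec. P \<subset> Q \<and> \<not> (\<exists>Q'\<in>Dspec. P \<subset> Q' \<and> Q' \<subset> Q)}"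

text \<open>A relation and not a function, since a largest differential ideal inside
  \<open>N\<close> has yet to be constructed.\<close>

definition is_core :: "'r set \<Rightarrow> 'r set \<Rightarrow> bool" where
  "is_core N P \<longleftrightarrow> diff_ideal P \<and> P \<subseteq> N \<and> (\<forall>I. diff_ideal I \<longrightarrow> I \<subseteq> N \<longrightarrow> I \<subseteq> P)"

definition primitive :: "'r set \<Rightarrow> bool" where
  "primitive P \<longleftrightarrow> (\<exists>N. is_maximal N \<and> is_core N P)"

text \<open>The closure of the point \<open>P\<close> consists of the primes containing it, so the
  point is locally closed iff the basic open set of some \<open>f\<close> cuts away all larger
  primes.\<close>

definition loc_closed :: "'r set \<Rightarrow> bool" where
  "loc_closed P \<longleftrightarrow> P \<in> Dspec \<and> (\<exists>f. f \<notin> P \<and> (\<forall>Q\<in>Dspec. P \<subset> Q \<longrightarrow> f \<in> Q))"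

text \<open>The pair \<open>a\<close>, \<open>s\<close> stands for the fraction \<open>a / s\<close>
  modulo \<open>P\<close>. By the quotient rule the inner hypothesis says that all its derivatives
  vanish; the conclusion says that it is a scalar.\<close>

definition rational :: "'r set \<Rightarrow> bool" where
  "rational P \<longleftrightarrow> P \<in> Dspec \<and>
     (\<forall>a s. s \<notin> P \<longrightarrow> (\<forall>d\<in>\<Delta>. s * d a - a * d s \<in> P) \<longrightarrow> (\<exists>c. a - \<iota> c * s \<in> P))"

lemma is_primeD: "is_prime P \<Longrightarrow> is_ideal P" "is_prime P \<Longrightarrow> K \<subseteq> P" "is_prime P \<Longrightarrow> 1 \<notin> P"
    "is_prime P \<Longrightarrow> a * b \<in> P \<Longrightarrow> a \<in> P \<or> b \<in> P"
  by (auto simp: is_prime_def)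

lemma is_prime_prod_list: "is_prime P \<Longrightarrow> (\<And>a. a \<in> set as \<Longrightarrow> a \<notin> P) \<Longrightarrow> prod_list as \<notin> P"
  by (induction as) (auto dest: is_primeD)

lemma is_prime_prod: "is_prime P \<Longrightarrow> (\<And>i. i \<in> I \<Longrightarrow> f i \<notin> P) \<Longrightarrow> prod f I \<notin> P"
  by (induction I rule: infinite_finite_induct) (auto dest: is_primeD)

lemma is_prime_power: "is_prime P \<Longrightarrow> a ^ n \<in> P \<Longrightarrow> a \<in> P"
  by (induction n) (auto dest: is_primeD)

lemma is_prime_iota: "is_prime P \<Longrightarrow> \<iota> c \<in> P \<longleftrightarrow> c = 0"
proof -
  assume P: "is_prime P"
  have "\<iota> (inverse c) * \<iota> c = 1" if "c \<noteq> 0" using that by (simp add: iota_one flip: iota_mult)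
  then show ?thesis
    using is_primeD[OF P] iota_zero is_ideal_0[of P] is_ideal_lmult[of P "\<iota> c" "\<iota> (inverse c)"] by metis
qed

lemma diff_idealD: "diff_ideal I \<Longrightarrow> is_ideal I" "diff_ideal I \<Longrightarrow> K \<subseteq> I"
    "diff_ideal I \<Longrightarrow> d \<in> \<Delta> \<Longrightarrow> a \<in> I \<Longrightarrow> d a \<in> I"
  by (auto simp: diff_ideal_def)

lemma DspecD: "P \<in> Dspec \<Longrightarrow> is_prime P" "P \<in> Dspec \<Longrightarrow> diff_ideal P" "P \<in> Dspec \<Longrightarrow> is_ideal P"
  by (auto simp: Dspec_def is_prime_def)

text \<open>Intersecting with the subalgebra \<open>C\<close> generated by \<open>G\<close> loses
  nothing: every element is congruent to one of \<open>C\<close> modulo \<open>K\<close>, so an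
  ideal containing \<open>K\<close> is determined by its part in \<open>C\<close>.\<close>

lemma wf_ideals: "wf {(J, I). is_ideal I \<and> is_ideal J \<and> K \<subseteq> I \<and> I \<subset> J}"
  unfolding wf_iff_no_infinite_down_chain
proof
  assume "\<exists>f. \<forall>i. (f (Suc i), f i) \<in> {(J, I). is_ideal I \<and> is_ideal J \<and> K \<subseteq> I \<and> I \<subset> J}"
  then obtain f
    where "\<And>i. (f (Suc i), f i) \<in> {(J, I). is_ideal I \<and> is_ideal J \<and> K \<subseteq> I \<and> I \<subset> J}"
    by blast
  then have f: "is_ideal (f i)" "K \<subseteq> f i" "f i \<subset> f (Suc i)" for i by simp_all
  define C where "C = subalgebra_gen \<iota> G"
  have "ideal_in C (f i \<inter> C)" for i
    using f(1)[of i] is_subring_gen[of G] by (auto simp: ideal_in_def is_subring_def C_def)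
  moreover have "f i \<inter> C \<subseteq> f (Suc i) \<inter> C" for i using f(3)[of i] by blast
  ultimately have "\<forall>n. ideal_in C (f n \<inter> C) \<and> f n \<inter> C \<subseteq> f (Suc n) \<inter> C" by blast
  then obtain n where n: "\<forall>k\<ge>n. f k \<inter> C = f n \<inter> C"
    using noetherian_subalgebra_gen[OF finite_gens, unfolded noetherian_subring_def, THEN spec,
        of "\<lambda>n. f n \<inter> C"]
    unfolding C_def by blast
  obtain a where a: "a \<in> f (Suc n)" "a \<notin> f n" using f(3)[of n] by blast
  obtain p where p: "p \<in> C" "a - p \<in> K" using generated unfolding C_def by blast
  have "p \<in> f (Suc n)" using is_ideal_cong[OF f(1)[of "Suc n"], of a p] p(2) f(2)[of "Suc n"] a(1) by blast
  then have "p \<in> f n" using n[rule_format, of "Suc n"] p(1) by auto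
  then show False using is_ideal_cong[OF f(1)[of n], of a p] p(2) f(2)[of n] a(2) by blast
qed

lemma ideal_noetherian_induct [consumes 2, case_names bigger]:
  assumes "is_ideal I" "K \<subseteq> I"
    and step: "\<And>I. is_ideal I \<Longrightarrow> K \<subseteq> I \<Longrightarrow> (\<And>J. is_ideal J \<Longrightarrow> K \<subseteq> J \<Longrightarrow> I \<subset> J \<Longrightarrow> Q J) \<Longrightarrow> Q I"
  shows "Q I"
  using assms(1,2)
proof (induction I rule: wf_induct_rule[OF wf_ideals])
  case (1 I)
  show ?case
  proof (rule step[OF 1(2,3)])
    fix J assume "is_ideal J" "K \<subseteq> J" "I \<subset> J"
    with 1(2,3) show "Q J" by (intro 1(1)) simp_all
  qed
qed

lemma ideal_maximal_exists:
  assumes "I \<in> F" "\<And>I. I \<in> F \<Longrightarrow> is_ideal I \<and> K \<subseteq> I"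
  obtains N where "N \<in> F" "\<And>J. J \<in> F \<Longrightarrow> N \<subseteq> J \<Longrightarrow> J = N"
proof (rule wfE_min[OF wf_ideals assms(1)])
  fix N assume N: "N \<in> F" and
    min: "\<And>J. (J, N) \<in> {(J, I). is_ideal I \<and> is_ideal J \<and> K \<subseteq> I \<and> I \<subset> J} \<Longrightarrow> J \<notin> F"
  show ?thesis
  proof (rule that[OF N])
    fix J assume J: "J \<in> F" "N \<subseteq> J"
    then show "J = N" using min[of J] assms(2)[OF N] assms(2)[OF J(1)] by auto
  qed
qed

definition minimal_Dspec_above :: "'r set \<Rightarrow> 'r set set" where
  "minimal_Dspec_above I = {Q \<in> Dspec. I \<subseteq> Q \<and> \<not> (\<exists>Q'\<in>Dspec. I \<subseteq> Q' \<and> Q' \<subset> Q)}"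

lemma minimal_Dspec_above_mono:
  "I \<subseteq> J \<Longrightarrow> Q \<in> minimal_Dspec_above I \<Longrightarrow> J \<subseteq> Q \<Longrightarrow> Q \<in> minimal_Dspec_above J"
  unfolding minimal_Dspec_above_def by blast

text \<open>If \<open>I\<close> is not itself a differential prime, the failing axiom either shows
  that no prime lies above \<open>I\<close>, or exhibits one or two elements outside
  \<open>I\<close> such that each differential prime above \<open>I\<close> contains one of them.
  Adjoining such an element preserves minimality, and noetherian induction applies.\<close>

theorem finite_minimal_Dspec_above:
  assumes "is_ideal I" "K \<subseteq> I"
  shows "finite (minimal_Dspec_above I)"
  using assms
proof (induction rule: ideal_noetherian_induct)
  case (bigger I)
  have fin: "finite (minimal_Dspec_above (extend_ideal I a))" if "a \<notin> I" for a
    by (rule bigger(3)) (use extend_ideal(1-3)[OF bigger(1), of a] bigger(2) that in auto)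
  have above: "Q \<in> minimal_Dspec_above (extend_ideal I a)"
    if "Q \<in> minimal_Dspec_above I" "a \<in> Q" for Q a
  proof (rule minimal_Dspec_above_mono[OF extend_ideal(2)[OF bigger(1)] that(1)])
    have "Q \<in> Dspec" "I \<subseteq> Q" using that(1) by (auto simp: minimal_Dspec_above_def)
    then show "extend_ideal I a \<subseteq> Q"
      using extend_ideal(4)[OF bigger(1) _ _ that(2)] DspecD by blast
  qed
  show ?case
  proof (cases "I \<in> Dspec")
    case True
    then have "minimal_Dspec_above I \<subseteq> {I}" unfolding minimal_Dspec_above_def by blast
    then show ?thesis by (rule finite_subset) simp
  next
    case False
    then consider "1 \<in> I" | a b where "a * b \<in> I" "a \<notin> I" "b \<notin> I" | d a where "d \<in> \<Delta>" "a \<in> I" "d a \<notin> I"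
      using bigger(1,2) unfolding Dspec_def is_prime_def diff_ideal_def by blast
    then show ?thesis
    proof cases
      case 1
      then have "minimal_Dspec_above I = {}" by (auto simp: minimal_Dspec_above_def Dspec_def is_prime_def)
      then show ?thesis by simp
    next
      case 2
      have "minimal_Dspec_above I \<subseteq>
        minimal_Dspec_above (extend_ideal I a) \<union> minimal_Dspec_above (extend_ideal I b)"
      proof
        fix Q assume Q: "Q \<in> minimal_Dspec_above I"
        then have "a * b \<in> Q" "is_prime Q" using 2(1) by (auto simp: minimal_Dspec_above_def Dspec_def)
        then have "a \<in> Q \<or> b \<in> Q" using is_primeD(4) by blast
        then show "Q \<in> minimal_Dspec_above (extend_ideal I a) \<union> minimal_Dspec_above (extend_ideal I b)"
          using above[OF Q] by blast
      qed
      then show ?thesis using fin[OF 2(2)] fin[OF 2(3)] finite_subset by blast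
    next
      case 3
      have "minimal_Dspec_above I \<subseteq> minimal_Dspec_above (extend_ideal I (d a))"
      proof
        fix Q assume Q: "Q \<in> minimal_Dspec_above I"
        then have "d a \<in> Q"
          using 3 diff_idealD(3)[of Q d a] by (auto simp: minimal_Dspec_above_def Dspec_def)
        then show "Q \<in> minimal_Dspec_above (extend_ideal I (d a))" by (rule above[OF Q])
      qed
      then show ?thesis using fin[OF 3(3)] finite_subset by blast
    qed
  qed
qed

end

section \<open>Descending chains of prime ideals\<close>

context affine_differential_algebra
begin

definition independent_mod :: "'r set \<Rightarrow> nat \<Rightarrow> (nat \<Rightarrow> 'r) \<Rightarrow> bool" where
  "independent_mod Q n u \<longleftrightarrow> (\<forall>c. (\<Sum>j<n. \<iota> (c j) * u j) \<in> Q \<longrightarrow> (\<forall>j<n. c j = 0))"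

text \<open>Modulo \<open>Q\<close> only the constant term survives, so it lies in \<open>Q\<close>
  and vanishes; primeness of \<open>P\<close> then permits cancelling a factor
  \<open>f\<close>.\<close>

lemma sum_powers_mem_imp_zero:
  assumes P: "is_prime P" and Q: "is_ideal Q" "P \<subseteq> Q" and f: "f \<in> Q" "f \<notin> P"
  shows "(\<Sum>k<n. f ^ k * B k) \<in> P \<Longrightarrow> (\<And>k. k < n \<Longrightarrow> B k \<in> Q \<Longrightarrow> B k = 0) \<Longrightarrow> k < n \<Longrightarrow> B k = 0"
proof (induction n arbitrary: B k)
  case (Suc n)
  define R where "R = (\<Sum>k<n. f ^ k * B (Suc k))"
  have "(\<Sum>k<Suc n. f ^ k * B k) = B 0 + f * R"
    by (simp add: sum.lessThan_Suc_shift R_def sum_distrib_left mult.assoc del: sum.lessThan_Suc)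
  with Suc.prems(1) have *: "B 0 + f * R \<in> P" by simp
  then have "B 0 + f * R - f * R \<in> Q"
    using Q f by (intro is_ideal_diff is_ideal_rmult) auto
  then have B0: "B 0 = 0" using Suc.prems(2)[of 0] by simp
  with * f have R: "R \<in> P" using is_primeD(4)[OF P, of f R] by simp
  have "B (Suc j) = 0" if "j < n" for j
    using Suc.IH[of "\<lambda>k. B (Suc k)" j] R Suc.prems(2) that unfolding R_def by auto
  then show ?case using B0 Suc.prems(3) by (cases k) auto
qed simp

text \<open>The family consists of the products \<open>f ^ i * u b\<close> with \<open>i < N\<close>
  and \<open>b < M\<close>, enumerated by \<open>j = b + i * M\<close>. An element of
  \<open>Q\<close> outside \<open>P\<close> behaves like a variable over a family that is
  independent modulo \<open>Q\<close>.\<close>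

lemma independent_mod_powers:
  assumes P: "is_prime P" and Q: "is_ideal Q" "P \<subseteq> Q" and f: "f \<in> Q" "f \<notin> P"
    and u: "independent_mod Q M u" and M: "M > 0"
  shows "independent_mod P (N * M) (\<lambda>j. f ^ (j div M) * u (j mod M))"
  unfolding independent_mod_def
proof (intro allI impI)
  fix c j assume *: "(\<Sum>j<N * M. \<iota> (c j) * (f ^ (j div M) * u (j mod M))) \<in> P" and j: "j < N * M"
  define B where "B a = (\<Sum>b<M. \<iota> (c (b + a * M)) * u b)" for a
  have "(\<Sum>j<N * M. \<iota> (c j) * (f ^ (j div M) * u (j mod M)))
      = (\<Sum>a<N. \<Sum>j = a * M..<a * M + M. \<iota> (c j) * (f ^ (j div M) * u (j mod M)))"
    by (rule sum.nat_group[symmetric])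
  also have "\<dots> = (\<Sum>a<N. f ^ a * B a)"
  proof (rule sum.cong[OF refl])
    fix a
    have "(\<Sum>j = a * M..<a * M + M. \<iota> (c j) * (f ^ (j div M) * u (j mod M)))
        = (\<Sum>b = 0..<M. \<iota> (c (b + a * M)) * (f ^ ((b + a * M) div M) * u ((b + a * M) mod M)))"
      using sum.shift_bounds_nat_ivl[of "\<lambda>j. \<iota> (c j) * (f ^ (j div M) * u (j mod M))" 0 "a * M" M]
      by (simp add: add.commute)
    also have "\<dots> = (\<Sum>b<M. \<iota> (c (b + a * M)) * (f ^ a * u b))"
      by (rule sum.cong) (use M in \<open>auto simp: lessThan_atLeast0\<close>)
    also have "\<dots> = f ^ a * B a" by (simp add: B_def sum_distrib_left algebra_simps)
    finally show "(\<Sum>j = a * M..<a * M + M. \<iota> (c j) * (f ^ (j div M) * u (j mod M))) = f ^ a * B a" .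
  qed
  finally have sum: "(\<Sum>a<N. f ^ a * B a) \<in> P" using * by simp
  have zero: "c (b + a * M) = 0" if "B a \<in> Q" "b < M" for a b
    using u[unfolded independent_mod_def, rule_format, of "\<lambda>b. c (b + a * M)" b] that
    unfolding B_def by blast
  have B_zero: "B a = 0" if "a < N" for a
  proof (rule sum_powers_mem_imp_zero[OF P Q f sum _ that])
    fix a assume "B a \<in> Q"
    then show "B a = 0" using zero[of a] unfolding B_def by (simp add: iota_zero)
  qed
  have "j div M < N" using j by (simp add: less_mult_imp_div_less)
  then have "c (j mod M + j div M * M) = 0"
    using zero[of "j div M" "j mod M"] B_zero is_ideal_0[OF Q(1)] M by simp
  then show "c j = 0" by simp
qed

text \<open>A descending chain yields algebraically independent elements, one from each step; as
  the monomials of bounded degree grow with exponent \<open>card G\<close>, the chain has at most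
  \<open>card G\<close> steps.\<close>

theorem wf_prime: "wf {(P, Q). is_prime P \<and> is_prime Q \<and> P \<subset> Q}"
  unfolding wf_iff_no_infinite_down_chain
proof
  assume "\<exists>g. \<forall>i. (g (Suc i), g i) \<in> {(P, Q). is_prime P \<and> is_prime Q \<and> P \<subset> Q}"
  then obtain g where "\<And>i. (g (Suc i), g i) \<in> {(P, Q). is_prime P \<and> is_prime Q \<and> P \<subset> Q}"
    by blast
  then have g: "is_prime (g i)" "g (Suc i) \<subset> g i" for i by simp_all
  have "\<exists>f n. f \<in> g i \<and> f \<notin> g (Suc i) \<and> f \<in> vs.span (monomials G n)" for i
  proof -
    obtain a where a: "a \<in> g i" "a \<notin> g (Suc i)" using g(2)[of i] by blast
    obtain p where p: "p \<in> subalgebra_gen \<iota> G" "a - p \<in> K" using generated by blast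
    have "p \<in> g j \<longleftrightarrow> a \<in> g j" for j
      using is_ideal_cong[OF is_primeD(1)[OF g(1)[of j]], of a p] is_primeD(2)[OF g(1)[of j]] p(2) by blast
    then show ?thesis using a subalgebra_gen_subset_span_monomials[OF finite_gens p(1)] by blast
  qed
  then obtain f n where f: "f i \<in> g i" "f i \<notin> g (Suc i)" "f i \<in> vs.span (monomials G (n i))" for i
    by metis
  define m where "m = card G"
  define k where "k = Max (n ` {..m})"
  \<comment> \<open>\<open>C\<close> and \<open>N\<close> come from the final count: there will be
    \<open>N ^ Suc m\<close> independent elements in the span of at most \<open>N ^ m * C\<close>
    monomials, which is impossible as soon as \<open>N > C\<close>.\<close>
  define C where "C = ((m + 1) * k + 1) ^ m"
  define N where "N = C + 1"
  have f_span: "f i \<in> vs.span (monomials G k)" if "i \<le> m" for i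
    using f(3)[of i] span_monomials_mono[of "n i" k G] that by (auto simp: k_def)
  \<comment> \<open>Each step down the chain multiplies the number of independent elements by
    \<open>N\<close> and raises the exponent bound by \<open>N * k\<close>.\<close>
  have "\<exists>u. (\<forall>j<N ^ d. u j \<in> vs.span (monomials G (d * (N * k)))) \<and> independent_mod (g d) (N ^ d) u"
    if "d \<le> Suc m" for d
    using that
  proof (induction d)
    case 0
    have "1 \<in> monomials G 0" using monomialsI[of G "\<lambda>_. 0" 0] by simp
    moreover have "independent_mod (g 0) 1 (\<lambda>_. 1)"
      unfolding independent_mod_def using is_prime_iota[OF g(1)[of 0]] by simp
    ultimately show ?case by (intro exI[of _ "\<lambda>_. 1"]) (auto intro: vs.span_base)
  next
    case (Suc d)
    then obtain u where u: "\<And>j. j < N ^ d \<Longrightarrow> u j \<in> vs.span (monomials G (d * (N * k)))"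
      "independent_mod (g d) (N ^ d) u" by auto
    let ?u = "\<lambda>j. f d ^ (j div N ^ d) * u (j mod N ^ d)"
    have pos: "N ^ d > 0" by (simp add: N_def)
    have "independent_mod (g (Suc d)) (N * N ^ d) ?u"
      by (rule independent_mod_powers[OF g(1) is_primeD(1)[OF g(1)] _ f(1,2) u(2) pos])
        (use g(2)[of d] in blast)
    moreover have "?u j \<in> vs.span (monomials G (Suc d * (N * k)))" if "j < N * N ^ d" for j
    proof -
      have "j div N ^ d < N" using that by (simp add: less_mult_imp_div_less)
      have "?u j \<in> vs.span (monomials G (j div N ^ d * k + d * (N * k)))"
        by (intro span_monomials_times span_monomials_power f_span u(1)) (use Suc.prems pos in auto)
      moreover have "j div N ^ d * k + d * (N * k) \<le> Suc d * (N * k)"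
        using \<open>j div N ^ d < N\<close> by (simp add: mult_le_mono1)
      ultimately show ?thesis using span_monomials_mono by blast
    qed
    ultimately show ?case by (intro exI[of _ ?u]) simp
  qed
  from this[of "Suc m"] obtain u
    where u: "\<And>j. j < N ^ Suc m \<Longrightarrow> u j \<in> vs.span (monomials G (Suc m * (N * k)))"
      "independent_mod (g (Suc m)) (N ^ Suc m) u" by blast
  have "card (monomials G (Suc m * (N * k))) \<le> (Suc m * (N * k) + 1) ^ m"
    unfolding m_def by (rule card_monomials[OF finite_gens])
  also have "\<dots> \<le> (N * ((m + 1) * k + 1)) ^ m"
    by (intro power_mono) (auto simp: N_def algebra_simps)
  also have "\<dots> = N ^ m * C" by (simp only: power_mult_distrib C_def)
  also have "\<dots> < N ^ Suc m" by (simp add: N_def)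
  finally obtain c j where c: "j < N ^ Suc m" "c j \<noteq> 0" "(\<Sum>j<N ^ Suc m. \<iota> (c j) * u j) = 0"
    using linear_dependence[OF finite_monomials[OF finite_gens], of _ "N ^ Suc m" u] u(1) by meson
  then have "(\<Sum>j<N ^ Suc m. \<iota> (c j) * u j) \<in> g (Suc m)"
    using is_ideal_0[OF is_primeD(1)[OF g(1)]] by simp
  then show False using u(2) c(1,2) unfolding independent_mod_def by blast
qed

text \<open>Zorn's lemma would not do here: the intersection of a chain of primes properly
  containing \<open>P\<close> may be \<open>P\<close> itself. The descending chain condition on
  primes excludes this.\<close>

lemma minimal_over_exists:
  assumes "P \<in> Dspec" "Q \<in> Dspec" "P \<subset> Q"
  shows "\<exists>Q'\<in>minimal_over P. Q' \<subseteq> Q"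
proof -
  let ?F = "{Q' \<in> Dspec. P \<subset> Q' \<and> Q' \<subseteq> Q}"
  have "Q \<in> ?F" using assms by blast
  then obtain Q' where Q': "Q' \<in> ?F"
    "\<And>Q''. (Q'', Q') \<in> {(P, Q). is_prime P \<and> is_prime Q \<and> P \<subset> Q} \<Longrightarrow> Q'' \<notin> ?F"
    by (rule wfE_min[OF wf_prime]) blast
  have "\<not> (\<exists>Q''\<in>Dspec. P \<subset> Q'' \<and> Q'' \<subset> Q')"
  proof
    assume "\<exists>Q''\<in>Dspec. P \<subset> Q'' \<and> Q'' \<subset> Q'"
    then obtain Q'' where Q'': "Q'' \<in> Dspec" "P \<subset> Q''" "Q'' \<subset> Q'" by blast
    then have "Q'' \<notin> ?F" using Q' DspecD(1) by (intro Q'(2)) auto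
    then show False using Q'' Q'(1) by auto
  qed
  then have "Q' \<in> minimal_over P" using Q'(1) unfolding minimal_over_def by blast
  then show ?thesis using Q'(1) by blast
qed

section \<open>The core of a prime ideal is prime\<close>

lemma deriv_mult_mem:
  "is_ideal J \<Longrightarrow> K \<subseteq> J \<Longrightarrow> d \<in> \<Delta> \<Longrightarrow> a * d b + d a * b \<in> J \<longleftrightarrow> d (a * b) \<in> J"
  using is_ideal_cong[of J "d (a * b)" "a * d b + d a * b"] deriv_mult by blast

lemma deriv_power_Suc: "d \<in> \<Delta> \<Longrightarrow> d (a ^ Suc n) - of_nat (Suc n) * a ^ n * d a \<in> K"
proof (induction n)
  case 0
  then show ?case using is_ideal_0[OF K_ideal] by simp
next
  case (Suc n)
  have "d (a ^ Suc (Suc n)) - of_nat (Suc (Suc n)) * a ^ Suc n * d a =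
     (d (a * a ^ Suc n) - (a * d (a ^ Suc n) + d a * a ^ Suc n)) +
     a * (d (a ^ Suc n) - of_nat (Suc n) * a ^ n * d a)"
    by (simp add: algebra_simps)
  also have "\<dots> \<in> K" by (intro is_ideal_add is_ideal_lmult K_ideal deriv_mult Suc)
  finally show ?case .
qed

text \<open>The extra factor \<open>a\<close> avoids the exponent \<open>n - 1\<close>, so that the
  rule can be applied uniformly to \<open>n = 2 * k\<close> with \<open>k = 0\<close>
  included.\<close>

lemma mult_deriv_power: "d \<in> \<Delta> \<Longrightarrow> a * d (a ^ n) - of_nat n * a ^ n * d a \<in> K"
proof (cases n)
  case 0
  assume "d \<in> \<Delta>"
  then show ?thesis using 0 deriv_iota[of d 1] by (auto simp: iota_one intro: is_ideal_lmult[OF K_ideal])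
next
  case (Suc m)
  assume "d \<in> \<Delta>"
  then have "a * (d (a ^ Suc m) - of_nat (Suc m) * a ^ m * d a) \<in> K"
    by (intro is_ideal_lmult K_ideal deriv_power_Suc)
  then show ?thesis by (simp add: Suc algebra_simps)
qed

lemma iota_mult_mem: "is_ideal I \<Longrightarrow> c \<noteq> 0 \<Longrightarrow> \<iota> c * a \<in> I \<longleftrightarrow> a \<in> I"
proof
  assume I: "is_ideal I" and c: "c \<noteq> 0" "\<iota> c * a \<in> I"
  have "\<iota> (inverse c) * (\<iota> c * a) = a"
    using c(1) by (simp add: iota_one flip: mult.assoc iota_mult)
  then show "a \<in> I" using is_ideal_lmult[OF I c(2), of "\<iota> (inverse c)"] by simp
qed (rule is_ideal_lmult)

definition radical :: "'r set \<Rightarrow> 'r set" where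
  "radical I = {a. \<exists>n. a ^ n \<in> I}"

lemma is_ideal_power_mono: "is_ideal I \<Longrightarrow> a ^ n \<in> I \<Longrightarrow> n \<le> m \<Longrightarrow> a ^ m \<in> I"
  using is_ideal_lmult[of I "a ^ n" "a ^ (m - n)"] by (simp flip: power_add)

lemma is_ideal_radical:
  assumes I: "is_ideal I"
  shows "is_ideal (radical I)"
  unfolding is_ideal_iff
proof (intro conjI ballI allI)
  show "0 \<in> radical I" using is_ideal_0[OF I] by (auto simp: radical_def intro!: exI[of _ 1])
next
  fix a b assume "a \<in> radical I" "b \<in> radical I"
  then obtain n m where nm: "a ^ n \<in> I" "b ^ m \<in> I" by (auto simp: radical_def)
  have "(a + b) ^ (n + m) = (\<Sum>k\<le>n + m. of_nat ((n + m) choose k) * a ^ k * b ^ (n + m - k))"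
    by (rule binomial_ring)
  also have "\<dots> \<in> I"
  proof (rule is_ideal_sum[OF I])
    fix k
    show "of_nat ((n + m) choose k) * a ^ k * b ^ (n + m - k) \<in> I"
    proof (cases "n \<le> k")
      case True
      show ?thesis
        by (intro is_ideal_rmult is_ideal_lmult I) (rule is_ideal_power_mono[OF I nm(1) True])
    next
      case False
      then have "m \<le> n + m - k" by simp
      then show ?thesis by (intro is_ideal_lmult I) (rule is_ideal_power_mono[OF I nm(2)])
    qed
  qed
  finally show "a + b \<in> radical I" by (auto simp: radical_def)
next
  fix r a assume "a \<in> radical I"
  then obtain n where "a ^ n \<in> I" by (auto simp: radical_def)
  then show "r * a \<in> radical I"
    by (auto simp: radical_def power_mult_distrib intro!: exI[of _ n] is_ideal_lmult[OF I])
qed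

text \<open>If \<open>a ^ n \<in> I\<close>, differentiating repeatedly trades one factor \<open>a\<close> for two factors \<open>d a\<close>.\<close>

lemma diff_ideal_power_deriv:
  assumes I: "diff_ideal I" and d: "d \<in> \<Delta>" and a: "a ^ n \<in> I"
  shows "k \<le> n \<Longrightarrow> a ^ (n - k) * d a ^ (2 * k) \<in> I"
proof (induction k)
  case 0
  then show ?case using a by simp
next
  case (Suc k)
  note id = diff_idealD(1)[OF I]
  obtain m where m: "n - k = Suc m" "n - Suc k = m" using Suc.prems by (cases "n - k") auto
  define b where "b = d a"
  have F: "a ^ Suc m * b ^ (2 * k) \<in> I" using Suc by (simp add: m b_def)
  then have 1: "a ^ Suc m * d (b ^ (2 * k)) + d (a ^ Suc m) * b ^ (2 * k) \<in> I"
    using deriv_mult_mem[OF id diff_idealD(2)[OF I] d] diff_idealD(3)[OF I d] by blast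
  have 2: "d (a ^ Suc m) - of_nat (Suc m) * a ^ m * b \<in> I"
    using deriv_power_Suc[OF d] diff_idealD(2)[OF I] unfolding b_def by blast
  have 3: "b * d (b ^ (2 * k)) - of_nat (2 * k) * b ^ (2 * k) * d b \<in> I"
    using mult_deriv_power[OF d] diff_idealD(2)[OF I] by blast
  \<comment> \<open>The derivative of \<open>a ^ Suc m * b ^ (2 * k)\<close> is multiplied by
    \<open>b\<close>, which turns the term containing \<open>d b\<close> into a multiple of the
    element itself. The coefficient \<open>Suc m\<close> is then removed, being invertible in
    characteristic zero.\<close>
  have "of_nat (Suc m) * (a ^ m * b ^ (2 * Suc k)) =
      b * (a ^ Suc m * d (b ^ (2 * k)) + d (a ^ Suc m) * b ^ (2 * k))
      - a ^ Suc m * (b * d (b ^ (2 * k)) - of_nat (2 * k) * b ^ (2 * k) * d b)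
      - b * b ^ (2 * k) * (d (a ^ Suc m) - of_nat (Suc m) * a ^ m * b)
      - of_nat (2 * k) * d b * (a ^ Suc m * b ^ (2 * k))"
    by (simp add: algebra_simps power2_eq_square power_add)
  also have "\<dots> \<in> I" by (intro is_ideal_diff is_ideal_lmult id 1 2 3 F)
  finally have "\<iota> (of_nat (Suc m)) * (a ^ m * b ^ (2 * Suc k)) \<in> I" by (simp add: iota_of_nat del: of_nat_Suc)
  then have "a ^ m * b ^ (2 * Suc k) \<in> I"
    by (subst (asm) iota_mult_mem[OF id]) (simp_all del: of_nat_Suc)
  then show ?case by (simp only: m b_def)
qed

lemma diff_ideal_radical:
  assumes I: "diff_ideal I"
  shows "diff_ideal (radical I)"
  unfolding diff_ideal_def
proof (intro conjI ballI)
  show "is_ideal (radical I)" by (rule is_ideal_radical[OF diff_idealD(1)[OF I]])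
  show "K \<subseteq> radical I" using diff_idealD(2)[OF I] by (auto simp: radical_def intro!: exI[of _ 1])
next
  fix d a assume "d \<in> \<Delta>" "a \<in> radical I"
  \<comment> \<open>The case \<open>k = n\<close>: no factor \<open>a\<close> is left, and
    \<open>d a ^ (2 * n)\<close> lies in \<open>I\<close>.\<close>
  then show "d a \<in> radical I"
    using diff_ideal_power_deriv[OF I, of d a] by (force simp: radical_def)
qed

definition colon :: "'r set \<Rightarrow> 'r set \<Rightarrow> 'r set" where
  "colon I S = {b. \<forall>s\<in>S. s * b \<in> I}"

text \<open>Differentiating \<open>s * b \<in> I\<close> leaves the unwanted term
  \<open>d s * b\<close>. Multiplication by \<open>s * d b\<close> makes that term a multiple of
  \<open>s * b\<close>, so the square of \<open>s * d b\<close> lies in \<open>I\<close>, and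
  \<open>I\<close> is radical.\<close>

lemma diff_ideal_colon:
  assumes I: "diff_ideal I" and rad: "radical I \<subseteq> I"
  shows "diff_ideal (colon I S)"
  unfolding diff_ideal_def is_ideal_iff
proof (intro conjI ballI allI)
  note id = diff_idealD(1)[OF I]
  show "0 \<in> colon I S" using is_ideal_0[OF id] by (simp add: colon_def)
  show "K \<subseteq> colon I S" using diff_idealD(2)[OF I] is_ideal_lmult[OF id] by (auto simp: colon_def)
  show "a + b \<in> colon I S" if "a \<in> colon I S" "b \<in> colon I S" for a b
    using that is_ideal_add[OF id] by (simp add: colon_def distrib_left)
  show "r * a \<in> colon I S" if "a \<in> colon I S" for r a
    using that is_ideal_lmult[OF id, of _ r] by (simp add: colon_def mult.left_commute[of _ r])
  fix d b assume d: "d \<in> \<Delta>" and b: "b \<in> colon I S"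
  show "d b \<in> colon I S"
    unfolding colon_def
  proof (clarify)
    fix s assume "s \<in> S"
    with b have sb: "s * b \<in> I" by (simp add: colon_def)
    then have "s * d b + d s * b \<in> I"
      using deriv_mult_mem[OF id diff_idealD(2)[OF I] d] diff_idealD(3)[OF I d] by blast
    then have "(s * d b) * (s * d b + d s * b) - (d s * d b) * (s * b) \<in> I"
      by (intro is_ideal_diff is_ideal_lmult id sb)
    then have "(s * d b) ^ 2 \<in> I" by (simp add: algebra_simps power2_eq_square)
    then show "s * d b \<in> I" using rad by (auto simp: radical_def)
  qed
qed

text \<open>Maximality of \<open>I\<close> among the differential ideals inside \<open>N\<close>
  absorbs first its radical and then its colon ideals. If \<open>a * b \<in> I\<close>, either
  \<open>colon I {a}\<close>, which contains \<open>b\<close>, lies in \<open>N\<close>, or it has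
  an element outside \<open>N\<close>; in the latter case primeness of \<open>N\<close> forces
  \<open>colon I (colon I {a})\<close>, which contains \<open>a\<close>, into
  \<open>N\<close>.\<close>

theorem core_in_Dspec:
  assumes N: "is_prime N" and I: "is_core N I"
  shows "I \<in> Dspec"
proof -
  have dI: "diff_ideal I" and IN: "I \<subseteq> N"
    and max: "\<And>J. diff_ideal J \<Longrightarrow> J \<subseteq> N \<Longrightarrow> J \<subseteq> I" using I by (auto simp: is_core_def)
  have rad: "radical I \<subseteq> I"
  proof (rule max[OF diff_ideal_radical[OF dI]])
    show "radical I \<subseteq> N" using IN is_prime_power[OF N] by (auto simp: radical_def)
  qed
  have "a \<in> I \<or> b \<in> I" if ab: "a * b \<in> I" for a b
  proof (cases "colon I {a} \<subseteq> N")
    case True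
    then have "colon I {a} \<subseteq> I" by (rule max[OF diff_ideal_colon[OF dI rad]])
    then show ?thesis using ab by (auto simp: colon_def)
  next
    case False
    then obtain x where x: "x \<in> colon I {a}" "x \<notin> N" by blast
    have "colon I (colon I {a}) \<subseteq> N"
    proof
      fix y assume "y \<in> colon I (colon I {a})"
      then have "x * y \<in> N" using x(1) IN by (auto simp: colon_def)
      then show "y \<in> N" using is_primeD(4)[OF N] x(2) by blast
    qed
    then have "colon I (colon I {a}) \<subseteq> I" by (rule max[OF diff_ideal_colon[OF dI rad]])
    then show ?thesis by (auto simp: colon_def mult.commute)
  qed
  then show ?thesis
    using dI IN is_primeD(3)[OF N] by (auto simp: Dspec_def is_prime_def diff_ideal_def)
qed

lemma core_exists:
  assumes "is_ideal N" "K \<subseteq> N"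
  shows "\<exists>I. is_core N I"
proof -
  \<comment> \<open>The union of all differential ideals inside \<open>N\<close> is closed under
    addition because the sum of two of them is again one.\<close>
  define C where "C = {a. \<exists>I. diff_ideal I \<and> I \<subseteq> N \<and> a \<in> I}"
  have K: "diff_ideal K" by (auto simp: diff_ideal_def K_ideal deriv_K)
  have "diff_ideal C"
    unfolding diff_ideal_def is_ideal_iff
  proof (intro conjI ballI allI)
    show KC: "K \<subseteq> C" using K assms(2) by (auto simp: C_def)
    show "0 \<in> C" using KC is_ideal_0[OF K_ideal] by blast
    show "r * a \<in> C" if "a \<in> C" for r a
      using that diff_idealD(1) is_ideal_lmult unfolding C_def by blast
    show "d a \<in> C" if "d \<in> \<Delta>" "a \<in> C" for d a
      using that diff_idealD(3) unfolding C_def by blast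
    show "a + b \<in> C" if ab: "a \<in> C" "b \<in> C" for a b
    proof -
      obtain I J where I: "diff_ideal I" "I \<subseteq> N" "a \<in> I" and J: "diff_ideal J" "J \<subseteq> N" "b \<in> J"
        using ab unfolding C_def by blast
      define S where "S = {i + j |i j. i \<in> I \<and> j \<in> J}"
      note idI = diff_idealD(1)[OF I(1)] and idJ = diff_idealD(1)[OF J(1)]
      have "diff_ideal S"
        unfolding diff_ideal_def is_ideal_iff
      proof (intro conjI ballI allI)
        have "x = x + 0" for x :: 'r by simp
        then show KS: "K \<subseteq> S"
          using is_ideal_0[OF idJ] diff_idealD(2)[OF I(1)] unfolding S_def by blast
        then show "0 \<in> S" using is_ideal_0[OF K_ideal] by blast
        fix x assume "x \<in> S"
        then obtain i j where x: "x = i + j" "i \<in> I" "j \<in> J" by (auto simp: S_def)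
        have "r * x = r * i + r * j" for r by (simp add: x distrib_left)
        then show "r * x \<in> S" for r
          using is_ideal_lmult[OF idI x(2)] is_ideal_lmult[OF idJ x(3)] unfolding S_def by blast
        show "d x \<in> S" if d: "d \<in> \<Delta>" for d
        proof -
          have "d x = ((d (i + j) - (d i + d j)) + d i) + d j" by (simp add: x)
          moreover have "(d (i + j) - (d i + d j)) + d i \<in> I"
            using deriv_add[OF d] diff_idealD(2)[OF I(1)] diff_idealD(3)[OF I(1) d x(2)]
            by (intro is_ideal_add[OF idI]) auto
          ultimately show ?thesis using diff_idealD(3)[OF J(1) d x(3)] unfolding S_def by blast
        qed
        fix y assume "y \<in> S"
        then obtain k l where y: "y = k + l" "k \<in> I" "l \<in> J" by (auto simp: S_def)
        have "x + y = (i + k) + (j + l)" by (simp add: x y)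
        then show "x + y \<in> S"
          using is_ideal_add[OF idI x(2) y(2)] is_ideal_add[OF idJ x(3) y(3)] unfolding S_def by blast
      qed
      moreover have "S \<subseteq> N" using I(2) J(2) is_ideal_add[OF assms(1)] by (auto simp: S_def)
      moreover have "a + b \<in> S" using I(3) J(3) by (auto simp: S_def)
      ultimately show ?thesis by (auto simp: C_def)
    qed
  qed
  then have "is_core N C" unfolding is_core_def C_def by blast
  then show ?thesis by blast
qed

section \<open>Separating sets of rational primes\<close>

text \<open>Gaussian elimination in place of a Wronskian determinant: rationality of \<open>P\<close> lets one
  eliminate the last coordinate of all vectors in \<open>F\<close> by differentiating quotients of
  coordinates.\<close>

lemma rational_separating_element:
  fixes m :: nat
  assumes P: "rational P"
  shows "\<exists>E. E \<notin> P \<and> (\<forall>Q c. diff_ideal Q \<longrightarrow> P \<subseteq> Q \<longrightarrow> (\<forall>v\<in>F. (\<Sum>i<m. \<iota> (c i) * v i) \<in> Q) \<longrightarrow>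
    (\<exists>v\<in>F. (\<Sum>i<m. \<iota> (c i) * v i) \<notin> P) \<longrightarrow> E \<in> Q)"
proof (induction m arbitrary: F)
  case 0
  have "is_prime P" using P by (simp add: rational_def Dspec_def)
  then show ?case using is_primeD(1,3) is_ideal_0 by (auto intro!: exI[of _ 1])
next
  case (Suc m)
  have pr: "is_prime P" using P by (simp add: rational_def Dspec_def)
  note idP = is_primeD(1)[OF pr]
  define L where "L c v = (\<Sum>i<m. \<iota> (c i) * v i)" for c and v :: "nat \<Rightarrow> 'r"
  have L_Suc: "(\<Sum>i<Suc m. \<iota> (c i) * v i) = L c v + \<iota> (c m) * v m" for c v
    by (simp add: L_def)
  show ?case
  proof (cases "\<forall>v\<in>F. v m \<in> P")
    case True
    obtain E where E_IH: "E \<notin> P \<and> (\<forall>Q c. diff_ideal Q \<longrightarrow> P \<subseteq> Q \<longrightarrow> (\<forall>v\<in>F. L c v \<in> Q) \<longrightarrow>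
        (\<exists>v\<in>F. L c v \<notin> P) \<longrightarrow> E \<in> Q)"
      using Suc.IH[of F] unfolding L_def by (rule exE)
    then have E: "E \<notin> P" by (rule conjunct1)
    have IH: "E \<in> Q"
      if "diff_ideal Q" "P \<subseteq> Q" "\<forall>v\<in>F. L c v \<in> Q" "v \<in> F" "L c v \<notin> P" for Q c v
      using E_IH[THEN conjunct2, rule_format, OF that(1,2), of c] that(3-5) by blast
    have iff: "L c v + \<iota> (c m) * v m \<in> Q \<longleftrightarrow> L c v \<in> Q" if "is_ideal Q" "P \<subseteq> Q" "v \<in> F" for Q c v
      using is_ideal_cong[OF that(1), of "L c v + \<iota> (c m) * v m" "L c v"] that
        is_ideal_lmult[OF that(1), of "v m"] True by auto
    show ?thesis
      unfolding L_Suc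
    proof (intro exI[of _ E] conjI allI impI E)
      fix Q c assume Q: "diff_ideal Q" "P \<subseteq> Q" "\<forall>v\<in>F. L c v + \<iota> (c m) * v m \<in> Q"
        and "\<exists>v\<in>F. L c v + \<iota> (c m) * v m \<notin> P"
      then obtain v where v: "v \<in> F" "L c v + \<iota> (c m) * v m \<notin> P" by blast
      show "E \<in> Q"
        by (rule IH[OF Q(1,2) _ v(1)])
          (use Q(3) v iff[OF diff_idealD(1)[OF Q(1)] Q(2)] iff[OF idP order_refl] in auto)
    qed
  next
    case False
    then obtain v0 where v0: "v0 \<in> F" "v0 m \<notin> P" by blast
    \<comment> \<open>\<open>u\<close> is the pivot. Cross-multiplication with \<open>v0\<close>
      kills the last coordinate of every \<open>w v\<close>; \<open>w' d\<close> consists of the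
      numerators of the derivatives of \<open>v0 i / u\<close>, whose last coordinate vanishes as
      well.\<close>
    define u where "u = v0 m"
    define w where "w v = (\<lambda>i. u * v i - v0 i * v m)" for v :: "nat \<Rightarrow> 'r"
    define w' where "w' d = (\<lambda>i. u * d (v0 i) - v0 i * d u)" for d :: "'r \<Rightarrow> 'r"
    define F' where "F' = w ` F \<union> w' ` \<Delta>"
    obtain E where E_IH: "E \<notin> P \<and> (\<forall>Q c. diff_ideal Q \<longrightarrow> P \<subseteq> Q \<longrightarrow> (\<forall>v\<in>F'. L c v \<in> Q) \<longrightarrow>
        (\<exists>v\<in>F'. L c v \<notin> P) \<longrightarrow> E \<in> Q)"
      using Suc.IH[of F'] unfolding L_def by (rule exE)
    then have E: "E \<notin> P" by (rule conjunct1)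
    have IH: "E \<in> Q"
      if "diff_ideal Q" "P \<subseteq> Q" "\<forall>v\<in>F'. L c v \<in> Q" "v \<in> F'" "L c v \<notin> P" for Q c v
      using E_IH[THEN conjunct2, rule_format, OF that(1,2), of c] that(3-5) by blast
    have L_w: "L c (w v) = u * L c v - v m * L c v0" for c v
      by (simp add: L_def w_def sum_distrib_left algebra_simps flip: sum_subtractf)
    have deriv_L: "d (L c v0) - (\<Sum>i<m. \<iota> (c i) * d (v0 i)) \<in> K" if d: "d \<in> \<Delta>" for c d
      unfolding L_def
    proof (induction m)
      case 0
      then show ?case using deriv_iota[OF d, of 0] by (simp add: iota_zero)
    next
      case (Suc n)
      let ?s = "\<lambda>n. \<Sum>i<n. \<iota> (c i) * v0 i" and ?t = "\<lambda>n. \<Sum>i<n. \<iota> (c i) * d (v0 i)"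
      have "d (?s (Suc n)) - ?t (Suc n) = (d (?s n) - ?t n) +
          (d (?s n + \<iota> (c n) * v0 n) - (d (?s n) + d (\<iota> (c n) * v0 n))) +
          (d (\<iota> (c n) * v0 n) - (\<iota> (c n) * d (v0 n) + d (\<iota> (c n)) * v0 n)) + d (\<iota> (c n)) * v0 n"
        by (simp add: algebra_simps)
      also have "\<dots> \<in> K"
        by (intro is_ideal_add is_ideal_rmult K_ideal Suc deriv_add deriv_mult deriv_iota d)
      finally show ?case .
    qed
    have L_w': "L c (w' d) - (u * d (L c v0) - L c v0 * d u) \<in> K" if d: "d \<in> \<Delta>" for c d
    proof -
      have "L c (w' d) = u * (\<Sum>i<m. \<iota> (c i) * d (v0 i)) - L c v0 * d u"
        by (simp add: L_def w'_def sum_distrib_left sum_distrib_right algebra_simps flip: sum_subtractf)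
      then have "L c (w' d) - (u * d (L c v0) - L c v0 * d u) =
          (- u) * (d (L c v0) - (\<Sum>i<m. \<iota> (c i) * d (v0 i)))" by (simp add: algebra_simps)
      then show ?thesis using is_ideal_lmult[OF K_ideal deriv_L[OF d]] by metis
    qed
    have uE: "u * E \<notin> P" using is_primeD(4)[OF pr, of u E] E v0(2) by (auto simp: u_def)
    show ?thesis
      unfolding L_Suc
    proof (intro exI[of _ "u * E"] conjI allI impI uE)
      fix Q c assume Q: "diff_ideal Q" "P \<subseteq> Q" and in_Q: "\<forall>v\<in>F. L c v + \<iota> (c m) * v m \<in> Q"
        and "\<exists>v\<in>F. L c v + \<iota> (c m) * v m \<notin> P"
      then obtain v1 where v1: "v1 \<in> F" "L c v1 + \<iota> (c m) * v1 m \<notin> P" by blast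
      note idQ = diff_idealD(1)[OF Q(1)] and KQ = diff_idealD(2)[OF Q(1)]
      define h where "h = L c v0"
      define q where "q = h + \<iota> (c m) * u"
      have q: "q \<in> Q" using in_Q v0(1) by (auto simp: q_def h_def u_def)
      have F'_Q: "\<forall>v\<in>F'. L c v \<in> Q"
        unfolding F'_def
      proof (intro ballI, elim UnE imageE, simp_all)
        fix v assume v: "v \<in> F"
        have "L c (w v) = u * (L c v + \<iota> (c m) * v m) - v m * q"
          by (simp add: L_w q_def h_def algebra_simps)
        then show "L c (w v) \<in> Q"
          using in_Q v q by (auto intro!: is_ideal_diff is_ideal_lmult idQ)
      next
        fix d assume d: "d \<in> \<Delta>"
        have dq: "d q \<in> Q" by (rule diff_idealD(3)[OF Q(1) d q])
        define t1 where "t1 = L c (w' d) - (u * d h - h * d u)"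
        define t2 where "t2 = d (h + \<iota> (c m) * u) - (d h + d (\<iota> (c m) * u))"
        define t3 where "t3 = d (\<iota> (c m) * u) - (\<iota> (c m) * d u + d (\<iota> (c m)) * u)"
        define t4 where "t4 = d (\<iota> (c m))"
        have t: "t1 \<in> Q" "t2 \<in> Q" "t3 \<in> Q" "t4 \<in> Q"
          unfolding t1_def t2_def t3_def t4_def h_def
          using L_w'[OF d] deriv_add[OF d] deriv_mult[OF d] deriv_iota[OF d] KQ by blast+
        have "L c (w' d) = t1 + u * d q - d u * q - u * t2 - u * t3 - u * u * t4"
          by (simp add: t1_def t2_def t3_def t4_def q_def algebra_simps)
        also have "\<dots> \<in> Q" by (intro is_ideal_add is_ideal_diff is_ideal_lmult idQ q dq t)
        finally show "L c (w' d) \<in> Q" .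
      qed
      show "u * E \<in> Q"
      proof (cases "\<exists>v\<in>F'. L c v \<notin> P")
        case True
        then have "E \<in> Q" using IH[OF Q F'_Q] by blast
        then show ?thesis by (rule is_ideal_lmult[OF idQ])
      next
        \<comment> \<open>All derivatives of \<open>h / u\<close> vanish modulo \<open>P\<close>, so
          rationality makes it a scalar \<open>l\<close>. Modulo \<open>P\<close> the combination is
          then \<open>l + c m\<close> times the last coordinate on all of \<open>F\<close>; it is
          nonzero at \<open>v1\<close>, so the scalar is invertible and \<open>u\<close> itself lies
          in \<open>Q\<close>.\<close>
        case False
        have "u * d h - h * d u \<in> P" if d: "d \<in> \<Delta>" for d
        proof -
          have "L c (w' d) \<in> P" using False d by (auto simp: F'_def)
          then show ?thesis
            using is_ideal_cong[OF idP, of "L c (w' d)" "u * d h - h * d u"] L_w'[OF d, of c]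
              is_primeD(2)[OF pr] by (auto simp: h_def)
        qed
        then obtain l where l: "h - \<iota> l * u \<in> P"
          using P v0(2) unfolding rational_def u_def by blast
        have mod_P: "L c v - \<iota> l * v m \<in> P" if v: "v \<in> F" for v
        proof -
          have "L c (w v) \<in> P" using False v by (auto simp: F'_def)
          then have "L c (w v) + v m * (h - \<iota> l * u) \<in> P"
            using l by (intro is_ideal_add is_ideal_lmult idP)
          then have "u * (L c v - \<iota> l * v m) \<in> P" by (simp add: L_w h_def algebra_simps)
          then show ?thesis using is_primeD(4)[OF pr, of u] v0(2) by (auto simp: u_def)
        qed
        then have mod_P': "L c v + \<iota> (c m) * v m - \<iota> (l + c m) * v m \<in> P" if "v \<in> F" for v
          using mod_P[OF that] by (simp add: iota_add algebra_simps)
        have nz: "l + c m \<noteq> 0" using mod_P'[OF v1(1)] v1(2) by (auto simp: iota_zero)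
        have "\<iota> (l + c m) * u \<in> Q"
          using is_ideal_cong[OF idQ, of "L c v0 + \<iota> (c m) * v0 m" "\<iota> (l + c m) * v0 m"]
            mod_P'[OF v0(1)] Q(2) in_Q v0(1) by (auto simp: u_def)
        then have "u \<in> Q" using iota_mult_mem[OF idQ nz] by blast
        then show ?thesis by (rule is_ideal_rmult[OF idQ])
      qed
    qed
  qed
qed

text \<open>The spans of monomials exhaust the ring modulo \<open>K\<close>, so one separating
  element for each exponent bound is enough.\<close>

theorem rational_countable_separating_set:
  assumes P: "rational P"
  shows "\<exists>E :: nat \<Rightarrow> 'r. (\<forall>n. E n \<notin> P) \<and> (\<forall>Q. diff_ideal Q \<longrightarrow> P \<subset> Q \<longrightarrow> (\<exists>n. E n \<in> Q))"
proof -
  have pr: "is_prime P" using P by (simp add: rational_def Dspec_def)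
  have "\<exists>E. E \<notin> P \<and> (\<forall>Q p. diff_ideal Q \<longrightarrow> P \<subseteq> Q \<longrightarrow> p \<in> vs.span (monomials G n) \<longrightarrow>
     p \<in> Q \<longrightarrow> p \<notin> P \<longrightarrow> E \<in> Q)" for n
  proof -
    let ?T = "monomials G n"
    have fin: "finite ?T" by (rule finite_monomials[OF finite_gens])
    then obtain v where v: "bij_betw v {..<card ?T} ?T"
      using ex_bij_betw_nat_finite[OF fin] by (auto simp: lessThan_atLeast0)
    \<comment> \<open>A single vector whose coordinates are all the monomials: its combinations form
      the whole span.\<close>
    obtain E where E: "E \<notin> P" "\<And>Q c. diff_ideal Q \<Longrightarrow> P \<subseteq> Q \<Longrightarrow>
        (\<Sum>i<card ?T. \<iota> (c i) * v i) \<in> Q \<Longrightarrow> (\<Sum>i<card ?T. \<iota> (c i) * v i) \<notin> P \<Longrightarrow> E \<in> Q"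
      using rational_separating_element[OF P, of "{v}" "card ?T"] by auto
    have "E \<in> Q" if Q: "diff_ideal Q" "P \<subseteq> Q" and p: "p \<in> vs.span ?T" "p \<in> Q" "p \<notin> P" for Q p
    proof -
      obtain c where "p = (\<Sum>t\<in>?T. \<iota> (c t) * t)" using p(1) vs.span_finite[OF fin] by auto
      also have "\<dots> = (\<Sum>i<card ?T. \<iota> (c (v i)) * v i)"
        by (rule sum.reindex_bij_betw[OF v, symmetric])
      finally show ?thesis using E(2)[OF Q, of "\<lambda>i. c (v i)"] p(2,3) by simp
    qed
    then show ?thesis using E(1) by blast
  qed
  then obtain E where E: "\<And>n. E n \<notin> P" "\<And>n Q p. diff_ideal Q \<Longrightarrow> P \<subseteq> Q \<Longrightarrow>
      p \<in> vs.span (monomials G n) \<Longrightarrow> p \<in> Q \<Longrightarrow> p \<notin> P \<Longrightarrow> E n \<in> Q" by metis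
  have "\<exists>n. E n \<in> Q" if Q: "diff_ideal Q" "P \<subset> Q" for Q
  proof -
    obtain f where f: "f \<in> Q" "f \<notin> P" using Q(2) by blast
    obtain p where p: "p \<in> subalgebra_gen \<iota> G" "f - p \<in> K" using generated by blast
    have "p \<in> Q"
      using is_ideal_cong[OF diff_idealD(1)[OF Q(1)], of f p] diff_idealD(2)[OF Q(1)] p(2) f(1) by blast
    moreover have "p \<notin> P"
      using is_ideal_cong[OF is_primeD(1)[OF pr], of f p] is_primeD(2)[OF pr] p(2) f(2) by blast
    ultimately show ?thesis
      using subalgebra_gen_subset_span_monomials[OF finite_gens p(1)] E(2)[OF Q(1)] Q(2) by blast
  qed
  then show ?thesis using E(1) by blast
qed

end

section \<open>A Nullstellensatz avoiding fewer than continuum many elements\<close>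

lemma lists_lepoll_infinite:
  includes cardinal_syntax
  assumes A: "infinite A"
  shows "lists A \<lesssim> A"
proof -
  have "|{xs \<in> lists A. length xs = n}| \<le>o |A|" for n
  proof (induction n)
    case 0
    have "finite {xs \<in> lists A. length xs = 0}" by simp
    then show ?case using A by (rule ordLeq3_finite_infinite)
  next
    case (Suc n)
    let ?L = "\<lambda>n. {xs \<in> lists A. length xs = n}"
    have "?L (Suc n) \<subseteq> (\<lambda>(x, xs). x # xs) ` (A \<times> ?L n)"
      by (auto simp: length_Suc_conv image_iff)
    then have "|?L (Suc n)| \<le>o |A \<times> ?L n|" by (rule surj_imp_ordLeq)
    moreover have "|A \<times> ?L n| \<le>o |A|"
      by (rule card_of_Sigma_ordLeq_infinite[OF A card_of_mono1[OF order_refl]]) (use Suc in blast)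
    ultimately show ?case by (rule ordLeq_transitive)
  qed
  then have "|\<Union>n\<in>UNIV :: nat set. {xs \<in> lists A. length xs = n}| \<le>o |A|"
    using A by (intro card_of_UNION_ordLeq_infinite) (auto simp: infinite_iff_card_of_nat)
  moreover have "(\<Union>n\<in>UNIV :: nat set. {xs \<in> lists A. length xs = n}) = lists A" by auto
  ultimately show ?thesis by (simp add: lepoll_def card_of_ordLeq)
qed

text \<open>With finite fibres only, the complex numbers would be a union of finite sets indexed by
  \<open>lists A \<times> UNIV\<close>: countable if \<open>A\<close> is countable, and of size at
  most that of \<open>A\<close> otherwise.\<close>

lemma ex_infinite_fibre:
  includes cardinal_syntax
  fixes f :: "complex \<Rightarrow> 'b list \<times> nat"
  assumes A: "A \<prec> (UNIV :: complex set)" and f: "\<And>z. f z \<in> lists A \<times> UNIV"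
  shows "\<exists>y. infinite (f -` {y})"
proof (rule ccontr)
  assume "\<not> ?thesis"
  then have fin: "finite (f -` {y})" for y by blast
  have UN: "(\<Union>y\<in>lists A \<times> UNIV. f -` {y}) = UNIV" using f by auto
  show False
  proof (cases "countable A")
    case True
    then have "countable (lists A \<times> (UNIV :: nat set))" by (intro countable_SIGMA countable_lists) auto
    then have "countable (\<Union>y\<in>lists A \<times> UNIV. f -` {y})"
      by (rule countable_UN) (rule countable_finite[OF fin])
    then show False using uncountable_UNIV_complex UN by simp
  next
    case False
    then have inf: "infinite A" using countable_finite by blast
    have "|lists A \<times> (UNIV :: nat set)| \<le>o |A|"
    proof (rule card_of_Sigma_ordLeq_infinite[OF inf])
      show "|lists A| \<le>o |A|"
        using lists_lepoll_infinite[OF inf] by (simp add: lepoll_def card_of_ordLeq)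
      show "\<forall>i\<in>lists A. |UNIV :: nat set| \<le>o |A|" using inf by (simp add: infinite_iff_card_of_nat)
    qed
    moreover have "|f -` {y}| \<le>o |A|" for y
      using fin[of y] inf by (rule ordLeq3_finite_infinite)
    ultimately have "|\<Union>y\<in>lists A \<times> UNIV. f -` {y}| \<le>o |A|"
      by (intro card_of_UNION_ordLeq_infinite inf) auto
    then have "(UNIV :: complex set) \<lesssim> A" by (simp add: UN lepoll_def card_of_ordLeq)
    then show False using A by (meson lesspoll_def lepoll_antisym)
  qed
qed

context affine_differential_algebra
begin

section \<open>Evaluation of complex polynomials at a ring element\<close>

definition eval_at :: "'r \<Rightarrow> complex poly \<Rightarrow> 'r" where
  "eval_at a p = poly (map_poly \<iota> p) a"

lemma eval_at_add: "eval_at a (p + q) = eval_at a p + eval_at a q"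
proof -
  have "map_poly \<iota> (p + q) = map_poly \<iota> p + map_poly \<iota> q"
    by (rule poly_eqI) (simp add: coeff_map_poly iota_zero iota_add)
  then show ?thesis by (simp add: eval_at_def)
qed

lemma eval_at_smult: "eval_at a (Polynomial.smult c p) = \<iota> c * eval_at a p"
proof -
  have "map_poly \<iota> (Polynomial.smult c p) = Polynomial.smult (\<iota> c) (map_poly \<iota> p)"
    by (rule poly_eqI) (simp add: coeff_map_poly iota_zero iota_mult)
  then show ?thesis by (simp add: eval_at_def)
qed

lemma eval_at_const: "eval_at a [:c:] = \<iota> c"
  by (simp add: eval_at_def map_poly_pCons iota_zero)

lemma eval_at_shift: "eval_at a (pCons 0 p) = a * eval_at a p"
  by (simp add: eval_at_def map_poly_pCons iota_zero)

lemma eval_at_linear_times: "eval_at a ([:- l, 1:] * p) = (a - \<iota> l) * eval_at a p"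
proof -
  have "[:- l, 1:] * p = Polynomial.smult (- l) p + pCons 0 p" by simp
  then have "eval_at a ([:- l, 1:] * p) = \<iota> (- l) * eval_at a p + a * eval_at a p"
    by (simp only: eval_at_add eval_at_smult eval_at_shift)
  then show ?thesis by (simp add: iota_uminus algebra_simps)
qed

lemma eval_at_prod_linear:
  "finite I \<Longrightarrow> eval_at a (\<Prod>i\<in>I. [:- l i, 1:]) = (\<Prod>i\<in>I. a - \<iota> (l i))"
  by (induction I rule: finite_induct)
    (simp_all add: eval_at_linear_times eval_at_const iota_one one_pCons del: mult_pCons_left)

lemma eval_at_sum: "eval_at a (\<Sum>i\<in>I. p i) = (\<Sum>i\<in>I. eval_at a (p i))"
  by (induction I rule: infinite_finite_induct)
    (simp_all add: eval_at_add eval_at_const[of a 0, simplified] iota_zero)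

text \<open>By the fundamental theorem of algebra \<open>q\<close> is a scalar times linear factors,
  and a prime ideal containing their product contains one of them.\<close>

lemma eval_at_mem_prime:
  assumes N: "is_prime N"
  shows "q \<noteq> 0 \<Longrightarrow> eval_at a q \<in> N \<Longrightarrow> \<exists>c. a - \<iota> c \<in> N"
proof (induction "Polynomial.degree q" arbitrary: q rule: less_induct)
  case less
  show ?case
  proof (cases "constant (poly q)")
    case True
    then obtain c where "q = [:c:]" using constant_degree[of q] degree_eq_zeroE by blast
    then show ?thesis using less.prems is_prime_iota[OF N] by (simp add: eval_at_const)
  next
    case False
    then obtain z where "poly q z = 0" using fundamental_theorem_of_algebra by blast
    then obtain p where p: "q = [:- z, 1:] * p" by (auto simp: poly_eq_0_iff_dvd elim: dvdE)
    then have "p \<noteq> 0" using less.prems(1) by auto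
    then have "Polynomial.degree q = Suc (Polynomial.degree p)"
      unfolding p by (subst degree_mult_eq) auto
    moreover have "a - \<iota> z \<in> N \<or> eval_at a p \<in> N"
      using less.prems(2) is_primeD(4)[OF N] unfolding p eval_at_linear_times by blast
    ultimately show ?thesis using less.hyps[of p] \<open>p \<noteq> 0\<close> by auto
  qed
qed

text \<open>\<open>r\<close> inverses \<open>b j = s / (a - l j)\<close> which are linearly dependent give a polynomial
  relation for \<open>a\<close>, by partial fractions.\<close>

lemma ex_eigenvalue_of_dependent_inverses:
  fixes l :: "nat \<Rightarrow> complex"
  assumes N: "is_prime N" and s: "s \<notin> N" and l: "inj_on l {..<r}"
    and b: "\<And>j. j < r \<Longrightarrow> b j * (a - \<iota> (l j)) - s \<in> N"
    and c: "\<exists>j<r. c j \<noteq> 0" "(\<Sum>j<r. \<iota> (c j) * b j) = 0"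
  shows "\<exists>z. a - \<iota> z \<in> N"
proof (rule eval_at_mem_prime[OF N])
  define p where "p j = (\<Prod>i\<in>{..<r} - {j}. [:- l i, 1:])" for j
  define q where "q = (\<Sum>j<r. Polynomial.smult (c j) (p j))"
  have poly_p: "poly (p j) x = (\<Prod>i\<in>{..<r} - {j}. x - l i)" for j x
    by (simp add: p_def poly_prod)
  obtain k where k: "k < r" "c k \<noteq> 0" using c(1) by blast
  \<comment> \<open>Evaluation at \<open>l k\<close> kills every summand except the
    \<open>k\<close>-th, so the relation \<open>q\<close> is not the zero polynomial.\<close>
  have "poly q (l k) = (\<Sum>j<r. c j * poly (p j) (l k))" by (simp add: q_def poly_sum)
  also have "\<dots> = (\<Sum>j<r. if j = k then c k * poly (p k) (l k) else 0)"
  proof (rule sum.cong[OF refl])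
    fix j assume "j \<in> {..<r}"
    then have "j \<noteq> k \<Longrightarrow> poly (p j) (l k) = 0"
      unfolding poly_p using k by (intro prod_zero) auto
    then show "c j * poly (p j) (l k) = (if j = k then c k * poly (p k) (l k) else 0)" by simp
  qed
  also have "\<dots> = c k * poly (p k) (l k)" using k by simp
  also have "\<dots> \<noteq> 0"
    using k l by (auto simp: poly_p prod_zero_iff inj_on_def)
  finally show "q \<noteq> 0" by auto
  have eval_p: "eval_at a (p j) = (\<Prod>i\<in>{..<r} - {j}. a - \<iota> (l i))" for j
    unfolding p_def by (rule eval_at_prod_linear) simp
  \<comment> \<open>Modulo \<open>N\<close> the factor \<open>s\<close> in the \<open>j\<close>-th
    summand may be replaced by \<open>b j * (a - \<iota> (l j))\<close>. This completes every
    product, and the sum becomes the given dependence times the full product.\<close>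
  have "s * eval_at a q = (\<Sum>j<r. \<iota> (c j) * (s * eval_at a (p j)))"
    by (simp add: q_def eval_at_sum eval_at_smult sum_distrib_left mult.left_commute)
  also have "\<dots> = (\<Sum>j<r. \<iota> (c j) * b j) * (\<Prod>i<r. a - \<iota> (l i))
      - (\<Sum>j<r. \<iota> (c j) * eval_at a (p j) * (b j * (a - \<iota> (l j)) - s))"
  proof -
    have "(\<Prod>i<r. a - \<iota> (l i)) = (a - \<iota> (l j)) * eval_at a (p j)" if "j < r" for j
      unfolding eval_p using that by (intro prod.remove) auto
    then have "(\<Sum>j<r. \<iota> (c j) * b j) * (\<Prod>i<r. a - \<iota> (l i)) =
        (\<Sum>j<r. \<iota> (c j) * b j * ((a - \<iota> (l j)) * eval_at a (p j)))"
      unfolding sum_distrib_right by (intro sum.cong) auto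
    then show ?thesis by (simp add: algebra_simps flip: sum_subtractf)
  qed
  also have "\<dots> = - (\<Sum>j<r. \<iota> (c j) * eval_at a (p j) * (b j * (a - \<iota> (l j)) - s))"
    unfolding c(2) by simp
  also have "\<dots> \<in> N"
    using b by (intro is_ideal_uminus is_ideal_sum is_ideal_lmult[of N "b _ * (a - _) - s"]
        is_primeD(1)[OF N]) auto
  finally show "eval_at a q \<in> N" using is_primeD(4)[OF N] s by blast
qed

text \<open>\<open>N\<close> is maximal among the ideals above \<open>P\<close> that miss all
  products of elements of \<open>A\<close>, hence prime. If no \<open>a - \<iota> c\<close> were in
  \<open>N\<close>, each would divide such a product modulo \<open>N\<close>. Infinitely many
  \<open>c\<close> share the product and the exponent bound of the cofactor; enough of these
  cofactors are linearly dependent, and partial fractions produce a scalar after all.\<close>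

theorem nullstellensatz_avoiding:
  assumes P: "is_prime P" and A: "A \<prec> (UNIV :: complex set)" "A \<inter> P = {}"
  shows "\<exists>N. is_prime N \<and> P \<subseteq> N \<and> A \<inter> N = {} \<and> (\<forall>a. \<exists>c. a - \<iota> c \<in> N)"
proof -
  define S where "S = prod_list ` lists A"
  have S1: "1 \<in> S" unfolding S_def by (force intro: image_eqI[of _ _ "[]"])
  have S_mult: "s * t \<in> S" if st: "s \<in> S" "t \<in> S" for s t
  proof -
    obtain as bs where "as \<in> lists A" "s = prod_list as" "bs \<in> lists A" "t = prod_list bs"
      using st unfolding S_def by blast
    then show ?thesis unfolding S_def by (intro image_eqI[of _ _ "as @ bs"]) auto
  qed
  have AS: "A \<subseteq> S"
  proof
    fix a assume "a \<in> A"
    then show "a \<in> S" unfolding S_def by (intro image_eqI[of _ _ "[a]"]) auto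
  qed
  define F where "F = {I. is_ideal I \<and> P \<subseteq> I \<and> I \<inter> S = {}}"
  have "prod_list as \<notin> P" if "as \<in> lists A" for as
    using is_prime_prod_list[OF P, of as] that A(2) by (auto simp: in_lists_conv_set)
  then have "P \<in> F" using is_primeD(1)[OF P] by (auto simp: F_def S_def)
  moreover have "is_ideal I \<and> K \<subseteq> I" if "I \<in> F" for I
    using that is_primeD(2)[OF P] by (auto simp: F_def)
  ultimately obtain N where N: "N \<in> F" and max: "\<And>J. J \<in> F \<Longrightarrow> N \<subseteq> J \<Longrightarrow> J = N"
    using ideal_maximal_exists[of P F] by metis
  have idN: "is_ideal N" and PN: "P \<subseteq> N" and NS: "N \<inter> S = {}" using N by (auto simp: F_def)
  have meets: "\<exists>i r. i \<in> N \<and> i + r * a \<in> S" if "a \<notin> N" for a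
  proof -
    have "extend_ideal N a \<notin> F" using max extend_ideal(2,3)[OF idN] that by blast
    then have "extend_ideal N a \<inter> S \<noteq> {}"
      using extend_ideal(1,2)[OF idN, of a] PN by (auto simp: F_def)
    then show ?thesis by (auto simp: extend_ideal_def)
  qed
  have N_prime: "is_prime N"
    unfolding is_prime_def
  proof (intro conjI allI impI idN)
    show "K \<subseteq> N" using is_primeD(2)[OF P] PN by blast
    show "1 \<notin> N" using S1 NS by blast
    fix a b assume ab: "a * b \<in> N"
    show "a \<in> N \<or> b \<in> N"
    proof (rule ccontr)
      assume "\<not> ?thesis"
      then obtain i r j t where ir: "i \<in> N" "i + r * a \<in> S" and jt: "j \<in> N" "j + t * b \<in> S"
        using meets[of a] meets[of b] by blast
      have "(i + r * a) * (j + t * b) = i * (j + t * b) + r * a * j + (r * t) * (a * b)"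
        by (simp add: algebra_simps)
      also have "\<dots> \<in> N"
        by (intro is_ideal_add idN is_ideal_rmult[OF idN ir(1)] is_ideal_lmult[OF idN jt(1)]
            is_ideal_lmult[OF idN ab])
      finally show False using S_mult[OF ir(2) jt(2)] NS by blast
    qed
  qed
  have "\<exists>c. a - \<iota> c \<in> N" for a
  proof (rule ccontr)
    assume no: "\<not> ?thesis"
    \<comment> \<open>\<open>y\<close> records a word in \<open>A\<close> and an exponent bound for
      the cofactor \<open>p\<close>: fewer than continuum many values against continuum many
      \<open>z\<close>.\<close>
    have "\<exists>p y. y \<in> lists A \<times> UNIV \<and> p \<in> vs.span (monomials G (snd y)) \<and>
        p * (a - \<iota> z) - prod_list (fst y) \<in> N" for z
    proof -
      have "a - \<iota> z \<notin> N" using no by blast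
      then obtain i r where "i \<in> N" "i + r * (a - \<iota> z) \<in> S" using meets by blast
      then obtain as where as: "as \<in> lists A" "i + r * (a - \<iota> z) = prod_list as"
        unfolding S_def by (elim imageE) simp
      obtain p where p: "p \<in> subalgebra_gen \<iota> G" "r - p \<in> K" using generated by blast
      obtain n where "p \<in> vs.span (monomials G n)"
        using subalgebra_gen_subset_span_monomials[OF finite_gens p(1)] by blast
      moreover have "p * (a - \<iota> z) - prod_list as = - (i + (r - p) * (a - \<iota> z))"
        by (simp add: as(2)[symmetric] algebra_simps)
      moreover have "- (i + (r - p) * (a - \<iota> z)) \<in> N"
        using p(2) is_primeD(2)[OF N_prime] \<open>i \<in> N\<close>
        by (intro is_ideal_uminus is_ideal_add is_ideal_rmult idN) auto
      ultimately show ?thesis using as(1) by (intro exI[of _ p] exI[of _ "(as, n)"]) auto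
    qed
    then obtain p f where f: "\<And>z. f z \<in> lists A \<times> UNIV"
      "\<And>z. p z \<in> vs.span (monomials G (snd (f z)))"
      "\<And>z. p z * (a - \<iota> z) - prod_list (fst (f z)) \<in> N" by metis
    obtain y where "infinite (f -` {y})" using ex_infinite_fibre[OF A(1), of f] f(1) by blast
    define T where "T = monomials G (snd y)"
    \<comment> \<open>One scalar more than the span of \<open>T\<close> has room for.\<close>
    define r where "r = Suc (card T)"
    obtain Z where Z: "Z \<subseteq> f -` {y}" "finite Z" "card Z = r"
      using infinite_arbitrarily_large[OF \<open>infinite (f -` {y})\<close>] by blast
    then obtain l where "bij_betw l {..<r} Z"
      using ex_bij_betw_nat_finite[OF Z(2)] by (auto simp: lessThan_atLeast0)
    then have l: "inj_on l {..<r}" "\<And>j. j < r \<Longrightarrow> f (l j) = y"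
      using Z(1) by (auto simp: bij_betw_def)
    have "\<exists>c. (\<exists>j<r. c j \<noteq> 0) \<and> (\<Sum>j<r. \<iota> (c j) * p (l j)) = 0"
    proof (rule linear_dependence)
      show "finite T" unfolding T_def by (rule finite_monomials[OF finite_gens])
      show "p (l j) \<in> vs.span T" if "j < r" for j
        using f(2)[of "l j"] l(2)[OF that] by (simp add: T_def)
    qed (simp add: r_def)
    then obtain c where c: "\<exists>j<r. c j \<noteq> 0" "(\<Sum>j<r. \<iota> (c j) * p (l j)) = 0" by blast
    have "prod_list (fst y) \<notin> N"
      using f(1)[of "l 0"] l(2)[of 0] NS by (auto simp: S_def r_def)
    then have "\<exists>z. a - \<iota> z \<in> N"
      by (rule ex_eigenvalue_of_dependent_inverses[OF N_prime _ l(1) _ c]) (use f(3) l(2) in metis)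
    then show False using no by blast
  qed
  then show ?thesis using N_prime PN NS AS by blast
qed

section \<open>Maximal ideals and their residue fields\<close>

lemma is_maximal_imp_prime:
  assumes N: "is_maximal N"
  shows "is_prime N"
proof -
  have id: "is_ideal N" using N by (simp add: is_maximal_def)
  have "b \<in> N" if ab: "a * b \<in> N" and a: "a \<notin> N" for a b
  proof -
    have "extend_ideal N a = UNIV"
      using N extend_ideal(1-3)[OF id, of a] a unfolding is_maximal_def by blast
    then obtain i r where ir: "i \<in> N" "1 = i + r * a" unfolding extend_ideal_def by blast
    have "b = (i + r * a) * b" by (simp flip: ir(2))
    also have "\<dots> = i * b + r * (a * b)" by (simp add: algebra_simps)
    also have "\<dots> \<in> N" by (intro is_ideal_add is_ideal_rmult[OF id ir(1)] is_ideal_lmult[OF id ab] id)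
    finally show ?thesis .
  qed
  then show ?thesis using N by (auto simp: is_prime_def is_maximal_def)
qed

lemma is_maximalI:
  assumes N: "is_prime N" and res: "\<And>a. \<exists>c. a - \<iota> c \<in> N"
  shows "is_maximal N"
  unfolding is_maximal_def
proof (intro conjI allI impI is_primeD[OF N])
  fix J assume J: "is_ideal J" "N \<subseteq> J"
  show "J = N \<or> J = UNIV"
  proof (rule disjCI)
    assume "J \<noteq> UNIV"
    have "a \<in> N" if a: "a \<in> J" for a
    proof -
      obtain c where c: "a - \<iota> c \<in> N" using res by blast
      then have "\<iota> c \<in> J" using is_ideal_cong[OF J(1), of a "\<iota> c"] J(2) a by blast
      have "c = 0"
      proof (rule ccontr)
        assume "c \<noteq> 0"
        then have "1 \<in> J" using iota_mult_mem[OF J(1), of c 1] \<open>\<iota> c \<in> J\<close> by simp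
        then show False using is_ideal_rmult[OF J(1), of 1] \<open>J \<noteq> UNIV\<close> by auto
      qed
      then show ?thesis using c by (simp add: iota_zero)
    qed
    then show "J = N" using J(2) by blast
  qed
qed

lemma is_maximal_residue:
  assumes N: "is_maximal N"
  shows "\<exists>c. a - \<iota> c \<in> N"
proof -
  \<comment> \<open>With nothing to avoid, the theorem is the ordinary Nullstellensatz.\<close>
  have "{} \<prec> (UNIV :: complex set)" by (simp add: lesspoll_def eqpoll_def bij_betw_def lepoll_def)
  then obtain N' where N': "is_prime N'" "N \<subseteq> N'" "\<forall>a. \<exists>c. a - \<iota> c \<in> N'"
    using nullstellensatz_avoiding[OF is_maximal_imp_prime[OF N]] by blast
  then have "N' = N" using N is_primeD(1,3) unfolding is_maximal_def by blast
  then show ?thesis using N'(3) by blast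
qed

section \<open>The Dixmier-Moeglin equivalence for differential ideals\<close>

lemma primitive_in_Dspec: "primitive P \<Longrightarrow> P \<in> Dspec"
  unfolding primitive_def using core_in_Dspec is_maximal_imp_prime by blast

text \<open>The core of a maximal ideal that contains \<open>P\<close> and misses \<open>A\<close>
  is a differential prime between \<open>P\<close> and that ideal. It misses \<open>A\<close> too,
  so it cannot be larger than \<open>P\<close>.\<close>

lemma primitive_if_avoids:
  assumes P: "P \<in> Dspec" and A: "A \<prec> (UNIV :: complex set)" "A \<inter> P = {}"
    and sep: "\<And>Q. Q \<in> Dspec \<Longrightarrow> P \<subset> Q \<Longrightarrow> A \<inter> Q \<noteq> {}"
  shows "primitive P"
proof -
  obtain N where N: "is_prime N" "P \<subseteq> N" "A \<inter> N = {}" "\<And>a. \<exists>c. a - \<iota> c \<in> N"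
    using nullstellensatz_avoiding[OF DspecD(1)[OF P] A] by blast
  obtain I where I: "is_core N I" using core_exists is_primeD[OF N(1)] by blast
  have "I \<in> Dspec" by (rule core_in_Dspec[OF N(1) I])
  moreover have "P \<subseteq> I" "I \<subseteq> N" using I DspecD(2)[OF P] N(2) unfolding is_core_def by auto
  ultimately have "I = P" using sep N(3) by blast
  then show ?thesis using I is_maximalI[OF N(1,4)] unfolding primitive_def by blast
qed

lemma loc_closed_imp_primitive:
  assumes "loc_closed P"
  shows "primitive P"
proof -
  obtain f where "P \<in> Dspec" "f \<notin> P" "\<forall>Q\<in>Dspec. P \<subset> Q \<longrightarrow> f \<in> Q"
    using assms unfolding loc_closed_def by blast
  moreover have "{f} \<prec> (UNIV :: complex set)"
    by (rule finite_lesspoll_infinite) (simp_all add: infinite_UNIV_char_0)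
  ultimately show ?thesis by (intro primitive_if_avoids[of P "{f}"]) auto
qed

text \<open>A constant fraction \<open>z = a / s\<close> is represented by pairs \<open>(b, e)\<close> with \<open>b z = e\<close>. The
  denominators \<open>b\<close> and, for each scalar \<open>c\<close>, the numerators \<open>e - c b\<close> of \<open>z - c\<close> form
  differential ideals.\<close>

theorem primitive_imp_rational:
  assumes "primitive P"
  shows "rational P"
  unfolding rational_def
proof (intro conjI allI impI)
  obtain N where N: "is_maximal N" "is_core N P" using assms unfolding primitive_def by blast
  show PD: "P \<in> Dspec" by (rule primitive_in_Dspec[OF assms])
  note prP = DspecD(1)[OF PD] and idP = DspecD(3)[OF PD] and dP = DspecD(2)[OF PD]
  note prN = is_maximal_imp_prime[OF N(1)] note idN = is_primeD(1)[OF prN]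
  have PN: "P \<subseteq> N" and max: "\<And>J. diff_ideal J \<Longrightarrow> J \<subseteq> N \<Longrightarrow> J \<subseteq> P"
    using N(2) by (auto simp: is_core_def)
  fix a s assume s: "s \<notin> P" and const: "\<forall>d\<in>\<Delta>. s * d a - a * d s \<in> P"
  define rep where "rep b e \<longleftrightarrow> a * b - s * e \<in> P" for b e
  have rep_add: "rep (b + b') (e + e')" if "rep b e" "rep b' e'" for b e b' e'
    using is_ideal_add[OF idP that[unfolded rep_def]] by (simp add: rep_def algebra_simps)
  have rep_mult: "rep (r * b) (r * e)" if "rep b e" for r b e
    using is_ideal_lmult[OF idP that[unfolded rep_def], of r] by (simp add: rep_def algebra_simps)
  have rep_P: "rep b e" if "b \<in> P" "e \<in> P" for b e
    unfolding rep_def by (intro is_ideal_diff is_ideal_lmult idP that)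
  have rep_deriv: "rep (d b) (d e)" if be: "rep b e" and d: "d \<in> \<Delta>" for b e d
  proof -
    define x where "x = a * b - s * e"
    define t1 where "t1 = d (x + s * e) - (d x + d (s * e))"
    define t2 where "t2 = d (s * e) - (s * d e + d s * e)"
    define t3 where "t3 = d (a * b) - (a * d b + d a * b)"
    have K: "t1 \<in> P" "t2 \<in> P" "t3 \<in> P"
      unfolding t1_def t2_def t3_def
      using deriv_add[OF d] deriv_mult[OF d] is_primeD(2)[OF prP] by blast+
    have x: "x \<in> P" "d x \<in> P" using be diff_idealD(3)[OF dP d] by (simp_all add: rep_def x_def)
    have c: "s * d a - a * d s \<in> P" using const d by blast
    have "s * (a * d b - s * d e) = s * (d x + t1 + t2 - t3) - b * (s * d a - a * d s) - d s * x"
      by (simp add: t1_def t2_def t3_def x_def algebra_simps)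
    also have "\<dots> \<in> P" by (intro is_ideal_diff is_ideal_add is_ideal_lmult idP K x c)
    finally show ?thesis using is_primeD(4)[OF prP] s unfolding rep_def by blast
  qed
  \<comment> \<open>The denominators include \<open>s\<close>, which is not in \<open>P\<close>; by
    maximality of the core they cannot all lie in \<open>N\<close>. The fraction is thus defined at
    the point \<open>N\<close>.\<close>
  have "diff_ideal {b. \<exists>e. rep b e}"
    unfolding diff_ideal_def is_ideal_iff
    using rep_add rep_mult rep_deriv rep_P is_primeD(2)[OF prP] is_ideal_0[OF idP] by blast
  moreover have "rep s a" using is_ideal_0[OF idP] by (simp add: rep_def mult.commute)
  ultimately obtain b e where be: "rep b e" "b \<notin> N" using max s by blast
  obtain \<beta> where \<beta>: "b - \<iota> \<beta> \<in> N" using is_maximal_residue[OF N(1)] by blast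
  obtain \<epsilon> where \<epsilon>: "e - \<iota> \<epsilon> \<in> N" using is_maximal_residue[OF N(1)] by blast
  have "\<beta> \<noteq> 0" using \<beta> be(2) by (auto simp: iota_zero)
  \<comment> \<open>The value of the fraction at the point \<open>N\<close>.\<close>
  define c where "c = \<epsilon> / \<beta>"
  have "\<iota> c * \<iota> \<beta> = \<iota> \<epsilon>" using \<open>\<beta> \<noteq> 0\<close> by (simp add: c_def flip: iota_mult)
  then have "e - \<iota> c * b = (e - \<iota> \<epsilon>) - \<iota> c * (b - \<iota> \<beta>)"
    by (simp add: algebra_simps)
  also have "\<dots> \<in> N" by (intro is_ideal_diff[OF idN \<epsilon>] is_ideal_lmult[OF idN \<beta>])
  finally have ecb: "e - \<iota> c * b \<in> N" .
  define J where "J = {e - \<iota> c * b |b e. rep b e}"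
  have JI: "e - \<iota> c * b \<in> J" if "rep b e" for b e using that by (auto simp: J_def)
  have "diff_ideal J"
    unfolding diff_ideal_def is_ideal_iff
  proof (intro conjI ballI allI)
    show KJ: "K \<subseteq> J"
    proof
      fix k assume "k \<in> K"
      then have "rep 0 k" using rep_P is_primeD(2)[OF prP] is_ideal_0[OF idP] by blast
      then show "k \<in> J" using JI[of 0 k] by simp
    qed
    then show "0 \<in> J" using is_ideal_0[OF K_ideal] by blast
    have JE: "\<exists>b e. x = e - \<iota> c * b \<and> rep b e" if "x \<in> J" for x using that by (auto simp: J_def)
    fix x assume "x \<in> J"
    then obtain b e where x: "x = e - \<iota> c * b" "rep b e" using JE by blast
    show "r * x \<in> J" for r
      using JI[OF rep_mult[OF x(2), of r]] by (simp add: x algebra_simps)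
    show "x + y \<in> J" if y: "y \<in> J" for y
    proof -
      obtain b' e' where y': "y = e' - \<iota> c * b'" "rep b' e'" using JE y by blast
      show ?thesis using JI[OF rep_add[OF x(2) y'(2)]] by (simp add: x y'(1) algebra_simps)
    qed
    show "d x \<in> J" if d: "d \<in> \<Delta>" for d
    proof -
      define t1 where "t1 = d (x + \<iota> c * b) - (d x + d (\<iota> c * b))"
      define t2 where "t2 = d (\<iota> c * b) - (\<iota> c * d b + d (\<iota> c) * b)"
      have "t1 \<in> P" "t2 \<in> P" "d (\<iota> c) \<in> P"
        unfolding t1_def t2_def
        using deriv_add[OF d] deriv_mult[OF d] deriv_iota[OF d] is_primeD(2)[OF prP] by blast+
      \<comment> \<open>Elements of \<open>P\<close> may be added to a numerator without changing
        the fraction. This absorbs the terms by which \<open>d\<close> fails to be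
        complex-linear.\<close>
      then have "rep 0 (- t1 - t2 - d (\<iota> c) * b)"
        by (intro rep_P is_ideal_0[OF idP] is_ideal_diff is_ideal_rmult is_ideal_uminus idP)
      from JI[OF rep_add[OF rep_deriv[OF x(2) d] this]]
      have "d e + (- t1 - t2 - d (\<iota> c) * b) - \<iota> c * d b \<in> J" by simp
      moreover have "d e + (- t1 - t2 - d (\<iota> c) * b) - \<iota> c * d b = d x"
        by (simp add: t1_def t2_def x algebra_simps)
      ultimately show ?thesis by simp
    qed
  qed
  moreover have "J \<subseteq> N"
  proof
    fix x assume "x \<in> J"
    then obtain b' e' where x: "x = e' - \<iota> c * b'" "rep b' e'" by (auto simp: J_def)
    \<comment> \<open>Cross-multiplication of two representations of the same fraction: since
      \<open>b\<close> is invertible at \<open>N\<close>, vanishing of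
      \<open>e - \<iota> c * b\<close> there carries over to every numerator in
      \<open>J\<close>.\<close>
    have "b' * (a * b - s * e) - b * (a * b' - s * e') \<in> P"
      by (rule is_ideal_diff[OF idP is_ideal_lmult[OF idP be(1)[unfolded rep_def]]
            is_ideal_lmult[OF idP x(2)[unfolded rep_def]]])
    then have "s * (e' * b - e * b') \<in> P" by (simp add: algebra_simps)
    then have "e' * b - e * b' \<in> P" using is_primeD(4)[OF prP] s by blast
    then have "(e' * b - e * b') + b' * (e - \<iota> c * b) \<in> N"
      using PN ecb by (intro is_ideal_add is_ideal_lmult idN) auto
    then have "b * x \<in> N" by (simp add: x algebra_simps)
    then show "x \<in> N" using is_primeD(4)[OF prN] be(2) by blast
  qed
  ultimately have "J \<subseteq> P" by (rule max)
  then show "\<exists>c. a - \<iota> c * s \<in> P" using JI[OF \<open>rep s a\<close>] by blast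
qed

text \<open>A prime above \<open>extend_ideal P f\<close> is automatically different from
  \<open>P\<close>, so minimality among proper overprimes of \<open>P\<close> becomes plain
  minimality over the larger ideal.\<close>

lemma minimal_over_subset:
  assumes "f \<notin> P" "is_ideal P"
  shows "{Q \<in> minimal_over P. f \<in> Q} \<subseteq> minimal_Dspec_above (extend_ideal P f)"
proof
  fix Q assume "Q \<in> {Q \<in> minimal_over P. f \<in> Q}"
  then have Q: "Q \<in> Dspec" "P \<subset> Q" "\<not> (\<exists>Q'\<in>Dspec. P \<subset> Q' \<and> Q' \<subset> Q)" "f \<in> Q"
    by (auto simp: minimal_over_def)
  have "extend_ideal P f \<subseteq> Q"
    using extend_ideal(4)[OF assms(2) DspecD(3)[OF Q(1)]] Q by blast
  moreover have "P \<subset> Q'" if "extend_ideal P f \<subseteq> Q'" for Q'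
    using that extend_ideal(2,3)[OF assms(2), of f] assms(1) by blast
  then have "\<not> (\<exists>Q'\<in>Dspec. extend_ideal P f \<subseteq> Q' \<and> Q' \<subset> Q)" using Q(3) by metis
  ultimately show "Q \<in> minimal_Dspec_above (extend_ideal P f)"
    using Q(1) by (simp add: minimal_Dspec_above_def)
qed

lemma finite_minimal_over_containing:
  assumes "P \<in> Dspec" "f \<notin> P"
  shows "finite {Q \<in> minimal_over P. f \<in> Q}"
proof (rule finite_subset[OF minimal_over_subset])
  note id = DspecD(3)[OF assms(1)]
  show "finite (minimal_Dspec_above (extend_ideal P f))"
    using extend_ideal(1,2)[OF id, of f] is_primeD(2)[OF DspecD(1)[OF assms(1)]]
    by (intro finite_minimal_Dspec_above) auto
qed (use assms DspecD in auto)

lemma loc_closed_imp_finite: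
  assumes "loc_closed P"
  shows "finite (minimal_over P)"
proof -
  obtain f where f: "P \<in> Dspec" "f \<notin> P" "\<forall>Q\<in>Dspec. P \<subset> Q \<longrightarrow> f \<in> Q"
    using assms unfolding loc_closed_def by blast
  then have "minimal_over P = {Q \<in> minimal_over P. f \<in> Q}" by (auto simp: minimal_over_def)
  then show ?thesis using finite_minimal_over_containing[OF f(1,2)] by simp
qed

lemma finite_imp_loc_closed:
  assumes P: "P \<in> Dspec" and fin: "finite (minimal_over P)"
  shows "loc_closed P"
proof -
  have "\<exists>f. f \<in> Q \<and> f \<notin> P" if "Q \<in> minimal_over P" for Q
    using that by (auto simp: minimal_over_def)
  then obtain f where f: "\<And>Q. Q \<in> minimal_over P \<Longrightarrow> f Q \<in> Q \<and> f Q \<notin> P" by metis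
  \<comment> \<open>One factor from each minimal prime puts the product into all of them, hence into
    every larger differential prime.\<close>
  define g where "g = (\<Prod>Q\<in>minimal_over P. f Q)"
  have "g \<notin> P" unfolding g_def by (rule is_prime_prod[OF DspecD(1)[OF P]]) (use f in blast)
  moreover have "g \<in> Q" if Q: "Q \<in> Dspec" "P \<subset> Q" for Q
  proof -
    obtain Q' where Q': "Q' \<in> minimal_over P" "Q' \<subseteq> Q" using minimal_over_exists[OF P Q] by blast
    have "g = f Q' * (\<Prod>Q\<in>minimal_over P - {Q'}. f Q)"
      unfolding g_def by (rule prod.remove[OF fin Q'(1)])
    then show ?thesis
      using is_ideal_rmult[OF DspecD(3)[OF Q(1)]] f[OF Q'(1)] Q'(2) by auto
  qed
  ultimately show ?thesis using P unfolding loc_closed_def by blast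
qed

lemma small_minimal_over_imp_primitive:
  assumes P: "P \<in> Dspec" and small: "minimal_over P \<prec> (UNIV :: complex set)"
  shows "primitive P"
proof -
  have "\<exists>f. f \<in> Q \<and> f \<notin> P" if "Q \<in> minimal_over P" for Q
    using that by (auto simp: minimal_over_def)
  then obtain f where f: "\<And>Q. Q \<in> minimal_over P \<Longrightarrow> f Q \<in> Q \<and> f Q \<notin> P" by metis
  have "f ` minimal_over P \<prec> (UNIV :: complex set)"
    using small image_lepoll lesspoll_trans1 by blast
  then show ?thesis
  proof (rule primitive_if_avoids[OF P])
    fix Q assume "Q \<in> Dspec" "P \<subset> Q"
    then obtain Q' where "Q' \<in> minimal_over P" "Q' \<subseteq> Q" using minimal_over_exists[OF P] by blast
    then show "f ` minimal_over P \<inter> Q \<noteq> {}" using f[of Q'] by blast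
  qed (use f in blast)
qed

lemma rational_imp_countable:
  assumes "rational P"
  shows "countable (minimal_over P)"
proof -
  have P: "P \<in> Dspec" using assms by (simp add: rational_def)
  obtain E :: "nat \<Rightarrow> 'r" where E: "\<And>n. E n \<notin> P"
    "\<And>Q. diff_ideal Q \<Longrightarrow> P \<subset> Q \<Longrightarrow> \<exists>n. E n \<in> Q"
    using rational_countable_separating_set[OF assms] by blast
  have "minimal_over P \<subseteq> (\<Union>n. {Q \<in> minimal_over P. E n \<in> Q})"
  proof
    fix Q assume Q: "Q \<in> minimal_over P"
    then have "Q \<in> Dspec" "P \<subset> Q" by (simp_all add: minimal_over_def)
    then obtain n where "E n \<in> Q" using E(2)[OF DspecD(2)] by meson
    then show "Q \<in> (\<Union>n. {Q \<in> minimal_over P. E n \<in> Q})" using Q by blast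
  qed
  moreover have "countable (\<Union>n. {Q \<in> minimal_over P. E n \<in> Q})"
    by (rule countable_UN) (simp_all add: countable_finite[OF finite_minimal_over_containing[OF P E(1)]])
  ultimately show ?thesis by (rule countable_subset)
qed

theorem differential_dixmier_moeglin:
  "{P. loc_closed P} = {P. primitive P} \<and> {P. primitive P} = {P. rational P} \<longleftrightarrow>
   (\<forall>P\<in>Dspec. minimal_over P \<prec> (UNIV :: complex set) \<longrightarrow> finite (minimal_over P))"
proof
  assume DME: "{P. loc_closed P} = {P. primitive P} \<and> {P. primitive P} = {P. rational P}"
  show "\<forall>P\<in>Dspec. minimal_over P \<prec> (UNIV :: complex set) \<longrightarrow> finite (minimal_over P)"
    using small_minimal_over_imp_primitive loc_closed_imp_finite DME by blast
next
  assume small: "\<forall>P\<in>Dspec. minimal_over P \<prec> (UNIV :: complex set) \<longrightarrow> finite (minimal_over P)"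
  \<comment> \<open>Locally closed implies primitive and primitive implies rational without the
    hypothesis; this implication closes the cycle.\<close>
  have "loc_closed P" if "rational P" for P
  proof -
    have P: "P \<in> Dspec" using that by (simp add: rational_def)
    have c: "countable (minimal_over P)" by (rule rational_imp_countable[OF that])
    have "minimal_over P \<lesssim> (UNIV :: nat set)"
      using c by (auto simp: countable_def lepoll_def)
    have "(UNIV :: nat set) \<lesssim> (UNIV :: complex set)"
      using infinite_le_lepoll infinite_UNIV_char_0 by blast
    with \<open>minimal_over P \<lesssim> (UNIV :: nat set)\<close> have "minimal_over P \<lesssim> (UNIV :: complex set)"
      by (rule lepoll_trans)
    moreover have "\<not> minimal_over P \<approx> (UNIV :: complex set)"
      using c countable_eqpoll eqpoll_sym uncountable_UNIV_complex by blast
    ultimately have "minimal_over P \<prec> (UNIV :: complex set)" by (simp add: lesspoll_def)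
    then show ?thesis using small P finite_imp_loc_closed by blast
  qed
  then show "{P. loc_closed P} = {P. primitive P} \<and> {P. primitive P} = {P. rational P}"
    using loc_closed_imp_primitive primitive_imp_rational by blast
qed

end

section \<open>Presenting a Poisson algebra by a polynomial ring\<close>

context complex_poisson_algebra
begin

lemma scalar_closed [simp]: "x \<in> carrier A \<Longrightarrow> c \<odot> x \<in> carrier A"
  using smult_closed[of c x] by (simp add: ring_of_type_algebra_def)

lemma scalar_one: "x \<in> carrier A \<Longrightarrow> 1 \<odot> x = x"
  using smult_one[of x] by (simp add: ring_of_type_algebra_def)

end

text \<open>\<open>phi_surj\<close> asks for surjectivity on the subalgebra generated by
  \<open>G\<close>, as the ring may have further variables.\<close>

locale poisson_presentation = complex_poisson_algebra A + complex_structure_map \<iota>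
  for A :: "('a, 'm) poisson_algebra_scheme" (structure) and \<iota> :: "complex \<Rightarrow> 'r::comm_ring_1" +
  fixes \<phi> :: "'r \<Rightarrow> 'a" and G :: "'r set"
  assumes phi_closed [simp]: "\<phi> r \<in> carrier A"
    and phi_add: "\<phi> (r + s) = \<phi> r \<oplus> \<phi> s"
    and phi_mult: "\<phi> (r * s) = \<phi> r \<otimes> \<phi> s"
    and phi_iota: "\<phi> (\<iota> c) = c \<odot> \<one>"
    and finite_G: "finite G"
    and phi_surj: "carrier A \<subseteq> \<phi> ` subalgebra_gen \<iota> G"
begin

lemma scalar_mult: "x \<in> carrier A \<Longrightarrow> c \<odot> x = (c \<odot> \<one>) \<otimes> x"
  using smult_assoc2[of c \<one> x] by (simp add: ring_of_type_algebra_def)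

lemma phi_one: "\<phi> 1 = \<one>"
  using phi_iota[of 1] by (simp add: iota_one scalar_one)

lemma phi_zero: "\<phi> 0 = \<zero>"
  using phi_add[of 0 0] add.r_cancel_one[of "\<phi> 0" "\<phi> 0"] by simp

lemma phi_uminus: "\<phi> (- r) = \<ominus> \<phi> r"
  using phi_add[of "- r" r] phi_zero minus_equality[of "\<phi> (- r)" "\<phi> r"] by simp

lemma phi_diff: "\<phi> (r - s) = \<phi> r \<ominus> \<phi> s"
  using phi_add[of r "- s"] by (simp add: phi_uminus a_minus_def)

lemma phi_scalar: "\<phi> (\<iota> c * r) = c \<odot> \<phi> r"
  by (simp add: phi_mult phi_iota flip: scalar_mult)

lemma minus_eq_zero_iff: "x \<in> carrier A \<Longrightarrow> y \<in> carrier A \<Longrightarrow> x \<ominus> y = \<zero> \<longleftrightarrow> x = y"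
  using r_right_minus_eq by blast

lemma bracket_one: "y \<in> carrier A \<Longrightarrow> \<lbrace>\<one>, y\<rbrace> = \<zero>"
  using bracket_leibniz_left[of \<one> \<one> y] bracket_closed[of \<one> y]
    add.r_cancel_one'[of "\<lbrace>\<one>, y\<rbrace>" "\<lbrace>\<one>, y\<rbrace>"] by simp

lemma bracket_zero: "y \<in> carrier A \<Longrightarrow> \<lbrace>\<zero>, y\<rbrace> = \<zero>"
  using bracket_add_left[of \<zero> \<zero> y] bracket_closed[of \<zero> y]
    add.r_cancel_one'[of "\<lbrace>\<zero>, y\<rbrace>" "\<lbrace>\<zero>, y\<rbrace>"] by simp

text \<open>An arbitrary choice of preimages with no claim of compatibility with the operations;
  this is why the lifted brackets are derivations modulo \<open>K\<close> only.\<close>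

definition lift :: "'a \<Rightarrow> 'r" where
  "lift = inv_into UNIV \<phi>"

lemma phi_lift: "x \<in> carrier A \<Longrightarrow> \<phi> (lift x) = x"
  unfolding lift_def by (rule f_inv_into_f) (use phi_surj in blast)

lemma range_phi: "range \<phi> = carrier A"
  using phi_surj by auto

definition \<delta> :: "'r \<Rightarrow> 'r \<Rightarrow> 'r" where
  "\<delta> r s = lift \<lbrace>\<phi> r, \<phi> s\<rbrace>"

lemma phi_delta: "\<phi> (\<delta> r s) = \<lbrace>\<phi> r, \<phi> s\<rbrace>"
  by (simp add: \<delta>_def phi_lift bracket_closed)

definition K :: "'r set" where
  "K = {r. \<phi> r = \<zero>}"

definition \<Delta> :: "('r \<Rightarrow> 'r) set" where
  "\<Delta> = {\<lambda>r. \<delta> r s |s. True}"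

sublocale da: affine_differential_algebra \<iota> K \<Delta> G
proof unfold_locales
  show "finite G" by (rule finite_G)
  show "is_ideal K"
    by (simp add: is_ideal_iff K_def phi_zero phi_add phi_mult)
  fix a
  obtain p where "p \<in> subalgebra_gen \<iota> G" "\<phi> a = \<phi> p" using phi_surj phi_closed[of a] by blast
  then show "\<exists>p\<in>subalgebra_gen \<iota> G. a - p \<in> K"
    by (auto simp: K_def phi_diff minus_eq_zero_iff)
next
  fix d a assume "d \<in> \<Delta>" "a \<in> K"
  then show "d a \<in> K" by (auto simp: \<Delta>_def K_def phi_delta bracket_zero)
next
  fix d c assume "d \<in> \<Delta>"
  then show "d (\<iota> c) \<in> K"
    using smult_r_null[of c]
    by (auto simp: \<Delta>_def K_def phi_delta phi_iota bracket_smult_left bracket_one ring_of_type_algebra_def)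
next
  fix d a b assume "d \<in> \<Delta>"
  then show "d (a + b) - (d a + d b) \<in> K" "d (a * b) - (a * d b + d a * b) \<in> K"
    by (auto simp: \<Delta>_def K_def phi_diff phi_delta phi_add phi_mult minus_eq_zero_iff bracket_closed
        bracket_add_left bracket_leibniz_left)
qed

section \<open>Ideals of \<open>A\<close> as ideals containing \<open>K\<close>\<close>

definition pre :: "'a set \<Rightarrow> 'r set" where
  "pre I = {r. \<phi> r \<in> I}"

lemma mem_pre [simp]: "r \<in> pre I \<longleftrightarrow> \<phi> r \<in> I"
  by (simp add: pre_def)

lemma pre_subset_iff: "I \<subseteq> carrier A \<Longrightarrow> pre I \<subseteq> pre J \<longleftrightarrow> I \<subseteq> J"
proof
  assume I: "I \<subseteq> carrier A" and le: "pre I \<subseteq> pre J"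
  show "I \<subseteq> J"
  proof
    fix x assume "x \<in> I"
    then show "x \<in> J" using le I phi_lift[of x] subsetD[OF le, of "lift x"] by auto
  qed
qed auto

lemma pre_psubset_iff: "I \<subseteq> carrier A \<Longrightarrow> J \<subseteq> carrier A \<Longrightarrow> pre I \<subset> pre J \<longleftrightarrow> I \<subset> J"
  by (simp add: less_le_not_le pre_subset_iff)

lemma pre_inj: "I \<subseteq> carrier A \<Longrightarrow> J \<subseteq> carrier A \<Longrightarrow> pre I = pre J \<Longrightarrow> I = J"
  by (metis order_refl pre_subset_iff subset_antisym)

text \<open>An ideal containing \<open>K\<close> is a union of fibres of \<open>\<phi>\<close>, so
  image and preimage are inverse to each other.\<close>

lemma pre_image:
  assumes J: "is_ideal J" "K \<subseteq> J"
  shows "pre (\<phi> ` J) = J"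
proof
  show "pre (\<phi> ` J) \<subseteq> J"
  proof
    fix r assume "r \<in> pre (\<phi> ` J)"
    then obtain j where j: "j \<in> J" "\<phi> r = \<phi> j" by auto
    then have "r - j \<in> K" by (simp add: K_def phi_diff minus_eq_zero_iff)
    then show "r \<in> J" using is_ideal_cong[OF J(1), of r j] j(1) J(2) by blast
  qed
qed auto

lemma ideal_iff:
  assumes I: "I \<subseteq> carrier A"
  shows "ideal I A \<longleftrightarrow> is_ideal (pre I)"
proof
  assume "ideal I A"
  then interpret ideal I A .
  show "is_ideal (pre I)"
    by (simp add: is_ideal_iff phi_zero phi_add phi_mult a_closed I_l_closed)
next
  assume id: "is_ideal (pre I)"
  have lift: "lift x \<in> pre I" if "x \<in> I" for x using that I phi_lift[of x] by auto
  have mult: "y \<otimes> x \<in> I" if "x \<in> I" "y \<in> carrier A" for x y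
    using is_ideal_lmult[OF id lift[OF that(1)], of "lift y"] that I phi_lift by (auto simp: phi_mult)
  show "ideal I A"
  proof (rule idealI)
    show "ring A" by (rule ring_axioms)
    show "subgroup I (add_monoid A)"
    proof (rule add.subgroupI)
      show "I \<noteq> {}" using is_ideal_0[OF id] by auto
      show "\<ominus> x \<in> I" if "x \<in> I" for x
        using is_ideal_uminus[OF id lift[OF that]] that I phi_lift by (auto simp: phi_uminus)
      show "x \<oplus> y \<in> I" if "x \<in> I" "y \<in> I" for x y
        using is_ideal_add[OF id lift[OF that(1)] lift[OF that(2)]]
        by (simp add: phi_add phi_lift subsetD[OF I] that)
    qed (use I in auto)
    show "y \<otimes> x \<in> I" "x \<otimes> y \<in> I" if "x \<in> I" "y \<in> carrier A" for x y
      using mult[OF that] m_comm[of x y] that I by auto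
  qed
qed

lemma K_subset_pre: "ideal I A \<Longrightarrow> K \<subseteq> pre I"
proof
  fix r assume "ideal I A" "r \<in> K"
  then interpret ideal I A by simp
  show "r \<in> pre I" using \<open>r \<in> K\<close> by (simp add: K_def)
qed

lemma pre_one: "ideal I A \<Longrightarrow> 1 \<in> pre I \<longleftrightarrow> I = carrier A"
proof -
  assume "ideal I A"
  then interpret ideal I A .
  show ?thesis using one_imp_carrier by (auto simp: phi_one)
qed

lemma primeideal_iff:
  assumes I: "I \<subseteq> carrier A"
  shows "primeideal I A \<longleftrightarrow> da.is_prime (pre I)"
proof
  assume "primeideal I A"
  then interpret primeideal I A .
  show "da.is_prime (pre I)"
    unfolding da.is_prime_def
    using ideal_iff[OF I] K_subset_pre pre_one I_notcarr I_prime is_ideal by (auto simp: phi_mult)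
next
  assume pr: "da.is_prime (pre I)"
  then have id: "ideal I A" using ideal_iff[OF I] da.is_primeD(1) by blast
  show "primeideal I A"
  proof (rule primeidealI[OF id cring_axioms])
    show "carrier A \<noteq> I" using pre_one[OF id] da.is_primeD(3)[OF pr] by blast
    fix x y assume "x \<in> carrier A" "y \<in> carrier A" "x \<otimes> y \<in> I"
    then show "x \<in> I \<or> y \<in> I"
      using da.is_primeD(4)[OF pr, of "lift x" "lift y"] by (simp add: phi_mult phi_lift)
  qed
qed

lemma pre_UNIV: "pre (carrier A) = UNIV"
  by auto

lemma maximalideal_iff:
  assumes I: "I \<subseteq> carrier A"
  shows "maximalideal I A \<longleftrightarrow> da.is_maximal (pre I)"
proof
  assume "maximalideal I A"
  then interpret maximalideal I A .
  have "J = pre I \<or> J = UNIV" if J: "is_ideal J" "pre I \<subseteq> J" for J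
  proof -
    have J': "pre (\<phi> ` J) = J" using pre_image[OF J(1)] K_subset_pre[OF is_ideal] J(2) by blast
    have sub: "\<phi> ` J \<subseteq> carrier A" by auto
    have "ideal (\<phi> ` J) A" using ideal_iff[OF sub] J(1) J' by simp
    moreover have "I \<subseteq> \<phi> ` J" using pre_subset_iff[OF I, of "\<phi> ` J"] J(2) J' by simp
    ultimately have "\<phi> ` J = I \<or> \<phi> ` J = carrier A" using I_maximal sub by blast
    then show ?thesis using J' pre_UNIV by auto
  qed
  then show "da.is_maximal (pre I)"
    unfolding da.is_maximal_def
    using ideal_iff[OF I] K_subset_pre pre_one I_notcarr is_ideal by blast
next
  assume mx: "da.is_maximal (pre I)"
  then have id: "ideal I A" using ideal_iff[OF I] by (simp add: da.is_maximal_def)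
  show "maximalideal I A"
  proof (rule maximalidealI[OF id])
    show "carrier A \<noteq> I" using pre_one[OF id] mx unfolding da.is_maximal_def by blast
    fix J assume J: "ideal J A" "I \<subseteq> J" "J \<subseteq> carrier A"
    then have "is_ideal (pre J)" "pre I \<subseteq> pre J" using ideal_iff[OF J(3)] by auto
    then have "pre J = pre I \<or> pre J = pre (carrier A)"
      using mx unfolding da.is_maximal_def pre_UNIV by blast
    then show "J = I \<or> J = carrier A" using pre_inj I J(3) by blast
  qed
qed

lemma poisson_ideal_iff:
  assumes I: "I \<subseteq> carrier A"
  shows "poisson_ideal A I \<longleftrightarrow> da.diff_ideal (pre I)"
proof
  assume pI: "poisson_ideal A I"
  then have "d r \<in> pre I" if "d \<in> \<Delta>" "r \<in> pre I" for d r
    using that by (auto simp: poisson_ideal_def \<Delta>_def phi_delta)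
  then show "da.diff_ideal (pre I)"
    using pI ideal_iff[OF I] K_subset_pre by (simp add: poisson_ideal_def da.diff_ideal_def)
next
  assume d: "da.diff_ideal (pre I)"
  have "\<lbrace>x, y\<rbrace> \<in> I" if "x \<in> I" "y \<in> carrier A" for x y
  proof -
    have "lift x \<in> pre I" using that I phi_lift[of x] by auto
    then have "\<delta> (lift x) (lift y) \<in> pre I"
      using da.diff_idealD(3)[OF d, of "\<lambda>r. \<delta> r (lift y)" "lift x"] by (auto simp: \<Delta>_def)
    then show ?thesis using that I phi_lift by (auto simp: phi_delta)
  qed
  then show "poisson_ideal A I"
    using ideal_iff[OF I] da.diff_idealD(1)[OF d] by (simp add: poisson_ideal_def)
qed

lemma ideal_subset: "ideal I A \<Longrightarrow> I \<subseteq> carrier A"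
  using additive_subgroup.a_subset ideal.axioms(1) by blast

lemma Pspec_subset: "P \<in> Pspec A \<Longrightarrow> P \<subseteq> carrier A"
  by (simp add: Pspec_def poisson_ideal_def ideal_subset)

lemma Pspec_iff: "P \<subseteq> carrier A \<Longrightarrow> P \<in> Pspec A \<longleftrightarrow> pre P \<in> da.Dspec"
  by (simp add: Pspec_def da.Dspec_def primeideal_iff poisson_ideal_iff)

lemma Dspec_eq: "da.Dspec = pre ` Pspec A"
proof
  show "pre ` Pspec A \<subseteq> da.Dspec" using Pspec_iff Pspec_subset by blast
  show "da.Dspec \<subseteq> pre ` Pspec A"
  proof
    fix J assume J: "J \<in> da.Dspec"
    then have "pre (\<phi> ` J) = J" using pre_image da.is_primeD(1,2) da.DspecD(1) by blast
    moreover have "\<phi> ` J \<subseteq> carrier A" by auto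
    ultimately show "J \<in> pre ` Pspec A" using Pspec_iff[of "\<phi> ` J"] J by (metis image_eqI)
  qed
qed

lemma minimal_over_eq:
  assumes P: "P \<in> Pspec A"
  shows "da.minimal_over (pre P) = pre ` minimal_Pspec_over A P"
proof -
  have "da.minimal_over (pre P) = {Q \<in> pre ` Pspec A. pre P \<subset> Q \<and>
      \<not> (\<exists>Q'\<in>pre ` Pspec A. pre P \<subset> Q' \<and> Q' \<subset> Q)}"
    unfolding da.minimal_over_def Dspec_eq ..
  also have "\<dots> = pre ` {Q \<in> Pspec A. pre P \<subset> pre Q \<and> \<not> (\<exists>Q'\<in>Pspec A. pre P \<subset> pre Q' \<and> pre Q' \<subset> pre Q)}"
    by auto
  also have "{Q \<in> Pspec A. pre P \<subset> pre Q \<and> \<not> (\<exists>Q'\<in>Pspec A. pre P \<subset> pre Q' \<and> pre Q' \<subset> pre Q)}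
      = minimal_Pspec_over A P"
    by (simp add: minimal_Pspec_over_def pre_psubset_iff Pspec_subset P cong: conj_cong)
  finally show ?thesis .
qed

lemma minimal_over_eqpoll:
  assumes P: "P \<in> Pspec A"
  shows "da.minimal_over (pre P) \<approx> minimal_Pspec_over A P"
proof -
  have "inj_on pre (minimal_Pspec_over A P)"
    using pre_inj Pspec_subset by (auto simp: inj_on_def minimal_Pspec_over_def)
  then show ?thesis unfolding minimal_over_eq[OF P] by (rule inj_on_image_eqpoll_self)
qed

text \<open>\<open>GREATEST\<close> denotes nothing definite until a largest element is exhibited;
  the differential side supplies it.\<close>

lemma poisson_core_eq:
  assumes I: "I \<subseteq> carrier A" and M: "M \<subseteq> carrier A" and core: "da.is_core (pre M) (pre I)"
  shows "poisson_core A M = I"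
  unfolding poisson_core_def
proof (rule Greatest_equality)
  show "poisson_ideal A I \<and> I \<subseteq> M"
    using core poisson_ideal_iff[OF I] pre_subset_iff[OF I] by (simp add: da.is_core_def)
  fix J assume J: "poisson_ideal A J \<and> J \<subseteq> M"
  then have "J \<subseteq> carrier A" using M by blast
  then have "da.diff_ideal (pre J)" "pre J \<subseteq> pre M"
    using J poisson_ideal_iff pre_subset_iff by auto
  then have "pre J \<subseteq> pre I" using core unfolding da.is_core_def by blast
  then show "J \<subseteq> I" using pre_subset_iff[OF \<open>J \<subseteq> carrier A\<close>] by blast
qed

lemma poisson_primitive_iff: "poisson_primitive A P \<longleftrightarrow> P \<subseteq> carrier A \<and> da.primitive (pre P)"
proof
  assume "poisson_primitive A P"
  then obtain M where M: "maximalideal M A" "P = poisson_core A M" by (auto simp: poisson_primitive_def)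
  then have Mc: "M \<subseteq> carrier A" by (simp add: ideal_subset maximalideal_def)
  then have mx: "da.is_maximal (pre M)" using maximalideal_iff M(1) by simp
  then obtain J where J: "da.is_core (pre M) J"
    using da.core_exists[of "pre M"] by (auto simp: da.is_maximal_def)
  then have "da.diff_ideal J" by (simp add: da.is_core_def)
  then have JJ: "pre (\<phi> ` J) = J" by (intro pre_image da.diff_idealD)
  have sub: "\<phi> ` J \<subseteq> carrier A" by auto
  have "P = \<phi> ` J" unfolding M(2) by (rule poisson_core_eq[OF sub Mc]) (simp add: JJ J)
  then show "P \<subseteq> carrier A \<and> da.primitive (pre P)"
    using sub JJ J mx by (auto simp: da.primitive_def)
next
  assume P: "P \<subseteq> carrier A \<and> da.primitive (pre P)"
  then obtain N where N: "da.is_maximal N" "da.is_core N (pre P)" by (auto simp: da.primitive_def)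
  have NN: "pre (\<phi> ` N) = N" using N(1) by (intro pre_image) (simp_all add: da.is_maximal_def)
  have sub: "\<phi> ` N \<subseteq> carrier A" by auto
  have "maximalideal (\<phi> ` N) A" using maximalideal_iff[OF sub] N(1) NN by simp
  moreover have "poisson_core A (\<phi> ` N) = P"
    using P by (intro poisson_core_eq sub) (simp_all add: NN N)
  ultimately show "poisson_primitive A P" by (auto simp: poisson_primitive_def)
qed

section \<open>The Zariski topology on the Poisson primes\<close>

lemma openin_Pspec_topology:
  "openin (Pspec_topology A) U \<longleftrightarrow> (\<exists>S\<subseteq>carrier A. U = {Q \<in> Pspec A. \<not> S \<subseteq> Q})"
proof -
  have open_iff: "openin (zariski_topology A) =
      (\<lambda>U. \<exists>S\<subseteq>carrier A. U = prime_spec A - {P \<in> prime_spec A. S \<subseteq> P})"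
    unfolding zariski_topology_def by (rule topology_inverse'[OF istopology_zariski])
  have eq: "(prime_spec A - {P \<in> prime_spec A. S \<subseteq> P}) \<inter> Pspec A = {Q \<in> Pspec A. \<not> S \<subseteq> Q}" for S
    by (auto simp: prime_spec_def Pspec_def)
  have "openin (Pspec_topology A) U \<longleftrightarrow>
      (\<exists>S\<subseteq>carrier A. U = (prime_spec A - {P \<in> prime_spec A. S \<subseteq> P}) \<inter> Pspec A)"
    unfolding Pspec_topology_def openin_subtopology open_iff by blast
  then show ?thesis unfolding eq .
qed

lemma topspace_Pspec_topology: "topspace (Pspec_topology A) = Pspec A"
proof
  show "topspace (Pspec_topology A) \<subseteq> Pspec A"
    using openin_topspace[of "Pspec_topology A"] unfolding openin_Pspec_topology by auto
  have "Pspec A = {Q \<in> Pspec A. \<not> carrier A \<subseteq> Q}"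
    using primeideal.I_notcarr Pspec_subset by (fastforce simp: Pspec_def)
  then have "openin (Pspec_topology A) (Pspec A)" unfolding openin_Pspec_topology by blast
  then show "Pspec A \<subseteq> topspace (Pspec_topology A)" by (rule openin_subset)
qed

text \<open>Primes above \<open>P\<close> lie in every closed set containing \<open>P\<close>, so an
  open set isolating \<open>P\<close> must exclude them; an element outside \<open>P\<close> of the
  set defining it then belongs to all of them. Conversely, the basic open set of \<open>f\<close>
  meets the closure of \<open>P\<close> in \<open>P\<close> alone.\<close>

lemma poisson_locally_closed_iff':
  "poisson_locally_closed A P \<longleftrightarrow>
     P \<in> Pspec A \<and> (\<exists>f\<in>carrier A. f \<notin> P \<and> (\<forall>Q\<in>Pspec A. P \<subset> Q \<longrightarrow> f \<in> Q))"
proof (cases "P \<in> Pspec A")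
  case P: True
  have "locally_closed_in (Pspec_topology A) {P} \<longleftrightarrow>
      (\<exists>f\<in>carrier A. f \<notin> P \<and> (\<forall>Q\<in>Pspec A. P \<subset> Q \<longrightarrow> f \<in> Q))"
  proof
    assume "locally_closed_in (Pspec_topology A) {P}"
    then obtain U C where U: "openin (Pspec_topology A) U" and C: "closedin (Pspec_topology A) C"
      and UC: "{P} = U \<inter> C" by (auto simp: locally_closed_in_def)
    obtain S where S: "S \<subseteq> carrier A" "U = {Q \<in> Pspec A. \<not> S \<subseteq> Q}"
      using U by (auto simp: openin_Pspec_topology)
    obtain T where T: "T \<subseteq> carrier A" "Pspec A - C = {Q \<in> Pspec A. \<not> T \<subseteq> Q}" "C \<subseteq> Pspec A"
      using C unfolding closedin_def topspace_Pspec_topology openin_Pspec_topology by blast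
    have "P \<in> U" "P \<in> C" using UC by auto
    then obtain f where f: "f \<in> S" "f \<notin> P" using S(2) by blast
    have "T \<subseteq> P" using T \<open>P \<in> C\<close> P by blast
    have "f \<in> Q" if Q: "Q \<in> Pspec A" "P \<subset> Q" for Q
    proof -
      have "Q \<in> C" using T(2) \<open>T \<subseteq> P\<close> Q by blast
      then have "Q \<notin> U" using UC Q(2) by blast
      then show ?thesis using S(2) Q(1) f(1) by blast
    qed
    then show "\<exists>f\<in>carrier A. f \<notin> P \<and> (\<forall>Q\<in>Pspec A. P \<subset> Q \<longrightarrow> f \<in> Q)" using f S(1) by blast
  next
    assume "\<exists>f\<in>carrier A. f \<notin> P \<and> (\<forall>Q\<in>Pspec A. P \<subset> Q \<longrightarrow> f \<in> Q)"
    then obtain f where f: "f \<in> carrier A" "f \<notin> P" "\<forall>Q\<in>Pspec A. P \<subset> Q \<longrightarrow> f \<in> Q" by blast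
    let ?U = "{Q \<in> Pspec A. \<not> {f} \<subseteq> Q}" and ?C = "{Q \<in> Pspec A. P \<subseteq> Q}"
    have "openin (Pspec_topology A) ?U" unfolding openin_Pspec_topology using f(1) by blast
    moreover have "Pspec A - ?C = {Q \<in> Pspec A. \<not> P \<subseteq> Q}" by blast
    then have "closedin (Pspec_topology A) ?C"
      unfolding closedin_def topspace_Pspec_topology openin_Pspec_topology
      using Pspec_subset[OF P] by blast
    moreover have "{P} = ?U \<inter> ?C" using P f by blast
    ultimately show "locally_closed_in (Pspec_topology A) {P}" unfolding locally_closed_in_def by blast
  qed
  then show ?thesis using P by (simp add: poisson_locally_closed_def)
qed (simp add: poisson_locally_closed_def)

lemma poisson_locally_closed_iff:
  "poisson_locally_closed A P \<longleftrightarrow> P \<subseteq> carrier A \<and> da.loc_closed (pre P)"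
proof (cases "P \<in> Pspec A")
  case True
  note P = Pspec_subset[OF True]
  have "(\<exists>f\<in>carrier A. f \<notin> P \<and> (\<forall>Q\<in>Pspec A. P \<subset> Q \<longrightarrow> f \<in> Q)) \<longleftrightarrow>
      (\<exists>r. \<phi> r \<notin> P \<and> (\<forall>Q\<in>Pspec A. P \<subset> Q \<longrightarrow> \<phi> r \<in> Q))"
    unfolding range_phi[symmetric] by blast
  also have "\<dots> \<longleftrightarrow> (\<exists>r. r \<notin> pre P \<and> (\<forall>Q\<in>Pspec A. pre P \<subset> pre Q \<longrightarrow> r \<in> pre Q))"
    using pre_psubset_iff[OF P] Pspec_subset by simp
  also have "\<dots> \<longleftrightarrow> (\<exists>r. r \<notin> pre P \<and> (\<forall>Q\<in>da.Dspec. pre P \<subset> Q \<longrightarrow> r \<in> Q))"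
    unfolding Dspec_eq by blast
  finally show ?thesis
    unfolding poisson_locally_closed_iff' da.loc_closed_def using True P Pspec_iff[OF P] by simp
next
  case False
  then show ?thesis using Pspec_iff by (auto simp: poisson_locally_closed_def da.loc_closed_def)
qed

end

section \<open>Rationality in terms of numerators and denominators\<close>

text \<open>Cosets of \<open>P\<close> and fractions of cosets are named by ring elements, so that
  their arithmetic is carried out in the type class.\<close>

locale presented_prime = poisson_presentation A \<iota> \<phi> G
  for A :: "('a, 'm) poisson_algebra_scheme" (structure) and \<iota> :: "complex \<Rightarrow> 'r::comm_ring_1"
    and \<phi> :: "'r \<Rightarrow> 'a" and G :: "'r set" +
  fixes P :: "'a set"
  assumes P: "P \<in> Pspec A"
begin

lemma ideal_P: "ideal P A"
  using P by (simp add: Pspec_def poisson_ideal_def)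

lemma pre_Dspec: "pre P \<in> da.Dspec"
  using P Pspec_iff Pspec_subset by blast

lemmas prime_P = da.DspecD(1)[OF pre_Dspec] and diff_P = da.DspecD(2)[OF pre_Dspec]
  and id_P = da.DspecD(3)[OF pre_Dspec]

lemma K_P: "K \<subseteq> pre P"
  using da.is_primeD(2)[OF prime_P] .

definition \<pi> :: "'r \<Rightarrow> 'a set" where
  "\<pi> r = P +> \<phi> r"

lemma pi_eq: "\<pi> r = {\<phi> r' |r'. r' - r \<in> pre P}"
proof
  show "\<pi> r \<subseteq> {\<phi> r' |r'. r' - r \<in> pre P}"
  proof
    fix x assume "x \<in> \<pi> r"
    then obtain h where h: "h \<in> P" "x = h \<oplus> \<phi> r" by (auto simp: \<pi>_def a_r_coset_def')
    then have "x = \<phi> (lift h + r)" "lift h \<in> pre P"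
      using Pspec_subset[OF P] phi_lift[of h] by (auto simp: phi_add)
    then show "x \<in> {\<phi> r' |r'. r' - r \<in> pre P}" by (intro CollectI exI[of _ "lift h + r"]) simp
  qed
  show "{\<phi> r' |r'. r' - r \<in> pre P} \<subseteq> \<pi> r"
  proof clarify
    fix r' assume "r' - r \<in> pre P"
    moreover have "\<phi> r' = \<phi> (r' - r) \<oplus> \<phi> r" by (simp flip: phi_add)
    ultimately show "\<phi> r' \<in> \<pi> r" unfolding \<pi>_def a_r_coset_def' by auto
  qed
qed

lemma pi_eq_iff: "\<pi> r = \<pi> s \<longleftrightarrow> r - s \<in> pre P"
proof
  assume "\<pi> r = \<pi> s"
  moreover have "\<phi> r \<in> \<pi> r" unfolding pi_eq using is_ideal_0[OF id_P] by force
  ultimately obtain r' where r': "\<phi> r = \<phi> r'" "r' - s \<in> pre P" unfolding pi_eq by auto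
  from r'(1) have "r - r' \<in> K" by (simp add: K_def phi_diff minus_eq_zero_iff)
  with K_P have "r - r' \<in> pre P" by blast
  from is_ideal_add[OF id_P this r'(2)] show "r - s \<in> pre P" by simp
next
  assume rs: "r - s \<in> pre P"
  have "r' - r \<in> pre P \<longleftrightarrow> r' - s \<in> pre P" for r'
    using is_ideal_cong[OF id_P, of "r' - s" "r' - r"] rs by simp
  then show "\<pi> r = \<pi> s" unfolding pi_eq by blast
qed

text \<open>The well-definedness principle for \<open>poisson_quot\<close>, whose scalar
  multiplication and bracket are unions over representatives.\<close>

lemma pi_UN:
  assumes "\<And>r'. r' - r \<in> pre P \<Longrightarrow> f (\<phi> r') = C"
  shows "(\<Union>x\<in>\<pi> r. f x) = C"
proof -
  have "\<phi> r \<in> \<pi> r" unfolding pi_eq using is_ideal_0[OF id_P] by force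
  moreover have "f x = C" if "x \<in> \<pi> r" for x using that assms unfolding pi_eq by blast
  ultimately show ?thesis by blast
qed

lemma delta_mem_Delta: "(\<lambda>r. \<delta> r c) \<in> \<Delta>"
  by (auto simp: \<Delta>_def)

lemma delta_add_left: "\<delta> (a + b) c - (\<delta> a c + \<delta> b c) \<in> pre P"
  using da.deriv_add[OF delta_mem_Delta] K_P by blast

lemma delta_antisym: "\<delta> a b + \<delta> b a \<in> pre P"
proof -
  have "\<zero> = \<lbrace>\<phi> a \<oplus> \<phi> b, \<phi> a \<oplus> \<phi> b\<rbrace>" by (simp add: bracket_alternating)
  also have "\<dots> = (\<lbrace>\<phi> a, \<phi> a\<rbrace> \<oplus> \<lbrace>\<phi> b, \<phi> a\<rbrace>) \<oplus> (\<lbrace>\<phi> a, \<phi> b\<rbrace> \<oplus> \<lbrace>\<phi> b, \<phi> b\<rbrace>)"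
    by (simp only: bracket_add_left bracket_add_right phi_closed add.m_closed)
  also have "\<dots> = \<phi> (\<delta> a b + \<delta> b a)"
    by (simp add: bracket_closed bracket_alternating phi_add phi_delta add.m_comm)
  finally have "\<delta> a b + \<delta> b a \<in> K" by (simp add: K_def)
  then show ?thesis using K_P by blast
qed

lemma delta_cong_left: "r - r' \<in> pre P \<Longrightarrow> \<delta> r s - \<delta> r' s \<in> pre P"
proof -
  assume "r - r' \<in> pre P"
  then have "\<delta> (r - r') s \<in> pre P" by (rule da.diff_idealD(3)[OF diff_P delta_mem_Delta])
  from is_ideal_add[OF id_P delta_add_left[of "r - r'" r' s] this] show ?thesis by simp
qed

text \<open>The operators in \<open>\<Delta>\<close> differentiate the left argument only;
  congruence on the right is transferred by antisymmetry.\<close>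

lemma delta_cong:
  assumes "r - r' \<in> pre P" "s - s' \<in> pre P"
  shows "\<delta> r s - \<delta> r' s' \<in> pre P"
proof -
  have "\<delta> r s - \<delta> r' s' = (\<delta> r s - \<delta> r' s) + (\<delta> r' s + \<delta> s r') - (\<delta> s r' - \<delta> s' r') - (\<delta> r' s' + \<delta> s' r')"
    by simp
  also have "\<dots> \<in> pre P"
    by (intro is_ideal_diff is_ideal_add id_P delta_cong_left delta_antisym assms)
  finally show ?thesis .
qed

lemma delta_one: "\<delta> a 1 \<in> pre P"
proof -
  have "\<delta> 1 a \<in> K" by (simp add: K_def phi_delta phi_one bracket_one)
  then have "\<delta> 1 a \<in> pre P" using K_P by blast
  from is_ideal_diff[OF id_P delta_antisym[of a 1] this] show ?thesis by simp
qed

section \<open>Arithmetic of the quotient on representatives\<close>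

definition D where "D = poisson_quot A P"

lemma carrier_D: "carrier D = range \<pi>"
  unfolding D_def poisson_quot_def FactRing_def A_RCOSETS_def' \<pi>_def
  by (auto simp flip: range_phi)

lemma mult_D: "\<pi> r \<otimes>\<^bsub>D\<^esub> \<pi> s = \<pi> (r * s)"
  using ideal.rcoset_mult_add[OF ideal_P, of "\<phi> r" "\<phi> s"]
  by (simp add: D_def poisson_quot_def FactRing_def \<pi>_def phi_mult)

lemma add_D: "\<pi> r \<oplus>\<^bsub>D\<^esub> \<pi> s = \<pi> (r + s)"
proof -
  interpret ideal P A by (rule ideal_P)
  show ?thesis
    by (simp add: D_def poisson_quot_def FactRing_def \<pi>_def phi_add a_rcos_sum)
qed

lemma one_D: "\<one>\<^bsub>D\<^esub> = \<pi> 1"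
  by (simp add: D_def poisson_quot_def FactRing_def \<pi>_def phi_one)

lemma zero_D: "\<zero>\<^bsub>D\<^esub> = \<pi> 0"
proof -
  interpret ideal P A by (rule ideal_P)
  show ?thesis
    using a_coset_add_zero[OF a_subset] by (simp add: D_def poisson_quot_def FactRing_def \<pi>_def phi_zero)
qed

text \<open>\<open>D\<close> is not interpreted as a ring, so the inverse is verified directly
  against the definite description behind \<open>a_inv\<close>.\<close>

lemma uminus_D: "\<ominus>\<^bsub>D\<^esub> \<pi> s = \<pi> (- s)"
  unfolding a_inv_def m_inv_def
proof (rule the_equality)
  fix x assume "x \<in> carrier (add_monoid D) \<and> \<pi> s \<otimes>\<^bsub>add_monoid D\<^esub> x = \<one>\<^bsub>add_monoid D\<^esub>
      \<and> x \<otimes>\<^bsub>add_monoid D\<^esub> \<pi> s = \<one>\<^bsub>add_monoid D\<^esub>"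
  then obtain r where "x = \<pi> r" "\<pi> (s + r) = \<pi> 0" by (auto simp: carrier_D add_D zero_D)
  then show "x = \<pi> (- s)" by (simp add: pi_eq_iff add.commute del: mem_pre)
qed (simp add: carrier_D add_D zero_D)

lemma minus_D: "\<pi> r \<ominus>\<^bsub>D\<^esub> \<pi> s = \<pi> (r - s)"
  by (simp add: a_minus_def uminus_D add_D)

lemma smult_D: "c \<odot>\<^bsub>D\<^esub> \<pi> r = \<pi> (\<iota> c * r)"
proof -
  have "c \<odot>\<^bsub>D\<^esub> \<pi> r = (\<Union>x\<in>\<pi> r. P +> (c \<odot> x))" by (simp add: D_def poisson_quot_def)
  also have "\<dots> = \<pi> (\<iota> c * r)"
  proof (rule pi_UN)
    fix r' assume "r' - r \<in> pre P"
    from is_ideal_lmult[OF id_P this, of "\<iota> c"] have "\<pi> (\<iota> c * r') = \<pi> (\<iota> c * r)"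
      by (simp only: pi_eq_iff right_diff_distrib)
    then show "P +> (c \<odot> \<phi> r') = \<pi> (\<iota> c * r)" unfolding \<pi>_def phi_scalar .
  qed
  finally show ?thesis .
qed

lemma bracket_D: "\<lbrace>\<pi> r, \<pi> s\<rbrace>\<^bsub>D\<^esub> = \<pi> (\<delta> r s)"
proof -
  have "\<lbrace>\<pi> r, \<pi> s\<rbrace>\<^bsub>D\<^esub> = (\<Union>x\<in>\<pi> r. \<Union>y\<in>\<pi> s. P +> \<lbrace>x, y\<rbrace>)"
    by (simp add: D_def poisson_quot_def)
  also have "\<dots> = \<pi> (\<delta> r s)"
  proof (intro pi_UN)
    fix r' s' assume "r' - r \<in> pre P" "s' - s \<in> pre P"
    then have "\<pi> (\<delta> r' s') = \<pi> (\<delta> r s)" unfolding pi_eq_iff by (rule delta_cong)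
    then show "P +> \<lbrace>\<phi> r', \<phi> s'\<rbrace> = \<pi> (\<delta> r s)" unfolding \<pi>_def phi_delta .
  qed
  finally show ?thesis .
qed

lemmas D_simps = mult_D add_D one_D zero_D minus_D smult_D bracket_D

section \<open>Fractions over the quotient and the Poisson center\<close>

definition fr :: "'r \<Rightarrow> 'r \<Rightarrow> ('a set \<times> 'a set) set" where
  "fr a s = fraction D (\<pi> a) (\<pi> s)"

lemma pi_zero_iff: "\<pi> s = \<pi> 0 \<longleftrightarrow> s \<in> pre P"
  by (simp add: pi_eq_iff)

lemma frac_pairs_D: "x \<in> frac_pairs D \<longleftrightarrow> (\<exists>a s. x = (\<pi> a, \<pi> s) \<and> s \<notin> pre P)"
proof -
  have "x \<in> frac_pairs D \<longleftrightarrow> (\<exists>a s. x = (\<pi> a, \<pi> s) \<and> \<pi> s \<noteq> \<pi> 0)"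
    unfolding frac_pairs_def carrier_D zero_D by blast
  then show ?thesis unfolding pi_zero_iff .
qed

lemma frac_rel_D:
  "((\<pi> a, \<pi> s), (\<pi> b, \<pi> t)) \<in> frac_rel D \<longleftrightarrow> s \<notin> pre P \<and> t \<notin> pre P \<and> a * t - b * s \<in> pre P"
  unfolding frac_rel_def frac_pairs_def carrier_D zero_D
  by (auto simp: pi_zero_iff mult_D pi_eq_iff[of "_ * _"] simp del: mem_pre)

lemma mem_fr: "(\<pi> b, \<pi> t) \<in> fr a s \<longleftrightarrow> s \<notin> pre P \<and> t \<notin> pre P \<and> a * t - b * s \<in> pre P"
  by (simp add: fr_def fraction_def frac_rel_D del: mem_pre)

lemma fr_cases:
  assumes "z \<in> fr a s"
  obtains b t where "z = (\<pi> b, \<pi> t)" "t \<notin> pre P" "a * t - b * s \<in> pre P"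
proof -
  have "z \<in> frac_pairs D" using assms by (auto simp: fr_def fraction_def frac_rel_def)
  then obtain b t where "z = (\<pi> b, \<pi> t)" using frac_pairs_D by blast
  then show ?thesis using that assms mem_fr by blast
qed

lemma fr_eq_iff:
  assumes s: "s \<notin> pre P" and t: "t \<notin> pre P"
  shows "fr a s = fr b t \<longleftrightarrow> a * t - b * s \<in> pre P"
proof
  assume "fr a s = fr b t"
  moreover have "(\<pi> b, \<pi> t) \<in> fr b t" using t is_ideal_0[OF id_P] by (simp add: mem_fr)
  ultimately show "a * t - b * s \<in> pre P" using mem_fr by blast
next
  assume ab: "a * t - b * s \<in> pre P"
  have iff: "a * u - c * s \<in> pre P \<longleftrightarrow> b * u - c * t \<in> pre P" for c u
  proof -
    \<comment> \<open>Transitivity of equality of fractions; primeness cancels \<open>s\<close> and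
      \<open>t\<close> afterwards.\<close>
    have eq: "t * (a * u - c * s) - s * (b * u - c * t) = u * (a * t - b * s)"
      by (simp add: algebra_simps)
    have "t * (a * u - c * s) - s * (b * u - c * t) \<in> pre P"
      unfolding eq by (rule is_ideal_lmult[OF id_P ab])
    then have "t * (a * u - c * s) \<in> pre P \<longleftrightarrow> s * (b * u - c * t) \<in> pre P"
      by (rule is_ideal_cong[OF id_P])
    then show ?thesis
      using s t da.is_primeD(4)[OF prime_P] is_ideal_lmult[OF id_P] by blast
  qed
  have "z \<in> fr a s \<longleftrightarrow> z \<in> fr b t" for z
  proof
    assume "z \<in> fr a s"
    then show "z \<in> fr b t" by (rule fr_cases) (use iff s t mem_fr in blast)
  next
    assume "z \<in> fr b t"
    then show "z \<in> fr a s" by (rule fr_cases) (use iff s t mem_fr in blast)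
  qed
  then show "fr a s = fr b t" by blast
qed

definition F where "F = poisson_frac D"

lemma one_not_P: "1 \<notin> pre P"
  by (rule da.is_primeD(3)[OF prime_P])

lemma carrier_F: "carrier F = {fr a s |a s. s \<notin> pre P}"
proof -
  have "carrier F = {fraction D (fst x) (snd x) |x. x \<in> frac_pairs D}"
    by (auto simp: F_def poisson_frac_def quotient_def fraction_def)
  also have "\<dots> = {fr a s |a s. s \<notin> pre P}"
    unfolding frac_pairs_D fr_def by auto
  finally show ?thesis .
qed

lemma zero_F: "\<zero>\<^bsub>F\<^esub> = fr 0 1"
  by (simp add: F_def poisson_frac_def fr_def zero_D one_D)

text \<open>The counterpart of \<open>pi_UN\<close> for the operations of
  \<open>poisson_frac\<close>, which are unions over representing pairs.\<close>

lemma fr_UN: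
  assumes s: "s \<notin> pre P" and f: "\<And>b t. t \<notin> pre P \<Longrightarrow> a * t - b * s \<in> pre P \<Longrightarrow> f (\<pi> b) (\<pi> t) = C"
  shows "(\<Union>(x, y)\<in>fr a s. f x y) = C"
proof -
  have "(\<pi> a, \<pi> s) \<in> fr a s" using s is_ideal_0[OF id_P] by (simp add: mem_fr)
  moreover have "f (fst z) (snd z) = C" if "z \<in> fr a s" for z
    using that by (rule fr_cases) (simp add: f del: mem_pre)
  ultimately show ?thesis by (fastforce simp: case_prod_unfold)
qed

lemma smult_one_F: "c \<odot>\<^bsub>F\<^esub> \<one>\<^bsub>F\<^esub> = fr (\<iota> c) 1"
proof -
  have "c \<odot>\<^bsub>F\<^esub> \<one>\<^bsub>F\<^esub> = (\<Union>(x, y)\<in>fr 1 1. fraction D (c \<odot>\<^bsub>D\<^esub> x) y)"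
    by (simp add: F_def poisson_frac_def fr_def one_D)
  also have "\<dots> = fr (\<iota> c) 1"
  proof (rule fr_UN[OF one_not_P])
    fix b t assume t: "t \<notin> pre P" and "1 * t - b * 1 \<in> pre P"
    then have "- \<iota> c * (1 * t - b * 1) \<in> pre P" by (intro is_ideal_lmult id_P)
    moreover have "- \<iota> c * (1 * t - b * 1) = (\<iota> c * b) * 1 - \<iota> c * t" by (simp add: algebra_simps)
    ultimately have "fr (\<iota> c * b) t = fr (\<iota> c) 1" using fr_eq_iff[OF t one_not_P] by metis
    then show "fraction D (c \<odot>\<^bsub>D\<^esub> \<pi> b) (\<pi> t) = fr (\<iota> c) 1" by (simp add: smult_D fr_def)
  qed
  finally show ?thesis .
qed

lemma scalars_F: "scalars F = {fr (\<iota> c) 1 |c. True}"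
  by (simp add: scalars_def smult_one_F)

text \<open>Up to the denominator \<open>s * s\<close> this is the bracket of \<open>a / s\<close>
  with \<open>y\<close>.\<close>

definition wronskian :: "'r \<Rightarrow> 'r \<Rightarrow> 'r \<Rightarrow> 'r" where
  "wronskian a s y = s * \<delta> a y - a * \<delta> s y"

definition numerator :: "'r \<Rightarrow> 'r \<Rightarrow> 'r \<Rightarrow> 'r \<Rightarrow> 'r" where
  "numerator a s b t = s * t * \<delta> a b - s * b * \<delta> a t - a * t * \<delta> s b + a * b * \<delta> s t"

text \<open>The bracket with \<open>b / t\<close> is governed by the brackets with \<open>b\<close>
  and \<open>t\<close>, so centrality can be tested against ring elements.\<close>

lemma numerator_eq: "numerator a s b t = t * wronskian a s b - b * wronskian a s t"
  by (simp add: numerator_def wronskian_def algebra_simps)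

lemma wronskian_one: "wronskian a s 1 \<in> pre P"
  unfolding wronskian_def by (intro is_ideal_diff is_ideal_lmult id_P delta_one)

lemma wronskian_cong:
  assumes s: "s \<notin> pre P" and w: "wronskian a s y \<in> pre P" and e: "a * s' - a' * s \<in> pre P"
  shows "wronskian a' s' y \<in> pre P"
proof -
  note d = delta_mem_Delta[of y]
  define x where "x = a * s' - a' * s"
  define t1 where "t1 = \<delta> (x + a' * s) y - (\<delta> x y + \<delta> (a' * s) y)"
  define t2 where "t2 = \<delta> (a * s') y - (a * \<delta> s' y + \<delta> a y * s')"
  define t3 where "t3 = \<delta> (a' * s) y - (a' * \<delta> s y + \<delta> a' y * s)"
  have t: "t1 \<in> pre P" "t2 \<in> pre P" "t3 \<in> pre P"
    unfolding t1_def t2_def t3_def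
    using da.deriv_add[OF d] da.deriv_mult[OF d] K_P by blast+
  have x: "x \<in> pre P" "\<delta> x y \<in> pre P"
    using e da.diff_idealD(3)[OF diff_P d, of x] by (simp_all add: x_def del: mem_pre)
  have "x + a' * s = a * s'" by (simp add: x_def)
  \<comment> \<open>The product rule on both sides of \<open>x + a' * s = a * s'\<close>, cleared of
    denominators; the factor \<open>s * s\<close> is cancelled by primeness.\<close>
  then have "(s * s) * wronskian a' s' y = (s' * s') * wronskian a s y
      - (s * s') * (\<delta> x y + t1 - t2 + t3) + (s' * \<delta> s y + s * \<delta> s' y) * x"
    by (simp add: wronskian_def t1_def t2_def t3_def) (simp add: x_def algebra_simps)
  also have "\<dots> \<in> pre P" by (intro is_ideal_diff is_ideal_add is_ideal_lmult id_P w t x)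
  finally show ?thesis using da.is_primeD(4)[OF prime_P] s by blast
qed

lemma bracket_F:
  "\<lbrace>fr a s, fr b t\<rbrace>\<^bsub>F\<^esub> = (\<Union>(x, y)\<in>fr a s. \<Union>(z, w)\<in>fr b t.
       fraction D
         ((((y \<otimes>\<^bsub>D\<^esub> w) \<otimes>\<^bsub>D\<^esub> \<lbrace>x, z\<rbrace>\<^bsub>D\<^esub>)
           \<ominus>\<^bsub>D\<^esub> ((y \<otimes>\<^bsub>D\<^esub> z) \<otimes>\<^bsub>D\<^esub> \<lbrace>x, w\<rbrace>\<^bsub>D\<^esub>)
           \<ominus>\<^bsub>D\<^esub> ((x \<otimes>\<^bsub>D\<^esub> w) \<otimes>\<^bsub>D\<^esub> \<lbrace>y, z\<rbrace>\<^bsub>D\<^esub>))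
           \<oplus>\<^bsub>D\<^esub> ((x \<otimes>\<^bsub>D\<^esub> z) \<otimes>\<^bsub>D\<^esub> \<lbrace>y, w\<rbrace>\<^bsub>D\<^esub>))
         ((y \<otimes>\<^bsub>D\<^esub> y) \<otimes>\<^bsub>D\<^esub> (w \<otimes>\<^bsub>D\<^esub> w)))"
  by (simp add: F_def poisson_frac_def)

lemma bracket_term:
  "fraction D
         ((((\<pi> s \<otimes>\<^bsub>D\<^esub> \<pi> t) \<otimes>\<^bsub>D\<^esub> \<lbrace>\<pi> a, \<pi> b\<rbrace>\<^bsub>D\<^esub>)
           \<ominus>\<^bsub>D\<^esub> ((\<pi> s \<otimes>\<^bsub>D\<^esub> \<pi> b) \<otimes>\<^bsub>D\<^esub> \<lbrace>\<pi> a, \<pi> t\<rbrace>\<^bsub>D\<^esub>)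
           \<ominus>\<^bsub>D\<^esub> ((\<pi> a \<otimes>\<^bsub>D\<^esub> \<pi> t) \<otimes>\<^bsub>D\<^esub> \<lbrace>\<pi> s, \<pi> b\<rbrace>\<^bsub>D\<^esub>))
           \<oplus>\<^bsub>D\<^esub> ((\<pi> a \<otimes>\<^bsub>D\<^esub> \<pi> b) \<otimes>\<^bsub>D\<^esub> \<lbrace>\<pi> s, \<pi> t\<rbrace>\<^bsub>D\<^esub>))
         ((\<pi> s \<otimes>\<^bsub>D\<^esub> \<pi> s) \<otimes>\<^bsub>D\<^esub> (\<pi> t \<otimes>\<^bsub>D\<^esub> \<pi> t)) = fr (numerator a s b t) ((s * s) * (t * t))"
  by (simp add: D_simps fr_def numerator_def)

lemma denominator_not_P: "s \<notin> pre P \<Longrightarrow> t \<notin> pre P \<Longrightarrow> (s * s) * (t * t) \<notin> pre P"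
  using da.is_primeD(4)[OF prime_P] by blast

lemma fr_zero_iff: "s \<notin> pre P \<Longrightarrow> fr a s = fr 0 1 \<longleftrightarrow> a \<in> pre P"
  using fr_eq_iff[OF _ one_not_P, of s a 0] by simp

text \<open>Independence of the bracket from representatives is established only where the bracket
  vanishes. For the forward direction one member of the union, taken at the given pairs, suffices:
  it is contained in the zero class. For the converse every member equals the zero class.\<close>

lemma center_F_iff:
  assumes s: "s \<notin> pre P"
  shows "fr a s \<in> poisson_center F \<longleftrightarrow> (\<forall>y. wronskian a s y \<in> pre P)"
proof
  assume center: "fr a s \<in> poisson_center F"
  show "\<forall>y. wronskian a s y \<in> pre P"
  proof
    fix y
    have "fr y 1 \<in> carrier F" using one_not_P carrier_F by blast
    then have zero: "\<lbrace>fr a s, fr y 1\<rbrace>\<^bsub>F\<^esub> = fr 0 1" using center by (simp add: poisson_center_def zero_F)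
    have mem: "(\<pi> a, \<pi> s) \<in> fr a s" "(\<pi> y, \<pi> 1) \<in> fr y 1"
      using s one_not_P is_ideal_0[OF id_P] by (simp_all add: mem_fr)
    have "fr (numerator a s y 1) ((s * s) * (1 * 1)) \<subseteq> \<lbrace>fr a s, fr y 1\<rbrace>\<^bsub>F\<^esub>"
      unfolding bracket_F bracket_term[symmetric] using mem by blast
    moreover have "(\<pi> (numerator a s y 1), \<pi> ((s * s) * (1 * 1))) \<in> fr (numerator a s y 1) ((s * s) * (1 * 1))"
      using denominator_not_P[OF s one_not_P] is_ideal_0[OF id_P] by (simp add: mem_fr)
    ultimately have "(\<pi> (numerator a s y 1), \<pi> ((s * s) * (1 * 1))) \<in> fr 0 1" using zero by blast
    then have "0 * ((s * s) * (1 * 1)) - numerator a s y 1 * 1 \<in> pre P" using mem_fr by blast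
    then have "numerator a s y 1 \<in> pre P"
      using is_ideal_uminus[OF id_P] by fastforce
    from is_ideal_add[OF id_P this is_ideal_lmult[OF id_P wronskian_one[of a s], of y]]
    show "wronskian a s y \<in> pre P" by (simp add: numerator_eq)
  qed
next
  assume w: "\<forall>y. wronskian a s y \<in> pre P"
  have "\<lbrace>fr a s, V\<rbrace>\<^bsub>F\<^esub> = \<zero>\<^bsub>F\<^esub>" if "V \<in> carrier F" for V
  proof -
    obtain b t where V: "V = fr b t" "t \<notin> pre P" using \<open>V \<in> carrier F\<close> unfolding carrier_F by blast
    show ?thesis
      unfolding V bracket_F zero_F
    proof (intro fr_UN s V(2))
      fix a' s' b' t' assume s': "s' \<notin> pre P" "a * s' - a' * s \<in> pre P" and t': "t' \<notin> pre P"
      have "wronskian a' s' y \<in> pre P" for y using wronskian_cong[OF s _ s'(2)] w by blast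
      then have "numerator a' s' b' t' \<in> pre P"
        unfolding numerator_eq by (intro is_ideal_diff is_ideal_lmult id_P)
      then show "fraction D
         ((((\<pi> s' \<otimes>\<^bsub>D\<^esub> \<pi> t') \<otimes>\<^bsub>D\<^esub> \<lbrace>\<pi> a', \<pi> b'\<rbrace>\<^bsub>D\<^esub>)
           \<ominus>\<^bsub>D\<^esub> ((\<pi> s' \<otimes>\<^bsub>D\<^esub> \<pi> b') \<otimes>\<^bsub>D\<^esub> \<lbrace>\<pi> a', \<pi> t'\<rbrace>\<^bsub>D\<^esub>)
           \<ominus>\<^bsub>D\<^esub> ((\<pi> a' \<otimes>\<^bsub>D\<^esub> \<pi> t') \<otimes>\<^bsub>D\<^esub> \<lbrace>\<pi> s', \<pi> b'\<rbrace>\<^bsub>D\<^esub>))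
           \<oplus>\<^bsub>D\<^esub> ((\<pi> a' \<otimes>\<^bsub>D\<^esub> \<pi> b') \<otimes>\<^bsub>D\<^esub> \<lbrace>\<pi> s', \<pi> t'\<rbrace>\<^bsub>D\<^esub>))
         ((\<pi> s' \<otimes>\<^bsub>D\<^esub> \<pi> s') \<otimes>\<^bsub>D\<^esub> (\<pi> t' \<otimes>\<^bsub>D\<^esub> \<pi> t')) = fr 0 1"
        unfolding bracket_term using fr_zero_iff denominator_not_P[OF s'(1) t'] by blast
    qed
  qed
  moreover have "fr a s \<in> carrier F" using s carrier_F by blast
  ultimately show "fr a s \<in> poisson_center F" by (simp add: poisson_center_def)
qed

text \<open>Rationality thereby reduces to the opposite inclusion.\<close>

lemma scalars_subset_center: "scalars F \<subseteq> poisson_center F"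
proof -
  have "wronskian (\<iota> c) 1 y \<in> pre P" for c y
  proof -
    have "\<delta> (\<iota> c) y \<in> K" for c using da.deriv_iota[OF delta_mem_Delta] .
    from this[of c] this[of 1] have "\<delta> (\<iota> c) y \<in> pre P" "\<delta> 1 y \<in> pre P"
      using K_P unfolding iota_one by blast+
    then show ?thesis unfolding wronskian_def by (intro is_ideal_diff is_ideal_lmult id_P)
  qed
  then show ?thesis using center_F_iff[OF one_not_P] by (auto simp: scalars_F)
qed

lemma poisson_rational_iff_rational: "poisson_rational A P \<longleftrightarrow> da.rational (pre P)"
proof -
  have "poisson_rational A P \<longleftrightarrow> poisson_center F \<subseteq> scalars F"
    using P scalars_subset_center by (auto simp: poisson_rational_def F_def D_def)
  also have "\<dots> \<longleftrightarrow> (\<forall>a s. s \<notin> pre P \<longrightarrow> fr a s \<in> poisson_center F \<longrightarrow> fr a s \<in> scalars F)"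
  proof
    assume *: "\<forall>a s. s \<notin> pre P \<longrightarrow> fr a s \<in> poisson_center F \<longrightarrow> fr a s \<in> scalars F"
    show "poisson_center F \<subseteq> scalars F"
    proof
      fix x assume x: "x \<in> poisson_center F"
      then have "x \<in> carrier F" by (simp add: poisson_center_def)
      then show "x \<in> scalars F" using * x unfolding carrier_F by blast
    qed
  qed blast
  also have "\<dots> \<longleftrightarrow> (\<forall>a s. s \<notin> pre P \<longrightarrow> (\<forall>y. wronskian a s y \<in> pre P) \<longrightarrow>
      (\<exists>c. a - \<iota> c * s \<in> pre P))"
  proof -
    have "fr a s \<in> scalars F \<longleftrightarrow> (\<exists>c. a - \<iota> c * s \<in> pre P)" if "s \<notin> pre P" for a s
      unfolding scalars_F using fr_eq_iff[OF that one_not_P, of a] by (auto simp del: mem_pre)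
    then show ?thesis using center_F_iff by (metis (no_types, lifting))
  qed
  also have "\<dots> \<longleftrightarrow> da.rational (pre P)"
  proof -
    have "(\<forall>y. wronskian a s y \<in> pre P) \<longleftrightarrow> (\<forall>d\<in>\<Delta>. s * d a - a * d s \<in> pre P)" for a s
      by (auto simp: \<Delta>_def wronskian_def simp del: mem_pre)
    then show ?thesis using pre_Dspec unfolding da.rational_def by blast
  qed
  finally show ?thesis .
qed

end

context poisson_presentation
begin

lemma poisson_rational_iff: "poisson_rational A P \<longleftrightarrow> P \<subseteq> carrier A \<and> da.rational (pre P)"
proof (cases "P \<in> Pspec A")
  case True
  then interpret presented_prime A \<iota> \<phi> G P by unfold_locales
  show ?thesis using poisson_rational_iff_rational Pspec_subset[OF True] by blast
next
  case False
  then show ?thesis using Pspec_iff by (auto simp: poisson_rational_def da.rational_def)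
qed

text \<open>Both properties upstairs force membership in \<open>da.Dspec\<close>, where every ideal
  is the preimage of one of \<open>A\<close>, so no ideal upstairs escapes the comparison.\<close>

lemma Collect_pre_eq_iff:
  assumes U: "\<And>P. U P \<longleftrightarrow> P \<subseteq> carrier A \<and> U' (pre P)" and V: "\<And>P. V P \<longleftrightarrow> P \<subseteq> carrier A \<and> V' (pre P)"
    and U': "\<And>J. U' J \<Longrightarrow> J \<in> da.Dspec" and V': "\<And>J. V' J \<Longrightarrow> J \<in> da.Dspec"
  shows "{P. U P} = {P. V P} \<longleftrightarrow> {J. U' J} = {J. V' J}"
proof
  assume eq: "{P. U P} = {P. V P}"
  have "U' J \<longleftrightarrow> V' J" if J: "J \<in> da.Dspec" for J
  proof -
    obtain P where "J = pre P" "P \<subseteq> carrier A" using J Pspec_subset unfolding Dspec_eq by blast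
    then show ?thesis using U[of P] V[of P] eq by blast
  qed
  then show "{J. U' J} = {J. V' J}" using U' V' by blast
qed (use U V in blast)

theorem dixmier_moeglin_iff_minimal_finite:
  "poisson_dixmier_moeglin A \<longleftrightarrow>
    (\<forall>P\<in>Pspec A. minimal_Pspec_over A P \<prec> (UNIV :: complex set) \<longrightarrow> finite (minimal_Pspec_over A P))"
proof -
  have LP: "{P. poisson_locally_closed A P} = {P. poisson_primitive A P} \<longleftrightarrow>
      {J. da.loc_closed J} = {J. da.primitive J}"
    by (rule Collect_pre_eq_iff[OF poisson_locally_closed_iff poisson_primitive_iff])
      (simp_all add: da.loc_closed_def da.primitive_in_Dspec)
  have PR: "{P. poisson_primitive A P} = {P. poisson_rational A P} \<longleftrightarrow>
      {J. da.primitive J} = {J. da.rational J}"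
    by (rule Collect_pre_eq_iff[OF poisson_primitive_iff poisson_rational_iff])
      (simp_all add: da.rational_def da.primitive_in_Dspec)
  have small: "da.minimal_over (pre P) \<prec> (UNIV :: complex set) \<longleftrightarrow>
      minimal_Pspec_over A P \<prec> (UNIV :: complex set)"
    and fin: "finite (da.minimal_over (pre P)) \<longleftrightarrow> finite (minimal_Pspec_over A P)"
    if "P \<in> Pspec A" for P
    using minimal_over_eqpoll[OF that]
    by (meson eqpoll_sym lesspoll_eq_trans eq_lesspoll_trans, meson eqpoll_finite_iff)
  show ?thesis
    unfolding poisson_dixmier_moeglin_def LP PR da.differential_dixmier_moeglin Dspec_eq
    using small fin by auto
qed

end

section \<open>Existence of a presentation\<close>

lemma poly_mapping_sum_singles: "(\<Sum>m\<in>Poly_Mapping.keys p. Poly_Mapping.single m (Poly_Mapping.lookup p m)) = p"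
  by (rule poly_mapping_eqI)
    (simp add: lookup_sum lookup_single when_def in_keys_iff)

lemma poly_mapping_single_add_induct:
  fixes p :: "'a \<Rightarrow>\<^sub>0 'b::comm_monoid_add"
  assumes "Q 0" "\<And>m c. Q (Poly_Mapping.single m c)" "\<And>p q. Q p \<Longrightarrow> Q q \<Longrightarrow> Q (p + q)"
  shows "Q p"
proof -
  have "Q (\<Sum>m\<in>M. Poly_Mapping.single m (Poly_Mapping.lookup p m))" for M
    by (induction M rule: infinite_finite_induct) (auto intro: assms)
  from this[of "Poly_Mapping.keys p"] show ?thesis unfolding poly_mapping_sum_singles .
qed

context complex_poisson_algebra
begin

text \<open>The product runs over \<open>S\<close> only, so a variable whose index lies outside
  \<open>S\<close> is sent to \<open>\<one>\<close>. The map stays multiplicative, and its values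
  stay in the carrier.\<close>

definition monom_value :: "'a set \<Rightarrow> ('a \<Rightarrow>\<^sub>0 nat) \<Rightarrow> 'a" where
  "monom_value S m = (\<Otimes>x\<in>S. x [^] Poly_Mapping.lookup m x)"

definition poly_value :: "'a set \<Rightarrow> (('a \<Rightarrow>\<^sub>0 nat) \<Rightarrow>\<^sub>0 complex) \<Rightarrow> 'a" where
  "poly_value S p = (\<Oplus>m\<in>Poly_Mapping.keys p. Poly_Mapping.lookup p m \<odot> monom_value S m)"

context
  fixes S :: "'a set"
  assumes S: "finite S" "S \<subseteq> carrier A"
begin

lemma monom_value_closed [simp]: "monom_value S m \<in> carrier A"
  unfolding monom_value_def using S by (intro finprod_closed) auto

lemma monom_value_add: "monom_value S (m + n) = monom_value S m \<otimes> monom_value S n"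
proof -
  have "monom_value S (m + n) = (\<Otimes>x\<in>S. x [^] Poly_Mapping.lookup m x \<otimes> x [^] Poly_Mapping.lookup n x)"
    unfolding monom_value_def using S by (intro finprod_cong') (auto simp: lookup_add nat_pow_mult)
  also have "\<dots> = monom_value S m \<otimes> monom_value S n"
    unfolding monom_value_def using S by (intro finprod_multf) auto
  finally show ?thesis .
qed

lemma monom_value_zero: "monom_value S 0 = \<one>"
  by (simp add: monom_value_def)

lemma monom_value_single: "x \<in> S \<Longrightarrow> monom_value S (Poly_Mapping.single x 1) = x"
proof -
  assume x: "x \<in> S"
  have "monom_value S (Poly_Mapping.single x 1) = (\<Otimes>y\<in>S. if x = y then y else \<one>)"
    unfolding monom_value_def using S
    by (intro finprod_cong') (auto simp: lookup_single when_def)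
  also have "\<dots> = x" using finprod_singleton[OF x S(1), of "\<lambda>y. y"] S(2) by auto
  finally show ?thesis .
qed

text \<open>Summation over a finite superset of the support gives two polynomials a common index
  set.\<close>

lemma poly_value_superset:
  assumes "finite M" "Poly_Mapping.keys p \<subseteq> M"
  shows "poly_value S p = (\<Oplus>m\<in>M. Poly_Mapping.lookup p m \<odot> monom_value S m)"
  unfolding poly_value_def
  using assms smult_l_null
  by (intro add.finprod_mono_neutral_cong_left) (auto simp: in_keys_iff ring_of_type_algebra_def)

lemma poly_value_closed: "poly_value S p \<in> carrier A"
  unfolding poly_value_def by (intro finsum_closed) auto

lemma poly_value_single: "poly_value S (Poly_Mapping.single m c) = c \<odot> monom_value S m"
  by (subst poly_value_superset[of "{m}"]) (auto simp: finsum_insert)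

lemma poly_value_zero: "poly_value S 0 = \<zero>"
  by (simp add: poly_value_def)

lemma poly_value_add: "poly_value S (p + q) = poly_value S p \<oplus> poly_value S q"
proof -
  let ?M = "Poly_Mapping.keys p \<union> Poly_Mapping.keys q"
  have "poly_value S (p + q) = (\<Oplus>m\<in>?M. Poly_Mapping.lookup p m \<odot> monom_value S m \<oplus> Poly_Mapping.lookup q m \<odot> monom_value S m)"
    using smult_l_distr
    by (subst poly_value_superset[of ?M])
      (auto simp: lookup_add ring_of_type_algebra_def keys_add intro!: finsum_cong')
  also have "\<dots> = (\<Oplus>m\<in>?M. Poly_Mapping.lookup p m \<odot> monom_value S m) \<oplus> (\<Oplus>m\<in>?M. Poly_Mapping.lookup q m \<odot> monom_value S m)"
    by (intro finsum_addf) auto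
  also have "\<dots> = poly_value S p \<oplus> poly_value S q"
    by (simp add: poly_value_superset[of ?M p] poly_value_superset[of ?M q])
  finally show ?thesis .
qed

lemma poly_value_single_mult:
  "poly_value S (Poly_Mapping.single m c * Poly_Mapping.single n d) =
    (c \<odot> monom_value S m) \<otimes> (d \<odot> monom_value S n)"
proof -
  have assoc1: "(a * b) \<odot> x = a \<odot> (b \<odot> x)" if "x \<in> carrier A" for a b x
    using smult_assoc1[of a b x] that by (simp add: ring_of_type_algebra_def)
  have assoc2: "(a \<odot> x) \<otimes> y = a \<odot> (x \<otimes> y)" if "x \<in> carrier A" "y \<in> carrier A" for a x y
    using smult_assoc2[of a x y] that by (simp add: ring_of_type_algebra_def)
  have "x \<otimes> (d \<odot> y) = d \<odot> (x \<otimes> y)" if "x \<in> carrier A" "y \<in> carrier A" for x y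
    using assoc2[of y x d] that by (simp add: m_comm)
  moreover have "c \<odot> (d \<odot> x) = d \<odot> (c \<odot> x)" if "x \<in> carrier A" for x
    using assoc1[OF that, of c d] assoc1[OF that, of d c] by (simp add: mult.commute)
  ultimately show ?thesis
    by (simp add: mult_single poly_value_single monom_value_add assoc1 assoc2)
qed

text \<open>Both sides are additive in each factor, so products of two single terms decide.\<close>

lemma poly_value_mult: "poly_value S (p * q) = poly_value S p \<otimes> poly_value S q"
proof (induction p rule: poly_mapping_single_add_induct)
  case (2 m c)
  show ?case
    by (induction q rule: poly_mapping_single_add_induct)
      (simp_all add: poly_value_zero poly_value_closed poly_value_single_mult poly_value_single
        distrib_left poly_value_add r_distr)
qed (simp_all add: poly_value_zero poly_value_closed distrib_right poly_value_add l_distr)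

lemma poisson_presentation_poly_value:
  assumes gen: "generate_ring A (scalars A \<union> S) = carrier A"
  shows "poisson_presentation A (Poly_Mapping.single 0) (poly_value S)
    ((\<lambda>x. Poly_Mapping.single (Poly_Mapping.single x 1) 1) ` S)"
proof unfold_locales
  let ?G = "(\<lambda>x. Poly_Mapping.single (Poly_Mapping.single x 1) 1) ` S"
  let ?C = "subalgebra_gen (Poly_Mapping.single 0 :: complex \<Rightarrow> ('a \<Rightarrow>\<^sub>0 nat) \<Rightarrow>\<^sub>0 complex) ?G"
  show add: "Poly_Mapping.single 0 (a + b) = Poly_Mapping.single 0 a + Poly_Mapping.single 0 b"
    and mult: "Poly_Mapping.single 0 (a * b) = Poly_Mapping.single 0 a * Poly_Mapping.single 0 b"
    and one: "Poly_Mapping.single 0 1 = (1 :: ('a \<Rightarrow>\<^sub>0 nat) \<Rightarrow>\<^sub>0 complex)" for a b :: complex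
    by (simp_all add: single_add mult_single)
  show "finite ?G" using S by simp
  show iota: "poly_value S (Poly_Mapping.single 0 c) = c \<odot> \<one>" for c
    by (simp add: poly_value_single monom_value_zero)
  show "carrier A \<subseteq> poly_value S ` ?C"
  proof
    fix x assume "x \<in> carrier A"
    then have "x \<in> generate_ring A (scalars A \<union> S)" using gen by simp
    then show "x \<in> poly_value S ` ?C"
    proof induction
      case one
      have "poly_value S (Poly_Mapping.single 0 1) = \<one>" by (simp add: iota scalar_one del: single_one)
      then show ?case using subalgebra_gen.scalar by (metis image_eqI)
    next
      case (incl h)
      show ?case
      proof (cases "h \<in> S")
        case True
        then have "poly_value S (Poly_Mapping.single (Poly_Mapping.single h 1) 1) = h"
          using S by (auto simp: poly_value_single monom_value_single scalar_one simp del: One_nat_def)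
        moreover have "Poly_Mapping.single (Poly_Mapping.single h 1) 1 \<in> ?C"
          using True by (intro subalgebra_gen.generator) simp
        ultimately show ?thesis by (metis image_eqI)
      next
        case False
        then obtain c where "h = c \<odot> \<one>" using incl by (auto simp: scalars_def)
        then show ?thesis using subalgebra_gen.scalar by (metis iota image_eqI)
      qed
    next
      case (a_inv h)
      then obtain p where p: "p \<in> ?C" "h = poly_value S p" by blast
      \<comment> \<open>\<open>subalgebra_gen\<close> has no rule for negation; it is multiplication
        by the scalar -1.\<close>
      have "Poly_Mapping.single 0 (- 1) * p \<in> ?C"
        using p(1) by (intro subalgebra_gen.mult subalgebra_gen.scalar)
      moreover have "Poly_Mapping.single 0 (- 1) * p = - p"
        by (simp add: single_uminus)
      moreover have "poly_value S (- p) = \<ominus> h"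
        using poly_value_add[of "- p" p] minus_equality[of "poly_value S (- p)" h]
        by (simp add: p(2) poly_value_zero poly_value_closed)
      ultimately show ?case by (metis image_eqI)
    next
      case (eng_add h1 h2)
      then obtain p q where "p \<in> ?C" "h1 = poly_value S p" "q \<in> ?C" "h2 = poly_value S q" by blast
      then show ?case by (intro image_eqI[of _ _ "p + q"] subalgebra_gen.add) (simp_all add: poly_value_add)
    next
      case (eng_mult h1 h2)
      then obtain p q where "p \<in> ?C" "h1 = poly_value S p" "q \<in> ?C" "h2 = poly_value S q" by blast
      then show ?case by (intro image_eqI[of _ _ "p * q"] subalgebra_gen.mult) (simp_all add: poly_value_mult)
    qed
  qed
qed (rule poly_value_closed poly_value_add poly_value_mult)+

end

end

theorem theoremA:
  fixes A :: "('a, 'm) poisson_algebra_scheme"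
  assumes "complex_affine_poisson_algebra A"
  shows "poisson_dixmier_moeglin A \<longleftrightarrow>
    (\<forall>P\<in>Pspec A. minimal_Pspec_over A P \<prec> (UNIV :: complex set)
        \<longrightarrow> finite (minimal_Pspec_over A P))"
proof -
  interpret complex_affine_poisson_algebra A by fact
  obtain S where S: "finite S" "S \<subseteq> carrier A" "generate_ring A (scalars A \<union> S) = carrier A"
    using finitely_generated by blast
  show ?thesis
    by (rule poisson_presentation.dixmier_moeglin_iff_minimal_finite
        [OF poisson_presentation_poly_value[OF S]])
qed

end
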